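(* Assume that the quadratic Schrödinger equation $$i\partial_t u=-\partial_x^2u+\mu|u|^2\quad\text{on }(0,T)\times\mathbb T,\qquad u(0)=u_0,$$ admits an exact solution $u\in C([0,T];H^r(\mathbb T))$ with $r>1/2$. Let $U_n^k$ denote the parareal approximation at the $k$-th iteration and the $n$-th coarse grid point $T_n=n\tau$ obtained with the exact fine propagator $\mathcal F_\tau$ and the coarse propagator $\mathcal G_\tau(v)=e^{i\tau\partial_x^2}v+\Phi_{c,1}(\tau;v)$, where $$\Phi_{c,1}(\tau;v)=-i\mu\tau\,\overline{\hat v_0}\,e^{i\tau\partial_x^2}v-\frac{i\mu\tau}{2\pi}\|v\|_{L^2}^2+i\mu\tau|\hat v_0|^2+\frac{\mu}{2}\partial_x^{-1}\Big[\big(e^{i\tau\partial_x^2}v\big)\big(e^{-i\tau\partial_x^2}\partial_x^{-1}\bar v\big)-e^{i\tau\partial_x^2}\big(v\,\partial_x^{-1}\bar v\big)\Big],$$ and let $U_n=u(T_n)$ be the exact solution. Then there exist constants $\tau_0$, $C_1$ and $C_2$, independent of $n$ and $k$, such that, for any $0<\tau\le\tau_0$, $$\max_{1\le n\le N_c}\|U_n^k-U_n\|_{H^r}\le C_1(C_2\tau)^k .$$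
   Context: $\mathbb T=(0,2\pi)$ with periodic boundary conditions; $\mu$ is the constant coefficient of the nonlinearity; $\tau$ is the coarse time-step size and $N_c=T/\tau\in\mathbb N$ is the number of coarse intervals. Fourier series: $f(x)=\sum_{k\in\mathbb Z}\hat f_k e^{ikx}$, so $\hat f_0$ is the mean of $f$. The regularized inverse derivative is $\partial_x^{-1}f(x)=\sum_{k\ne0}(ik)^{-1}\hat f_k e^{ikx}$ (zero mode set to $0$). $\|v\|_{L^2}^2=\int_{\mathbb T}|v|^2dx$. Exact fine propagator: $\mathcal F_\tau(v)$ is the value at time $\tau$ of the exact solution of the equation with initial value $v$ at time $0$. Parareal algorithm: $U_0^k=u_0$ for all $k$, and $$U_{n+1}^0=\mathcal G_\tau(U_n^0),\qquad U_{n+1}^{k+1}=\mathcal G_\tau(U_n^{k+1})+(\mathcal F_\tau-\mathcal G_\tau)(U_n^k),$$ for $n=0,\dots,N_c-1$ and $k=0,1,2,\dots$. *)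

theory Defs
  imports "HOL-Analysis.Analysis"
begin

text \<open>
  Functions on the torus are represented by functions \<open>real \<Rightarrow> complex\<close> of which only the values
  on \<open>(0, 2\<pi>)\<close>, up to null sets, are relevant. Periodicity enters through the Fourier
  coefficients and through the periodic test functions.
\<close>

abbreviation torus :: "real measure" where
  "torus \<equiv> lebesgue_on {0<..<2 * pi}"

definition fourier_coeff :: "(real \<Rightarrow> complex) \<Rightarrow> int \<Rightarrow> complex" where
  "fourier_coeff f k = (1 / (2 * pi)) * (LINT x|torus. f x * exp (- (\<i> * of_int k * of_real x)))"

definition L2 :: "(real \<Rightarrow> complex) set" where
  "L2 = {f. f \<in> borel_measurable torus \<and> integrable torus (\<lambda>x. (cmod (f x))\<^sup>2)}"

definition norm_L2 :: "(real \<Rightarrow> complex) \<Rightarrow> real" where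
  "norm_L2 f = sqrt (LINT x|torus. (cmod (f x))\<^sup>2)"

text \<open>The usual Sobolev space for exponents \<open>r \<ge> 0\<close>, which are the only ones needed.\<close>

definition sobolev :: "real \<Rightarrow> (real \<Rightarrow> complex) set" where
  "sobolev r = {f \<in> L2.
     (\<lambda>k::int. (1 + (of_int k)\<^sup>2) powr r * (cmod (fourier_coeff f k))\<^sup>2) summable_on UNIV}"

text \<open>
  The factor \<open>2\<pi>\<close> makes the norm for \<open>r = 0\<close> equal to \<open>norm_L2\<close>. The value is
  meaningful only for members of \<open>sobolev r\<close>.
\<close>

definition norm_sobolev :: "real \<Rightarrow> (real \<Rightarrow> complex) \<Rightarrow> real" where
  "norm_sobolev r f =
     sqrt (2 * pi * (\<Sum>\<^sub>\<infinity>k::int. (1 + (of_int k)\<^sup>2) powr r * (cmod (fourier_coeff f k))\<^sup>2))"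

text \<open>
  The operator \<open>exp (i t \<partial>\<^sub>x\<^sup>2)\<close> for \<open>t\<close> of either sign. The series is summed pointwise; this is
  appropriate for functions with absolutely summable Fourier coefficients, in particular on
  \<open>sobolev r\<close> with \<open>r > 1/2\<close>.
\<close>

definition schroedinger_group :: "real \<Rightarrow> (real \<Rightarrow> complex) \<Rightarrow> real \<Rightarrow> complex" where
  "schroedinger_group t f x =
     (\<Sum>\<^sub>\<infinity>k::int. exp (- (\<i> * of_real t * (of_int k)\<^sup>2)) * fourier_coeff f k
        * exp (\<i> * of_int k * of_real x))"

definition inv_dx :: "(real \<Rightarrow> complex) \<Rightarrow> real \<Rightarrow> complex" where
  "inv_dx f x =
     (\<Sum>\<^sub>\<infinity>k\<in>UNIV - {0::int}. inverse (\<i> * of_int k) * fourier_coeff f k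
        * exp (\<i> * of_int k * of_real x))"

definition continuous_into_sobolev :: "real \<Rightarrow> real \<Rightarrow> (real \<Rightarrow> real \<Rightarrow> complex) \<Rightarrow> bool" where
  "continuous_into_sobolev r T u \<longleftrightarrow>
     (\<forall>t\<in>{0..T}. u t \<in> sobolev r) \<and>
     (\<forall>t\<in>{0..T}. ((\<lambda>s. norm_sobolev r (\<lambda>x. u s x - u t x)) \<longlongrightarrow> 0) (at t within {0..T}))"

definition dx :: "(real \<Rightarrow> complex) \<Rightarrow> real \<Rightarrow> complex" where
  "dx \<phi> = (\<lambda>x. vector_derivative \<phi> (at x))"

definition periodic_test_function :: "(real \<Rightarrow> complex) \<Rightarrow> bool" where
  "periodic_test_function \<phi> \<longleftrightarrow>
     (\<forall>x. \<phi> (x + 2 * pi) = \<phi> x) \<and> (\<forall>n x. ((dx ^^ n) \<phi>) differentiable (at x))"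

text \<open>
  A solution of \<open>i \<partial>\<^sub>t u = - \<partial>\<^sub>x\<^sup>2 u + \<mu> |u|\<^sup>2\<close> on \<open>(0,T)\<close> times the torus, with \<open>u(0) = u\<^sub>0\<close>, in
  \<open>C([0,T]; H\<^sup>r)\<close>. As \<open>u(t)\<close> is in general not twice differentiable in space, the equation holds
  in the sense of distributions on the torus at each time: it is tested against smooth periodic
  functions, and the two space derivatives are moved to the test function.
\<close>

definition exact_solution ::
  "complex \<Rightarrow> real \<Rightarrow> real \<Rightarrow> (real \<Rightarrow> complex) \<Rightarrow> (real \<Rightarrow> real \<Rightarrow> complex) \<Rightarrow> bool" where
  "exact_solution \<mu> r T u0 u \<longleftrightarrow>
     continuous_into_sobolev r T u \<and>
     (AE x in torus. u 0 x = u0 x) \<and>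
     (\<forall>\<phi>. periodic_test_function \<phi> \<longrightarrow> (\<forall>t\<in>{0<..<T}. \<exists>D.
        ((\<lambda>s. LINT x|torus. u s x * \<phi> x) has_vector_derivative D) (at t) \<and>
        \<i> * D = - (LINT x|torus. u t x * dx (dx \<phi>) x)
                 + \<mu> * (LINT x|torus. of_real ((cmod (u t x))\<^sup>2) * \<phi> x)))"

text \<open>
  Solutions with \<open>r > 1/2\<close> are unique up to null sets at each time, so the choice only selects a
  representative. Nothing is known about the value if there is no solution up to time \<open>\<tau>\<close>.
\<close>

definition fine_propagator ::
  "complex \<Rightarrow> real \<Rightarrow> real \<Rightarrow> (real \<Rightarrow> complex) \<Rightarrow> real \<Rightarrow> complex" where
  "fine_propagator \<mu> r \<tau> v = (SOME u. exact_solution \<mu> r \<tau> v u) \<tau>"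

definition Phi_c1 :: "complex \<Rightarrow> real \<Rightarrow> (real \<Rightarrow> complex) \<Rightarrow> real \<Rightarrow> complex" where
  "Phi_c1 \<mu> \<tau> v x =
     - \<i> * \<mu> * of_real \<tau> * cnj (fourier_coeff v 0) * schroedinger_group \<tau> v x
     - \<i> * \<mu> * of_real \<tau> / (2 * of_real pi) * of_real ((norm_L2 v)\<^sup>2)
     + \<i> * \<mu> * of_real \<tau> * of_real ((cmod (fourier_coeff v 0))\<^sup>2)
     + \<mu> / 2 * inv_dx (\<lambda>y.
         schroedinger_group \<tau> v y * schroedinger_group (- \<tau>) (inv_dx (\<lambda>z. cnj (v z))) y
         - schroedinger_group \<tau> (\<lambda>z. v z * inv_dx (\<lambda>w. cnj (v w)) z) y) x"

definition coarse_propagator ::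
  "complex \<Rightarrow> real \<Rightarrow> (real \<Rightarrow> complex) \<Rightarrow> real \<Rightarrow> complex" where
  "coarse_propagator \<mu> \<tau> v x = schroedinger_group \<tau> v x + Phi_c1 \<mu> \<tau> v x"

text \<open>\<open>parareal F G u0 n k\<close> is the iterate with time index \<open>n\<close> and iteration index \<open>k\<close>.\<close>

fun parareal ::
  "((real \<Rightarrow> complex) \<Rightarrow> real \<Rightarrow> complex) \<Rightarrow> ((real \<Rightarrow> complex) \<Rightarrow> real \<Rightarrow> complex) \<Rightarrow>
   (real \<Rightarrow> complex) \<Rightarrow> nat \<Rightarrow> nat \<Rightarrow> real \<Rightarrow> complex" where
  "parareal F G u0 0 k = u0"
| "parareal F G u0 (Suc n) 0 = G (parareal F G u0 n 0)"
| "parareal F G u0 (Suc n) (Suc k) =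
     (\<lambda>x. G (parareal F G u0 n (Suc k)) x
        + (F (parareal F G u0 n k) x - G (parareal F G u0 n k) x))"

end

theory Submission
  imports Defs
begin

text \<open>
  With \<open>v(t) = exp (- i t \<partial>\<^sub>x\<^sup>2) u(t)\<close> the equation becomes, in Fourier space, an integral
  equation whose quadratic right hand side is bounded on weighted square-summable sequences because
  \<open>r > 1/2\<close>. The coarse propagator is exactly the first Picard iterate of this integral
  equation: the integral over \<open>[0,\<tau>]\<close> of the phase \<open>exp (- 2 i s k j)\<close> is evaluated in closed form.
  Hence \<open>F - G\<close> is Lipschitz with constant \<open>O(\<tau>\<^sup>2)\<close> on bounded sets, \<open>G\<close> is Lipschitz with constant
  \<open>1 + O(\<tau>)\<close>, and the parareal errors satisfy
  \<open>E(n+1,k+1) \<le> (1 + L \<tau>) E(n,k+1) + D \<tau>\<^sup>2 E(n,k)\<close>. Summing over the \<open>T/\<tau>\<close> steps gains a factor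
  \<open>O(\<tau>)\<close> per iteration.
\<close>

section \<open>Weighted square-summable families\<close>

text \<open>The fine propagator is chosen by \<open>SOME\<close> among distributional solutions, so
  its value is unknown until existence and uniqueness are settled, and this for every parareal
  iterate, not just for u0. Hence exact and mild solutions are shown to correspond in both
  directions, and local existence comes with a time that depends only on the size of the data. The
  Lipschitz bounds hold on bounded sets only. That the iterates stay in one is part of the
  induction: the error bound \<open>M * (S * \<tau>) ^ Suc k\<close> is at most 1 for small \<tau>,
  which keeps every iterate in the ball of radius \<open>M + 1\<close>. The order \<tau>^2 of F - G
  costs no derivatives: in the interaction picture the solution is Lipschitz in time in the H^r norm
  itself, since the oscillating phases have modulus 1 and are never differentiated.\<close>

definition sob_weight :: "real \<Rightarrow> int \<Rightarrow> real" where
  "sob_weight r k = (1 + (of_int k)\<^sup>2) powr (r / 2)"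

text \<open>Bounding all finite sums encodes membership and a norm bound in one predicate: no
  summability has to be carried along, and the property survives limits that are only
  coefficientwise. Up to the factor sqrt (2 pi), M bounds the Sobolev norm of a function with
  coefficients a.\<close>

definition sob_le :: "real \<Rightarrow> (int \<Rightarrow> complex) \<Rightarrow> real \<Rightarrow> bool" where
  "sob_le r a M \<longleftrightarrow> (\<forall>F. finite F \<longrightarrow> L2_set (\<lambda>k. sob_weight r k * cmod (a k)) F \<le> M)"

lemma sob_weight_pos [simp]: "sob_weight r k > 0"
proof -
  have "1 + (real_of_int k)\<^sup>2 > 0" by (smt (verit) zero_le_power2)
  then show ?thesis by (simp add: sob_weight_def)
qed

lemma sob_weight_nonneg [simp]: "sob_weight r k \<ge> 0"
  using sob_weight_pos[of r k] by linarith

lemma sob_weight_nz [simp]: "sob_weight r k \<noteq> 0"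
  using sob_weight_pos[of r k] by linarith

lemma sob_weight_ge_1: "r \<ge> 0 \<Longrightarrow> sob_weight r k \<ge> 1"
  by (simp add: sob_weight_def ge_one_powr_ge_zero)

lemma sob_weight_square: "(sob_weight r k)\<^sup>2 = (1 + (of_int k)\<^sup>2) powr r"
proof -
  have "1 + (real_of_int k)\<^sup>2 > 0" by (smt (verit) zero_le_power2)
  then show ?thesis by (simp add: sob_weight_def power2_eq_square flip: powr_add)
qed

lemma sob_le_nonneg: "sob_le r a M \<Longrightarrow> M \<ge> 0"
  unfolding sob_le_def by (metis L2_set_empty finite.emptyI)

lemma sob_le_mono: "sob_le r a M \<Longrightarrow> M \<le> N \<Longrightarrow> sob_le r a N"
  unfolding sob_le_def by (meson order_trans)

lemma sob_le_weighted:
  assumes "sob_le r a M" shows "sob_weight r k * cmod (a k) \<le> M"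
  using assms[unfolded sob_le_def, rule_format, of "{k}"] by (simp add: L2_set_def)

lemma sob_le_cmod:
  assumes "sob_le r a M" "r \<ge> 0" shows "cmod (a k) \<le> M"
proof -
  have "1 * cmod (a k) \<le> sob_weight r k * cmod (a k)"
    by (rule mult_right_mono) (use sob_weight_ge_1[OF assms(2)] in auto)
  then show ?thesis using sob_le_weighted[OF assms(1), of k] by simp
qed

lemma sob_le_dominated:
  assumes "sob_le r a M" "\<And>k. cmod (b k) \<le> cmod (a k)" shows "sob_le r b M"
  unfolding sob_le_def
proof (intro allI impI)
  fix F :: "int set" assume F: "finite F"
  have "L2_set (\<lambda>k. sob_weight r k * cmod (b k)) F \<le> L2_set (\<lambda>k. sob_weight r k * cmod (a k)) F"
    by (rule L2_set_mono) (auto intro!: mult_left_mono assms(2))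
  also have "\<dots> \<le> M" using assms(1) F by (auto simp: sob_le_def)
  finally show "L2_set (\<lambda>k. sob_weight r k * cmod (b k)) F \<le> M" .
qed

lemma sob_le_add:
  assumes "sob_le r a M" "sob_le r b N" shows "sob_le r (\<lambda>k. a k + b k) (M + N)"
  unfolding sob_le_def
proof (intro allI impI)
  fix F :: "int set" assume F: "finite F"
  have "L2_set (\<lambda>k. sob_weight r k * cmod (a k + b k)) F
      \<le> L2_set (\<lambda>k. sob_weight r k * cmod (a k) + sob_weight r k * cmod (b k)) F"
    by (rule L2_set_mono) (auto simp: norm_triangle_ineq simp flip: distrib_left)
  also have "\<dots> \<le> L2_set (\<lambda>k. sob_weight r k * cmod (a k)) F + L2_set (\<lambda>k. sob_weight r k * cmod (b k)) F"
    by (rule L2_set_triangle_ineq)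
  also have "\<dots> \<le> M + N" using assms F unfolding sob_le_def by (intro add_mono) auto
  finally show "L2_set (\<lambda>k. sob_weight r k * cmod (a k + b k)) F \<le> M + N" .
qed

lemma sob_le_uminus: "sob_le r a M \<Longrightarrow> sob_le r (\<lambda>k. - a k) M"
  by (erule sob_le_dominated) auto

lemma sob_le_diff:
  assumes "sob_le r a M" "sob_le r b N" shows "sob_le r (\<lambda>k. a k - b k) (M + N)"
  using sob_le_add[OF assms(1) sob_le_uminus[OF assms(2)]] by simp

lemma sob_le_diff_commute: "sob_le r (\<lambda>k. a k - b k) M \<longleftrightarrow> sob_le r (\<lambda>k. b k - a k) M"
  by (auto elim!: sob_le_dominated simp: norm_minus_commute)

lemma sob_le_0: "M \<ge> 0 \<Longrightarrow> sob_le r (\<lambda>k. 0) M"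
  by (simp add: sob_le_def L2_set_def)

lemma sob_le_cmult:
  assumes "sob_le r a M" shows "sob_le r (\<lambda>k. c * a k) (cmod c * M)"
  unfolding sob_le_def
proof (intro allI impI)
  fix F :: "int set" assume F: "finite F"
  have "L2_set (\<lambda>k. sob_weight r k * cmod (c * a k)) F
      = L2_set (\<lambda>k. cmod c * (sob_weight r k * cmod (a k))) F"
    by (simp add: norm_mult mult_ac)
  also have "\<dots> = cmod c * L2_set (\<lambda>k. sob_weight r k * cmod (a k)) F"
    by (simp add: L2_set_right_distrib)
  also have "\<dots> \<le> cmod c * M" using assms F by (auto simp: sob_le_def intro!: mult_left_mono)
  finally show "L2_set (\<lambda>k. sob_weight r k * cmod (c * a k)) F \<le> cmod c * M" .
qed

text \<open>A Fatou argument: each finite set of indices gives an inequality between finitely many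
  convergent quantities. Convergence of every single coefficient is therefore enough, which serves
  for infinite sums, for the Picard limit and for bounds that tend to 0.\<close>

lemma sob_le_tendsto:
  assumes "\<And>k. ((\<lambda>x. a x k) \<longlongrightarrow> b k) F" "F \<noteq> bot"
    "eventually (\<lambda>x. sob_le r (a x) (M x)) F" "(M \<longlongrightarrow> M') F"
  shows "sob_le r b M'"
  unfolding sob_le_def
proof (intro allI impI)
  fix J :: "int set" assume J: "finite J"
  have 1: "((\<lambda>x. L2_set (\<lambda>k. sob_weight r k * cmod (a x k)) J) \<longlongrightarrow> L2_set (\<lambda>k. sob_weight r k * cmod (b k)) J) F"
    unfolding L2_set_def by (intro tendsto_intros assms(1))
  show "L2_set (\<lambda>k. sob_weight r k * cmod (b k)) J \<le> M'"
    by (rule tendsto_le[OF assms(2,4) 1]) (use assms(3) J in \<open>auto simp: sob_le_def elim!: eventually_mono\<close>)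
qed

text \<open>Minkowski's integral inequality by duality: the square of the weighted norm S of the
  integral is itself an integral of pairings with the fixed family I, and Cauchy-Schwarz bounds the
  integrand by S times m. Dividing by S gives the claim.\<close>

lemma L2_set_integral_le:
  fixes g :: "real \<Rightarrow> 'i \<Rightarrow> complex"
  assumes F: "finite F" and c: "\<And>k. k \<in> F \<Longrightarrow> continuous_on {a..b} (\<lambda>s. g s k)"
    and m: "continuous_on {a..b} m" and w: "\<And>k. k \<in> F \<Longrightarrow> w k \<ge> 0"
    and le: "\<And>s. s \<in> {a..b} \<Longrightarrow> L2_set (\<lambda>k. w k * cmod (g s k)) F \<le> m s"
  shows "L2_set (\<lambda>k. w k * cmod (integral {a..b} (\<lambda>s. g s k))) F \<le> integral {a..b} m"
proof -
  define I where "I k = integral {a..b} (\<lambda>s. g s k)" for k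
  define S where "S = L2_set (\<lambda>k. w k * cmod (I k)) F"
  have S0: "S \<ge> 0" by (simp add: S_def L2_set_nonneg)
  have m0: "m s \<ge> 0" if "s \<in> {a..b}" for s using le[OF that] L2_set_nonneg order_trans by blast
  have gi: "(\<lambda>s. g s k) integrable_on {a..b}" if "k \<in> F" for k
    using integrable_continuous_interval[OF c[OF that]] .
  have mi: "m integrable_on {a..b}" using integrable_continuous_interval[OF m] .
  have "of_real (S\<^sup>2) = (\<Sum>k\<in>F. of_real ((w k)\<^sup>2) * (cnj (I k) * I k))"
    unfolding mult.commute[of "cnj _"] complex_norm_square[symmetric]
    by (simp add: S_def L2_set_def sum_nonneg power_mult_distrib)
  also have "\<dots> = (\<Sum>k\<in>F. integral {a..b} (\<lambda>s. of_real ((w k)\<^sup>2) * cnj (I k) * g s k))"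
    by (intro sum.cong refl) (simp add: I_def[symmetric])
  also have "\<dots> = integral {a..b} (\<lambda>s. \<Sum>k\<in>F. of_real ((w k)\<^sup>2) * cnj (I k) * g s k)"
    by (subst integral_sum) (auto intro!: F integrable_continuous_interval continuous_intros c)
  finally have eq: "of_real (S\<^sup>2) = \<dots>" .
  have "S\<^sup>2 = cmod (of_real (S\<^sup>2))" by (metis norm_of_real abs_power2)
  also have "\<dots> \<le> integral {a..b} (\<lambda>s. S * m s)"
    unfolding eq
  proof (rule integral_norm_bound_integral)
    show "(\<lambda>s. \<Sum>k\<in>F. of_real ((w k)\<^sup>2) * cnj (I k) * g s k) integrable_on {a..b}"
      by (auto intro!: F integrable_continuous_interval continuous_intros c)
    show "(\<lambda>s. S * m s) integrable_on {a..b}" 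
      by (intro integrable_continuous_interval continuous_intros m)
    fix s assume s: "s \<in> {a..b}"
    have "cmod (\<Sum>k\<in>F. of_real ((w k)\<^sup>2) * cnj (I k) * g s k)
        \<le> (\<Sum>k\<in>F. (w k * cmod (I k)) * (w k * cmod (g s k)))"
      by (rule order_trans[OF norm_sum]) (auto intro!: sum_mono simp: norm_mult norm_power power2_eq_square mult_ac)
    also have "\<dots> \<le> (\<Sum>k\<in>F. \<bar>w k * cmod (I k)\<bar> * \<bar>w k * cmod (g s k)\<bar>)"
      by (rule sum_mono) (metis abs_ge_self abs_mult)
    also have "\<dots> \<le> S * L2_set (\<lambda>k. w k * cmod (g s k)) F"
      unfolding S_def by (rule L2_set_mult_ineq)
    also have "\<dots> \<le> S * m s" by (rule mult_left_mono[OF le[OF s] S0])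
    finally show "cmod (\<Sum>k\<in>F. of_real ((w k)\<^sup>2) * cnj (I k) * g s k) \<le> S * m s" .
  qed
  also have "\<dots> = S * integral {a..b} m" by simp
  finally have "S * S \<le> S * integral {a..b} m" by (simp add: power2_eq_square)
  moreover have "integral {a..b} m \<ge> 0" by (rule integral_nonneg[OF mi m0])
  ultimately have "S \<le> integral {a..b} m"
    using S0 by (cases "S = 0") auto
  then show ?thesis by (simp add: S_def I_def)
qed

lemma sob_le_integral:
  fixes g :: "real \<Rightarrow> int \<Rightarrow> complex"
  assumes "\<And>k. continuous_on {a..b} (\<lambda>s. g s k)" "continuous_on {a..b} m"
    and "\<And>s. s \<in> {a..b} \<Longrightarrow> sob_le r (g s) (m s)"
  shows "sob_le r (\<lambda>k. integral {a..b} (\<lambda>s. g s k)) (integral {a..b} m)"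
  unfolding sob_le_def
proof (intro allI impI)
  fix F :: "int set" assume F: "finite F"
  show "L2_set (\<lambda>k. sob_weight r k * cmod (integral {a..b} (\<lambda>s. g s k))) F \<le> integral {a..b} m"
    by (rule L2_set_integral_le[OF F _ assms(2), where w = "sob_weight r"]) (use assms(1,3) F in \<open>auto simp: sob_le_def\<close>)
qed

lemma sob_le_integral_const:
  fixes g :: "real \<Rightarrow> int \<Rightarrow> complex"
  assumes "\<And>k. continuous_on {a..b} (\<lambda>s. g s k)" "a \<le> b"
    and "\<And>s. s \<in> {a..b} \<Longrightarrow> sob_le r (g s) M"
  shows "sob_le r (\<lambda>k. integral {a..b} (\<lambda>s. g s k)) ((b - a) * M)"
  using sob_le_integral[of a b g "\<lambda>_. M" r] assms by simp

section \<open>The embedding into absolutely summable families\<close>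

lemma summable_on_int_iff_nat:
  fixes f :: "int \<Rightarrow> real"
  assumes "(\<lambda>n. f (int n)) summable_on UNIV" "(\<lambda>n. f (- int n)) summable_on UNIV"
  shows "f summable_on UNIV"
proof -
  have 1: "f summable_on range int" using assms(1) by (subst summable_on_reindex) (auto simp: o_def)
  have "f summable_on range (\<lambda>n. - int n)"
    using assms(2) by (subst summable_on_reindex) (auto simp: o_def inj_on_def)
  then have 2: "f summable_on range (\<lambda>n. - int n) - range int"
    by (rule summable_on_subset_banach) auto
  have "f summable_on range int \<union> (range (\<lambda>n. - int n) - range int)"
    by (rule summable_on_Un_disjoint[OF 1 2]) auto
  moreover have "range int \<union> (range (\<lambda>n. - int n) - range int) = UNIV"
    by (auto) (metis int_cases2 rangeI)
  ultimately show ?thesis by simp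
qed

text \<open>The threshold 1/2 comes from here: the terms are compared with n to the power - 2
  r.\<close>

lemma summable_on_inverse_sob_weight:
  assumes "r > 1/2" shows "(\<lambda>k. (inverse (sob_weight r k))\<^sup>2) summable_on UNIV"
proof -
  have "summable (\<lambda>n. (inverse (sob_weight r (int n)))\<^sup>2)"
  proof (rule summable_comparison_test_ev)
    show "summable (\<lambda>n. real n powr (- 2 * r))"
      using assms by (subst summable_real_powr_iff) auto
    show "eventually (\<lambda>n. norm ((inverse (sob_weight r (int n)))\<^sup>2) \<le> real n powr (- 2 * r)) sequentially"
      using eventually_gt_at_top[of 0]
    proof eventually_elim
      case (elim n)
      have "real n powr (2 * r) = ((real n)\<^sup>2) powr r"
        by (metis elim of_nat_0_less_iff powr_powr powr_numeral less_imp_le)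
      also have "\<dots> \<le> (1 + (real n)\<^sup>2) powr r" using assms by (intro powr_mono2) auto
      finally have "real n powr (2 * r) \<le> (sob_weight r (int n))\<^sup>2" by (simp add: sob_weight_square)
      then have "inverse ((sob_weight r (int n))\<^sup>2) \<le> inverse (real n powr (2 * r))"
        by (rule le_imp_inverse_le) (use elim in auto)
      then show ?case by (simp add: power_inverse powr_minus)
    qed
  qed
  then have *: "(\<lambda>n. (inverse (sob_weight r (int n)))\<^sup>2) summable_on UNIV"
    by (subst summable_on_UNIV_nonneg_real_iff) auto
  have "sob_weight r (- k) = sob_weight r k" for k by (simp add: sob_weight_def)
  then show ?thesis by (intro summable_on_int_iff_nat) (use * in auto)
qed

text \<open>The Cauchy-Schwarz constant of the embedding of H^r into the absolutely summable
  families, for r > 1/2.\<close>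

definition sob_emb :: "real \<Rightarrow> real" where
  "sob_emb r = sqrt (\<Sum>\<^sub>\<infinity>k. (inverse (sob_weight r k))\<^sup>2)"

lemma sob_emb_nonneg [simp]: "sob_emb r \<ge> 0"
  by (simp add: sob_emb_def infsum_nonneg)

lemma L2_set_inverse_sob_weight_le:
  assumes "r > 1/2" "finite F" shows "L2_set (\<lambda>k. inverse (sob_weight r k)) F \<le> sob_emb r"
  unfolding L2_set_def sob_emb_def
  by (intro real_sqrt_le_mono finite_sum_le_infsum summable_on_inverse_sob_weight assms) auto

text \<open>The norm of the inverse weights is kept over F instead of being bounded by
  \<open>sob_emb\<close> at once: over sets far out it is small, uniformly for all families in a
  ball.\<close>

lemma sob_le_sum_cmod:
  assumes "sob_le r a M" "finite F"
  shows "(\<Sum>k\<in>F. cmod (a k)) \<le> M * L2_set (\<lambda>k. inverse (sob_weight r k)) F"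
proof -
  have "(\<Sum>k\<in>F. cmod (a k)) = (\<Sum>k\<in>F. \<bar>sob_weight r k * cmod (a k)\<bar> * \<bar>inverse (sob_weight r k)\<bar>)"
    by (intro sum.cong refl) (simp add: abs_mult)
  also have "\<dots> \<le> L2_set (\<lambda>k. sob_weight r k * cmod (a k)) F * L2_set (\<lambda>k. inverse (sob_weight r k)) F"
    by (rule L2_set_mult_ineq)
  also have "\<dots> \<le> M * L2_set (\<lambda>k. inverse (sob_weight r k)) F"
    by (rule mult_right_mono) (use assms in \<open>auto simp: sob_le_def L2_set_nonneg\<close>)
  finally show ?thesis .
qed

lemma sob_le_sum_cmod_emb:
  assumes "sob_le r a M" "finite F" "r > 1/2"
  shows "(\<Sum>k\<in>F. cmod (a k)) \<le> M * sob_emb r"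
  using order_trans[OF sob_le_sum_cmod[OF assms(1,2)] 
     mult_left_mono[OF L2_set_inverse_sob_weight_le[OF assms(3,2)] sob_le_nonneg[OF assms(1)]]] .

lemma sob_le_abs_summable:
  assumes "sob_le r a M" "r > 1/2"
  shows "(\<lambda>k. cmod (a k)) summable_on UNIV"
  by (rule nonneg_bdd_above_summable_on)
     (auto simp: bdd_above_def intro!: exI[of _ "M * sob_emb r"] sob_le_sum_cmod_emb[OF assms(1) _ assms(2)])

text \<open>Used in two ways: with the inverse weights, J serves all families in a ball at once;
  with the weighted coefficients of a single family, J depends on that family.\<close>

lemma small_tail:
  fixes g :: "int \<Rightarrow> real"
  assumes g: "(\<lambda>k. (g k)\<^sup>2) summable_on UNIV" and e: "e > 0"
  shows "\<exists>J. finite J \<and> (\<forall>F. finite F \<longrightarrow> F \<inter> J = {} \<longrightarrow> L2_set g F \<le> e)"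
proof -
  let ?g = "\<lambda>k. (g k)\<^sup>2"
  have "\<forall>\<^sub>F J in finite_subsets_at_top UNIV. dist (sum ?g J) (infsum ?g UNIV) < e\<^sup>2"
    by (rule tendstoD[OF has_sum_infsum[OF g, unfolded has_sum_def]]) (use e in simp)
  then obtain J where J: "finite J" and d: "dist (sum ?g J) (infsum ?g UNIV) < e\<^sup>2"
    unfolding eventually_finite_subsets_at_top by blast
  have "L2_set g F \<le> e" if F: "finite F" "F \<inter> J = {}" for F
  proof -
    have "sum ?g F + sum ?g J = sum ?g (F \<union> J)" using F J by (simp add: sum.union_disjoint)
    also have "\<dots> \<le> infsum ?g UNIV" by (rule finite_sum_le_infsum[OF g]) (use F J in auto)
    finally have "sum ?g F \<le> e\<^sup>2" using d by (simp add: dist_real_def)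
    then show ?thesis unfolding L2_set_def using e by (intro real_le_lsqrt) (auto intro: sum_nonneg)
  qed
  with J show ?thesis by blast
qed

lemmas sob_emb_tail = small_tail[OF summable_on_inverse_sob_weight]

section \<open>The interaction in Fourier space\<close>

abbreviation osc :: "real \<Rightarrow> int \<Rightarrow> int \<Rightarrow> complex" where
  "osc s k j \<equiv> exp (- (2 * \<i> * of_real s * of_int k * of_int j))"

text \<open>In terms of \<open>v(t) = exp (- i t \<partial>\<^sub>x\<^sup>2) u(t)\<close> the equation reads
  \<open>d/dt v\<^sub>k = - i \<mu> interaction t v v k\<close>: the phases of \<open>|u|\<^sup>2\<close> combine to
  \<open>k\<^sup>2 - (k + j)\<^sup>2 + j\<^sup>2 = - 2 k j\<close>.\<close>

definition interaction :: "real \<Rightarrow> (int \<Rightarrow> complex) \<Rightarrow> (int \<Rightarrow> complex) \<Rightarrow> int \<Rightarrow> complex" where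
  "interaction s a b k =
     (\<Sum>\<^sub>\<infinity>j. osc s k j * (a (k + j) * cnj (b j)))"

lemma cmod_phase [simp]: "cmod (osc s k j) = 1"
proof -
  have "- (2 * \<i> * of_real s * of_int k * of_int j) = \<i> * of_real (- (2 * s * k * j))" by simp
  then show ?thesis by (metis norm_exp_i_times)
qed

section \<open>Convergence and bilinearity of the interaction\<close>

lemma summable_on_interaction:
  assumes "sob_le r a M" "sob_le r b N" "r > 1/2"
  shows "(\<lambda>j. osc s k j * (a (k + j) * cnj (b j))) summable_on UNIV"
proof (rule abs_summable_summable, rule summable_on_comparison_test)
  show "(\<lambda>j. M * cmod (b j)) summable_on UNIV"
    by (intro summable_on_cmult_right sob_le_abs_summable[OF assms(2,3)])
  show "norm (osc s k j * (a (k + j) * cnj (b j))) \<le> M * cmod (b j)" for j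
    using sob_le_cmod[OF assms(1)] assms(3) by (auto simp: norm_mult intro!: mult_right_mono)
qed auto

lemma has_sum_interaction:
  assumes "sob_le r a M" "sob_le r b N" "r > 1/2"
  shows "((\<lambda>j. osc s k j * (a (k + j) * cnj (b j))) has_sum interaction s a b k) UNIV"
  unfolding interaction_def by (rule has_sum_infsum[OF summable_on_interaction[OF assms]])

lemma interaction_add_left:
  assumes "sob_le r a M" "sob_le r a' M'" "sob_le r b N" "r > 1/2"
  shows "interaction s (\<lambda>k. a k + a' k) b k = interaction s a b k + interaction s a' b k"
  unfolding interaction_def distrib_left distrib_right
  by (intro infsum_add summable_on_interaction[OF assms(1,3,4)] summable_on_interaction[OF assms(2,3,4)])

lemma interaction_add_right:
  assumes "sob_le r a M" "sob_le r b N" "sob_le r b' N'" "r > 1/2"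
  shows "interaction s a (\<lambda>k. b k + b' k) k = interaction s a b k + interaction s a b' k"
  unfolding interaction_def complex_cnj_add distrib_left distrib_right
  by (intro infsum_add summable_on_interaction[OF assms(1,2,4)] summable_on_interaction[OF assms(1,3,4)])

lemma interaction_diff_left:
  assumes "sob_le r a M" "sob_le r a' M'" "sob_le r b N" "r > 1/2"
  shows "interaction s (\<lambda>k. a k - a' k) b k = interaction s a b k - interaction s a' b k"
  using interaction_add_left[OF sob_le_diff[OF assms(1,2)] assms(2-4), of s k] by simp

lemma interaction_diff_right:
  assumes "sob_le r a M" "sob_le r b N" "sob_le r b' N'" "r > 1/2"
  shows "interaction s a (\<lambda>k. b k - b' k) k = interaction s a b k - interaction s a b' k"
  using interaction_add_right[OF assms(1) sob_le_diff[OF assms(2,3)] assms(3,4), of s k] by simp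

text \<open>The output frequency k = (k + j) - j is at most twice as large as the larger of the two
  input frequencies, so its weight can be moved to one of the two factors of the
  convolution.\<close>

lemma sob_weight_peetre:
  assumes "r \<ge> 0"
  shows "sob_weight r k \<le> 2 powr r * (sob_weight r (k + j) + sob_weight r j)"
proof -
  define x y :: real where "x = of_int (k + j)" and "y = of_int j"
  have k: "of_int k = x - y" by (simp add: x_def y_def)
  define m where "m = max (1 + x\<^sup>2) (1 + y\<^sup>2)"
  have m: "m \<ge> 1" by (simp add: m_def le_max_iff_disj)
  have "0 \<le> (x + y)\<^sup>2" by simp
  then have "1 + (x - y)\<^sup>2 \<le> 2 * (1 + x\<^sup>2) + 2 * (1 + y\<^sup>2)"
    by (simp add: power2_eq_square algebra_simps)
  also have "\<dots> \<le> 4 * m"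
  proof -
    have "1 + x\<^sup>2 \<le> m" "1 + y\<^sup>2 \<le> m" by (simp_all add: m_def)
    then have "2 * (1 + x\<^sup>2) + 2 * (1 + y\<^sup>2) \<le> 2 * m + 2 * m"
      by (intro add_mono mult_left_mono) auto
    then show ?thesis by simp
  qed
  finally have "(1 + (x - y)\<^sup>2) powr (r/2) \<le> (4 * m) powr (r/2)"
    by (intro powr_mono2) (use assms in auto)
  also have "\<dots> = 2 powr r * m powr (r/2)"
  proof -
    have "(4::real) powr (r/2) = (2 powr 2) powr (r/2)" by simp
    also have "\<dots> = 2 powr r" by (subst powr_powr) simp
    finally show ?thesis using m by (simp add: powr_mult)
  qed
  also have "\<dots> \<le> 2 powr r * ((1 + x\<^sup>2) powr (r/2) + (1 + y\<^sup>2) powr (r/2))"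
    by (intro mult_left_mono) (auto simp: m_def max_def)
  finally show ?thesis by (simp only: sob_weight_def k x_def[symmetric] y_def[symmetric])
qed

lemma L2_set_sum_le:
  assumes "finite J" shows "L2_set (\<lambda>k. \<Sum>j\<in>J. g j k) F \<le> (\<Sum>j\<in>J. L2_set (g j) F)"
  using assms
proof (induction J rule: finite_induct)
  case empty then show ?case by (simp add: L2_set_def)
next
  case (insert x J)
  then show ?case using L2_set_triangle_ineq[of "g x" "\<lambda>k. \<Sum>j\<in>J. g j k" F] by simp
qed

lemma sob_le_L2_set_shift:
  assumes "sob_le r a M" "finite F"
  shows "L2_set (\<lambda>k. sob_weight r (k + j) * cmod (a (k + j))) F \<le> M"
proof -
  have "L2_set (\<lambda>k. sob_weight r (k + j) * cmod (a (k + j))) F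
      = L2_set (\<lambda>k. sob_weight r k * cmod (a k)) ((\<lambda>k. k + j) ` F)"
    unfolding L2_set_def by (subst sum.reindex) (auto simp: inj_on_def)
  also have "\<dots> \<le> M" using assms by (simp add: sob_le_def)
  finally show ?thesis .
qed

text \<open>The factor 2 counts the two placements of the weight, \<open>2 powr r\<close> comes from
  the weight inequality, and \<open>sob_emb\<close> from summing the unweighted factor
  absolutely.\<close>

definition bil_const :: "real \<Rightarrow> real" where
  "bil_const r = 2 * 2 powr r * sob_emb r"

lemma bil_const_nonneg [simp]: "bil_const r \<ge> 0"
  by (simp add: bil_const_def)

text \<open>Young's inequality for a convolution of l1 and l2: after the weight is split, the
  unweighted factor is summed absolutely, and the weighted one keeps its l2 norm, which translations
  do not change. A finite J avoids all questions of convergence.\<close>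

lemma sob_le_interaction_finite:
  assumes a: "sob_le r a M" and b: "sob_le r b N" and r: "r > 1/2" and J: "finite J"
  shows "sob_le r (\<lambda>k. \<Sum>j\<in>J. osc s k j * (a (k + j) * cnj (b j)))
     (bil_const r * M * N)"
  unfolding sob_le_def
proof (intro allI impI)
  fix F :: "int set" assume F: "finite F"
  let ?w = "sob_weight r"
  let ?S = "\<lambda>k. \<Sum>j\<in>J. osc s k j * (a (k + j) * cnj (b j))"
  define P where "P k = (\<Sum>j\<in>J. cmod (b j) * (?w (k + j) * cmod (a (k + j))))" for k
  define Q where "Q k = (\<Sum>j\<in>J. cmod (a (k + j)) * (?w j * cmod (b j)))" for k
  \<comment> \<open>In Q the weight sits on b, so the summation index has to be that of a, namely i
    = k + j. As J shifted by k varies with k, the sum is enlarged to the common range I.\<close>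
  define I where "I = (\<lambda>(k, j). k + j) ` (F \<times> J)"
  have I: "finite I" using F J by (simp add: I_def)
  define R where "R k = (\<Sum>i\<in>I. cmod (a i) * (?w (- k + i) * cmod (b (- k + i))))" for k
  have QR: "Q k \<le> R k" if k: "k \<in> F" for k
  proof -
    have "Q k = (\<Sum>i\<in>(\<lambda>j. k + j) ` J. cmod (a i) * (?w (- k + i) * cmod (b (- k + i))))"
      unfolding Q_def by (subst sum.reindex) (auto simp: inj_on_def)
    also have "\<dots> \<le> R k" unfolding R_def
      by (rule sum_mono2) (use I k in \<open>auto simp: I_def\<close>)
    finally show ?thesis .
  qed
  have M: "M \<ge> 0" and N: "N \<ge> 0" using a b sob_le_nonneg by auto
  have PF: "L2_set P F \<le> (N * sob_emb r) * M"
  proof -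
    have "L2_set P F \<le> (\<Sum>j\<in>J. L2_set (\<lambda>k. cmod (b j) * (?w (k + j) * cmod (a (k + j)))) F)"
      unfolding P_def by (rule L2_set_sum_le[OF J])
    also have "\<dots> = (\<Sum>j\<in>J. cmod (b j) * L2_set (\<lambda>k. ?w (k + j) * cmod (a (k + j))) F)"
      by (simp add: L2_set_right_distrib)
    also have "\<dots> \<le> (\<Sum>j\<in>J. cmod (b j) * M)"
      by (intro sum_mono mult_left_mono sob_le_L2_set_shift[OF a F]) auto
    also have "\<dots> \<le> (N * sob_emb r) * M"
      unfolding sum_distrib_right[symmetric] by (intro mult_right_mono sob_le_sum_cmod_emb[OF b J r] M)
    finally show ?thesis .
  qed
  have RF: "L2_set R F \<le> (M * sob_emb r) * N"
  proof -
    have "L2_set R F \<le> (\<Sum>i\<in>I. L2_set (\<lambda>k. cmod (a i) * (?w (- k + i) * cmod (b (- k + i)))) F)"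
      unfolding R_def by (rule L2_set_sum_le[OF I])
    also have "\<dots> = (\<Sum>i\<in>I. cmod (a i) * L2_set (\<lambda>k. ?w (- k + i) * cmod (b (- k + i))) F)"
      by (simp add: L2_set_right_distrib)
    also have "\<dots> \<le> (\<Sum>i\<in>I. cmod (a i) * N)"
    proof (intro sum_mono mult_left_mono)
      fix i
      have "L2_set (\<lambda>k. ?w (- k + i) * cmod (b (- k + i))) F
          = L2_set (\<lambda>k. ?w (k + i) * cmod (b (k + i))) (uminus ` F)"
        unfolding L2_set_def by (subst sum.reindex) (auto simp: inj_on_def)
      also have "\<dots> \<le> N" by (rule sob_le_L2_set_shift[OF b]) (use F in auto)
      finally show "L2_set (\<lambda>k. ?w (- k + i) * cmod (b (- k + i))) F \<le> N" .
    qed auto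
    also have "\<dots> \<le> (M * sob_emb r) * N"
      unfolding sum_distrib_right[symmetric] by (intro mult_right_mono sob_le_sum_cmod_emb[OF a I r] N)
    finally show ?thesis .
  qed
  have "L2_set (\<lambda>k. ?w k * cmod (?S k)) F
     \<le> L2_set (\<lambda>k. 2 powr r * (P k + R k)) F"
  proof (rule L2_set_mono)
    fix k assume k: "k \<in> F"
    have "?w k * cmod (?S k)
       \<le> ?w k * (\<Sum>j\<in>J. cmod (a (k + j)) * cmod (b j))"
      by (rule mult_left_mono[OF sum_norm_le]) (auto simp: norm_mult)
    also have "\<dots> = (\<Sum>j\<in>J. ?w k * (cmod (a (k + j)) * cmod (b j)))" by (simp add: sum_distrib_left)
    also have "\<dots> \<le> (\<Sum>j\<in>J. 2 powr r * (?w (k + j) + ?w j) * (cmod (a (k + j)) * cmod (b j)))"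
      by (intro sum_mono mult_right_mono sob_weight_peetre) (use r in auto)
    also have "\<dots> = 2 powr r * (P k + Q k)"
      unfolding P_def Q_def sum.distrib[symmetric] sum_distrib_left by (intro sum.cong refl) (simp add: algebra_simps)
    also have "\<dots> \<le> 2 powr r * (P k + R k)" using QR[OF k] by simp
    finally show "?w k * cmod (?S k)
       \<le> 2 powr r * (P k + R k)" .
  qed auto
  also have "\<dots> = 2 powr r * L2_set (\<lambda>k. P k + R k) F" by (simp add: L2_set_right_distrib)
  also have "\<dots> \<le> 2 powr r * (L2_set P F + L2_set R F)"
    by (intro mult_left_mono L2_set_triangle_ineq) auto
  also have "\<dots> \<le> 2 powr r * ((N * sob_emb r) * M + (M * sob_emb r) * N)"
    by (intro mult_left_mono add_mono PF RF) auto
  also have "\<dots> = bil_const r * M * N" by (simp add: bil_const_def)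
  finally show "L2_set (\<lambda>k. ?w k * cmod (?S k)) F
     \<le> bil_const r * M * N" .
qed

lemma sob_le_interaction:
  assumes "sob_le r a M" "sob_le r b N" "r > 1/2"
  shows "sob_le r (interaction s a b) (bil_const r * M * N)"
proof (rule sob_le_tendsto)
  show "((\<lambda>J. \<Sum>j\<in>J. osc s k j * (a (k + j) * cnj (b j)))
     \<longlongrightarrow> interaction s a b k) (finite_subsets_at_top UNIV)" for k
    using has_sum_interaction[OF assms, of s k] by (simp add: has_sum_def)
  show "\<forall>\<^sub>F J in finite_subsets_at_top UNIV.
     sob_le r (\<lambda>k. \<Sum>j\<in>J. osc s k j * (a (k + j) * cnj (b j))) (bil_const r * M * N)"
    by (rule eventually_finite_subsets_at_top_weakI) (rule sob_le_interaction_finite[OF assms])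
qed auto

text \<open>The phases have modulus 1 and the tail condition concerns the weights alone, so the
  error depends on a and b only through M and N, and not on s or k. All exchanges of limits below
  rest on this uniformity.\<close>

lemma interaction_tail:
  assumes a: "sob_le r a M" and b: "sob_le r b N" and r: "r > 1/2" and J: "finite J"
    and tail: "\<And>F. finite F \<Longrightarrow> F \<inter> J = {} \<Longrightarrow> L2_set (\<lambda>k. inverse (sob_weight r k)) F \<le> e"
  shows "cmod (interaction s a b k - (\<Sum>j\<in>J. osc s k j * (a (k + j) * cnj (b j))))
     \<le> M * (N * e)"
proof -
  let ?f = "\<lambda>j. osc s k j * (a (k + j) * cnj (b j))"
  have M: "M \<ge> 0" and N: "N \<ge> 0" using a b sob_le_nonneg by auto
  have "(?f has_sum (interaction s a b k - sum ?f J)) (UNIV - J)"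
    by (rule has_sum_Diff[OF has_sum_interaction[OF a b r] has_sum_finite]) (use J in auto)
  then have lim: "(sum ?f \<longlongrightarrow> interaction s a b k - sum ?f J) (finite_subsets_at_top (UNIV - J))"
    by (simp add: has_sum_def)
  show ?thesis
  proof (rule tendsto_upperbound[OF tendsto_norm[OF lim]])
    show "\<forall>\<^sub>F F in finite_subsets_at_top (UNIV - J). cmod (sum ?f F) \<le> M * (N * e)"
    proof (rule eventually_finite_subsets_at_top_weakI)
      fix F assume F: "finite F" "F \<subseteq> UNIV - J"
      have "cmod (sum ?f F) \<le> (\<Sum>j\<in>F. M * cmod (b j))"
        by (rule sum_norm_le) (use sob_le_cmod[OF a] r in \<open>auto simp: norm_mult intro!: mult_right_mono\<close>)
      also have "\<dots> = M * (\<Sum>j\<in>F. cmod (b j))" by (simp add: sum_distrib_left)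
      also have "\<dots> \<le> M * (N * L2_set (\<lambda>k. inverse (sob_weight r k)) F)"
        by (intro mult_left_mono sob_le_sum_cmod[OF b] F M)
      also have "\<dots> \<le> M * (N * e)"
        by (intro mult_left_mono tail M N) (use F in auto)
      finally show "cmod (sum ?f F) \<le> M * (N * e)" .
    qed
  qed auto
qed

text \<open>Coefficientwise convergence suffices: by the uniform tail bound both interactions are
  close to sums over one finite J, in which the limit is taken term by term.\<close>

lemma tendsto_interaction:
  assumes r: "r > 1/2" and s: "(s \<longlongrightarrow> s') X"
    and a: "\<And>k. ((\<lambda>x. a x k) \<longlongrightarrow> a' k) X" and b: "\<And>k. ((\<lambda>x. b x k) \<longlongrightarrow> b' k) X"
    and aM: "eventually (\<lambda>x. sob_le r (a x) M) X" and bN: "eventually (\<lambda>x. sob_le r (b x) N) X"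
  shows "((\<lambda>x. interaction (s x) (a x) (b x) k) \<longlongrightarrow> interaction s' a' b' k) X"
proof (cases "X = bot")
  case False
  have a'M: "sob_le r a' M" and b'N: "sob_le r b' N"
    using sob_le_tendsto[OF a False aM tendsto_const] sob_le_tendsto[OF b False bN tendsto_const] by auto
  have M: "M \<ge> 0" and N: "N \<ge> 0" using a'M b'N sob_le_nonneg by auto
  show ?thesis
    unfolding tendsto_iff
  proof (intro allI impI)
    fix e :: real assume e: "e > 0"
    define d where "d = e / (4 * (M * N + 1))"
    have MN: "M * N \<ge> 0" using M N by simp
    have d: "d > 0" using e MN by (simp add: d_def add_nonneg_pos)
    have MNd: "M * (N * d) < e / 3"
    proof -
      have "M * (N * d) \<le> (M * N + 1) * d" using d by (simp add: distrib_right)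
      also have "\<dots> = e / 4" using MN by (simp add: d_def add_nonneg_pos divide_simps)
      finally show ?thesis using e by linarith
    qed
    obtain J where J: "finite J"
      and tail: "\<And>F. finite F \<Longrightarrow> F \<inter> J = {} \<Longrightarrow> L2_set (\<lambda>k. inverse (sob_weight r k)) F \<le> d"
      using sob_emb_tail[OF r d] by blast
    let ?S = "\<lambda>s a b. \<Sum>j\<in>J. osc s k j * (a (k + j) * cnj (b j))"
    have "((\<lambda>x. ?S (s x) (a x) (b x)) \<longlongrightarrow> ?S s' a' b') X"
      by (intro tendsto_sum tendsto_mult tendsto_exp tendsto_minus tendsto_const tendsto_of_real s a tendsto_cnj b)
    then have "eventually (\<lambda>x. dist (?S (s x) (a x) (b x)) (?S s' a' b') < e / 3) X"
      by (rule tendstoD) (use e in simp)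
    then show "eventually (\<lambda>x. dist (interaction (s x) (a x) (b x) k) (interaction s' a' b' k) < e) X"
      using aM bN
    proof eventually_elim
      case (elim x)
      have 1: "cmod (interaction (s x) (a x) (b x) k - ?S (s x) (a x) (b x)) \<le> M * (N * d)"
        by (rule interaction_tail[OF elim(2,3) r J tail])
      have 2: "cmod (interaction s' a' b' k - ?S s' a' b') \<le> M * (N * d)"
        by (rule interaction_tail[OF a'M b'N r J tail])
      have "dist (interaction (s x) (a x) (b x) k) (?S (s x) (a x) (b x)) < e / 3"
        using 1 MNd by (simp add: dist_norm)
      moreover have "dist (?S s' a' b') (interaction s' a' b' k) < e / 3"
        using 2 MNd by (simp add: dist_norm norm_minus_commute)
      ultimately show ?case
        using elim(1) dist_triangle_third by blast
    qed
  qed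
qed auto

lemma continuous_on_interaction:
  assumes r: "r > 1/2" and a: "\<And>k. continuous_on S (\<lambda>s. a s k)" and b: "\<And>k. continuous_on S (\<lambda>s. b s k)"
    and aM: "\<And>s. s \<in> S \<Longrightarrow> sob_le r (a s) M" and bN: "\<And>s. s \<in> S \<Longrightarrow> sob_le r (b s) N"
  shows "continuous_on S (\<lambda>s. interaction s (a s) (b s) k)"
  unfolding continuous_on_def
proof
  fix t assume t: "t \<in> S"
  have ev: "eventually (\<lambda>s. s \<in> S) (at t within S)" by (simp add: eventually_at_filter)
  show "((\<lambda>s. interaction s (a s) (b s) k) \<longlongrightarrow> interaction t (a t) (b t) k) (at t within S)"
  proof (rule tendsto_interaction[OF r])
    show "\<forall>\<^sub>F x in at t within S. sob_le r (a x) M" "\<forall>\<^sub>F x in at t within S. sob_le r (b x) N"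
      using ev by (auto elim!: eventually_mono intro: aM bN)
  qed (use a b t in \<open>auto simp: continuous_on_def\<close>)
qed

section \<open>Mild solutions in the interaction picture\<close>

text \<open>Continuity is asked of single coefficients only; with the uniform bound this makes the
  Duhamel integrals meaningful. Continuity in the H^r norm is recovered afterwards for mild
  solutions.\<close>

definition admissible :: "real \<Rightarrow> real \<Rightarrow> real \<Rightarrow> (real \<Rightarrow> int \<Rightarrow> complex) \<Rightarrow> bool" where
  "admissible r T M v \<longleftrightarrow>
     (\<forall>k. continuous_on {0..T} (\<lambda>t. v t k)) \<and> (\<forall>t\<in>{0..T}. sob_le r (v t) M)"

text \<open>The initial value is separate from the path: with a constant path this is the first
  Picard iterate, and with initial value 0 along a mild solution it is the increment from time
  0.\<close>

definition duhamel :: "complex \<Rightarrow> (int \<Rightarrow> complex) \<Rightarrow> (real \<Rightarrow> int \<Rightarrow> complex) \<Rightarrow> real \<Rightarrow> int \<Rightarrow> complex" where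
  "duhamel \<mu> v0 v t k = v0 k - \<i> * \<mu> * integral {0..t} (\<lambda>s. interaction s (v s) (v s) k)"

definition mild :: "complex \<Rightarrow> real \<Rightarrow> real \<Rightarrow> (real \<Rightarrow> int \<Rightarrow> complex) \<Rightarrow> bool" where
  "mild \<mu> r T v \<longleftrightarrow> (\<exists>M. admissible r T M v) \<and> (\<forall>t\<in>{0..T}. v t = duhamel \<mu> (v 0) v t)"

text \<open>The Lipschitz constant of the right hand side on the ball of radius M; the 2 stands for
  the two slots of the bilinear interaction.\<close>

definition lip :: "complex \<Rightarrow> real \<Rightarrow> real \<Rightarrow> real" where
  "lip \<mu> r M = cmod \<mu> * (2 * bil_const r * M)"

lemma lip_nonneg: "M \<ge> 0 \<Longrightarrow> lip \<mu> r M \<ge> 0"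
  by (simp add: lip_def)

lemma admissible_mono: "admissible r T M v \<Longrightarrow> M \<le> N \<Longrightarrow> admissible r T N v"
  by (auto simp: admissible_def intro: sob_le_mono)

lemma admissible_nonneg: "admissible r T M v \<Longrightarrow> T \<ge> 0 \<Longrightarrow> M \<ge> 0"
  by (auto simp: admissible_def intro: sob_le_nonneg)

lemma admissible_const: "sob_le r a M \<Longrightarrow> admissible r T M (\<lambda>_. a)"
  by (simp add: admissible_def)

lemma continuous_on_interaction_admissible:
  assumes "admissible r T M v" "r > 1/2" "t \<le> T"
  shows "continuous_on {0..t} (\<lambda>s. interaction s (v s) (v s) k)"
  by (rule continuous_on_interaction[where M = M and N = M, OF assms(2)])
     (use assms in \<open>auto simp: admissible_def intro: continuous_on_subset\<close>)

lemma interaction_diff_decomp: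
  assumes "sob_le r a M" "sob_le r b M" "r > 1/2"
  shows "interaction s a a k - interaction s b b k
     = interaction s (\<lambda>k. a k - b k) a k + interaction s b (\<lambda>k. a k - b k) k"
  by (simp add: interaction_diff_left[OF assms(1,2,1,3)] interaction_diff_right[OF assms(2,1,2,3)])

lemma sob_le_interaction_diff:
  assumes "sob_le r a M" "sob_le r b M" "sob_le r (\<lambda>k. a k - b k) d" "r > 1/2"
  shows "sob_le r (\<lambda>k. interaction s a a k - interaction s b b k) (2 * bil_const r * M * d)"
  unfolding interaction_diff_decomp[OF assms(1,2,4)]
  using sob_le_add[OF sob_le_interaction[OF assms(3,1,4), of s] sob_le_interaction[OF assms(2,3,4), of s]]
  by (simp add: mult_ac)

text \<open>The distance of the paths is measured by a function m of time instead of its maximum, so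
  that one bound serves constant distances in the fixed point argument and exponential ones in the
  stability estimate.\<close>

lemma sob_le_duhamel_diff:
  assumes v: "admissible r T M v" and w: "admissible r T M w" and r: "r > 1/2"
    and m: "continuous_on {0..T} m" and d: "\<And>s. s \<in> {0..T} \<Longrightarrow> sob_le r (\<lambda>k. v s k - w s k) (m s)"
    and d0: "sob_le r (\<lambda>k. v0 k - w0 k) \<delta>" and t: "t \<in> {0..T}"
  shows "sob_le r (\<lambda>k. duhamel \<mu> v0 v t k - duhamel \<mu> w0 w t k) (\<delta> + lip \<mu> r M * integral {0..t} m)"
proof -
  have tT: "t \<le> T" using t by auto
  have cm: "continuous_on {0..t} m" using m tT by (auto intro: continuous_on_subset)
  note cv = continuous_on_interaction_admissible[OF v r tT]
  note cw = continuous_on_interaction_admissible[OF w r tT]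
  have "sob_le r (\<lambda>k. integral {0..t} (\<lambda>s. interaction s (v s) (v s) k - interaction s (w s) (w s) k))
     (integral {0..t} (\<lambda>s. 2 * bil_const r * M * m s))"
    by (rule sob_le_integral)
       (use v w d t in \<open>auto intro!: continuous_on_diff cv cw continuous_on_mult_left cm
          sob_le_interaction_diff[OF _ _ _ r] simp: admissible_def\<close>)
  then have "sob_le r (\<lambda>k. integral {0..t} (\<lambda>s. interaction s (v s) (v s) k - interaction s (w s) (w s) k))
     (2 * bil_const r * M * integral {0..t} m)" by simp
  from sob_le_add[OF d0 sob_le_cmult[OF this, of "- (\<i> * \<mu>)"]]
  have "sob_le r (\<lambda>k. (v0 k - w0 k) + - (\<i> * \<mu>) * integral {0..t} (\<lambda>s. interaction s (v s) (v s) k - interaction s (w s) (w s) k))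
     (\<delta> + lip \<mu> r M * integral {0..t} m)"
    by (simp add: norm_mult lip_def mult_ac)
  moreover have "integral {0..t} (\<lambda>s. interaction s (v s) (v s) k - interaction s (w s) (w s) k)
    = integral {0..t} (\<lambda>s. interaction s (v s) (v s) k) - integral {0..t} (\<lambda>s. interaction s (w s) (w s) k)" for k
    by (intro integral_diff integrable_continuous_interval cv cw)
  ultimately show ?thesis by (simp add: duhamel_def algebra_simps)
qed

lemma sob_le_duhamel_increment:
  assumes v: "admissible r T M v" and r: "r > 1/2" and t: "t \<in> {0..T}"
  shows "sob_le r (\<lambda>k. duhamel \<mu> v0 v t k - v0 k) (t * (cmod \<mu> * (bil_const r * M * M)))"
proof -
  have "sob_le r (\<lambda>k. integral {0..t} (\<lambda>s. interaction s (v s) (v s) k)) ((t - 0) * (bil_const r * M * M))"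
    by (rule sob_le_integral_const) 
       (use v t r in \<open>auto intro!: continuous_on_interaction_admissible[OF v r] sob_le_interaction simp: admissible_def\<close>)
  from sob_le_cmult[OF this, of "- (\<i> * \<mu>)"] show ?thesis
    by (simp add: duhamel_def norm_mult mult_ac)
qed

text \<open>Iterating the Duhamel bound with weights \<open>exp (\<lambda> t)\<close> contracts by the factor \<open>1/2\<close> on every time interval.\<close>

lemma mild_stability:
  assumes v: "admissible r T M v" "\<forall>t\<in>{0..T}. v t = duhamel \<mu> (v 0) v t"
    and w: "admissible r T M w" "\<forall>t\<in>{0..T}. w t = duhamel \<mu> (w 0) w t"
    and r: "r > 1/2" and d: "sob_le r (\<lambda>k. v 0 k - w 0 k) \<delta>" and t: "t \<in> {0..T}"
  shows "sob_le r (\<lambda>k. v t k - w t k) (2 * \<delta> * exp ((2 * lip \<mu> r M + 1) * t))"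
proof -
  \<comment> \<open>With this rate, integrating exp (l s) and multiplying by \<open>lip\<close>
    gains a factor of at most 1/2; the summand 1 keeps l positive when \<open>lip\<close> is
    0.\<close>
  define l where "l = 2 * lip \<mu> r M + 1"
  have M: "M \<ge> 0" using admissible_nonneg[OF v(1)] t by auto
  have K: "lip \<mu> r M \<ge> 0" using lip_nonneg[OF M] .
  have l: "l > 0" using K by (simp add: l_def)
  have \<delta>: "\<delta> \<ge> 0" using sob_le_nonneg[OF d] .
  \<comment> \<open>The value 2 \<delta> is the fixed point of x -> \<delta> + x / 2, and 2 M is the
    trivial bound for the difference of the two paths, halved in each round.\<close>
  let ?b = "\<lambda>n t. (2 * \<delta> + 2 * M / 2 ^ n) * exp (l * t)"
  let ?d = "\<lambda>t k. v t k - w t k"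
  have step: "\<forall>t\<in>{0..T}. sob_le r (?d t) (?b n t)" for n
  proof (induction n)
    case 0
    show ?case
    proof
      fix t assume t: "t \<in> {0..T}"
      have "sob_le r (?d t) (M + M)"
        by (rule sob_le_diff) (use v(1) w(1) t in \<open>auto simp: admissible_def\<close>)
      moreover have "M + M \<le> ?b 0 t"
      proof -
        have "(M + M) * 1 \<le> ?b 0 t"
          by (rule mult_mono) (use M \<delta> l t in auto)
        then show ?thesis by simp
      qed
      ultimately show "sob_le r (?d t) (?b 0 t)"
        by (rule sob_le_mono)
    qed
  next
    case (Suc n)
    define B where "B = 2 * \<delta> + 2 * M / 2 ^ n"
    have B: "B \<ge> 0" using \<delta> M by (simp add: B_def)
    show ?case
    proof
      fix t assume t: "t \<in> {0..T}"
      have "((\<lambda>s. B * exp (l * s)) has_integral (B / l * exp (l * t) - B / l * exp (l * 0))) {0..t}"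
        by (rule fundamental_theorem_of_calculus)
           (use t l in \<open>auto intro!: derivative_eq_intros simp flip: has_real_derivative_iff_has_vector_derivative\<close>)
      then have I: "integral {0..t} (\<lambda>s. B * exp (l * s)) = B / l * (exp (l * t) - 1)"
        by (subst integral_unique) (auto simp: right_diff_distrib)
      have le: "sob_le r (\<lambda>k. duhamel \<mu> (v 0) v t k - duhamel \<mu> (w 0) w t k)
        (\<delta> + lip \<mu> r M * integral {0..t} (\<lambda>s. B * exp (l * s)))"
        by (rule sob_le_duhamel_diff[OF v(1) w(1) r _ _ d t])
           (use Suc in \<open>auto intro!: continuous_intros simp: B_def\<close>)
      have eq: "duhamel \<mu> (v 0) v t = v t" "duhamel \<mu> (w 0) w t = w t"
        using v(2) w(2) t by metis+
      have "\<delta> + lip \<mu> r M * integral {0..t} (\<lambda>s. B * exp (l * s))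
         \<le> ?b (Suc n) t"
      proof -
        have "lip \<mu> r M / l \<le> 1/2" using K by (simp add: l_def divide_simps)
        then have "(lip \<mu> r M / l) * (B * (exp (l * t) - 1)) \<le> 1/2 * (B * (exp (l * t) - 1))"
          by (rule mult_right_mono) (use B l t in auto)
        also have "\<dots> \<le> B / 2 * exp (l * t)" using B by (simp add: algebra_simps)
        finally have 1: "lip \<mu> r M * integral {0..t} (\<lambda>s. B * exp (l * s)) \<le> B / 2 * exp (l * t)"
          unfolding I by (simp add: mult_ac)
        have "\<delta> * 1 \<le> \<delta> * exp (l * t)" by (rule mult_left_mono) (use \<delta> l t in auto)
        with 1 have "\<delta> + lip \<mu> r M * integral {0..t} (\<lambda>s. B * exp (l * s)) \<le> (\<delta> + B / 2) * exp (l * t)"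
          by (simp add: distrib_right)
        also have "\<delta> + B / 2 = 2 * \<delta> + 2 * M / 2 ^ Suc n" by (simp add: B_def)
        finally show ?thesis .
      qed
      from sob_le_mono[OF le this]
      show "sob_le r (?d t) (?b (Suc n) t)"
        by (simp only: eq)
    qed
  qed
  show ?thesis
    unfolding l_def[symmetric]
  proof (rule sob_le_tendsto[where F = sequentially])
    show "\<forall>\<^sub>F n in sequentially. sob_le r (?d t) (?b n t)"
      using step t by simp
    have "(\<lambda>n. 2 * M * (1 / 2) ^ n) \<longlonglongrightarrow> 2 * M * 0"
      by (intro tendsto_mult tendsto_const LIMSEQ_power_zero) auto
    then have "(\<lambda>n. 2 * M / 2 ^ n) \<longlonglongrightarrow> 0" by (simp add: power_one_over)
    then have "(\<lambda>n. ?b n t) \<longlonglongrightarrow> (2 * \<delta> + 0) * exp (l * t)"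
      by (intro tendsto_intros)
    then show "(\<lambda>n. ?b n t) \<longlonglongrightarrow> 2 * \<delta> * exp (l * t)" by simp
  qed auto
qed

lemma mild_unique:
  assumes "mild \<mu> r T v" "mild \<mu> r T w" "v 0 = w 0" "r > 1/2" "t \<in> {0..T}"
  shows "v t = w t"
proof
  fix k
  obtain M N where M: "admissible r T M v" and N: "admissible r T N w"
    using assms(1,2) unfolding mild_def by blast
  have "sob_le r (\<lambda>k. v t k - w t k) (2 * 0 * exp ((2 * lip \<mu> r (max M N) + 1) * t))"
  proof (rule mild_stability[OF _ _ _ _ assms(4) _ assms(5)])
    show "admissible r T (max M N) v" "admissible r T (max M N) w"
      by (auto intro: admissible_mono[OF M] admissible_mono[OF N])
    show "\<forall>t\<in>{0..T}. v t = duhamel \<mu> (v 0) v t" "\<forall>t\<in>{0..T}. w t = duhamel \<mu> (w 0) w t"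
      using assms(1,2) unfolding mild_def by blast+
  qed (simp add: assms(3) sob_le_0)
  then show "v t k = w t k" using sob_le_cmod[of r "\<lambda>k. v t k - w t k" 0 k] assms(4) by simp
qed

lemma mild_0: "mild \<mu> r T (\<lambda>t k. 0)"
  unfolding mild_def admissible_def by (auto simp: duhamel_def interaction_def intro!: exI[of _ 0] sob_le_0)

lemma continuous_on_duhamel:
  assumes "admissible r T M v" "r > 1/2"
  shows "continuous_on {0..T} (\<lambda>t. duhamel \<mu> v0 v t k)"
  unfolding duhamel_def
  by (intro continuous_intros indefinite_integral_continuous_1 integrable_continuous_interval
      continuous_on_interaction_admissible[OF assms(1,2) order_refl])

subsection \<open>Local existence\<close>

text \<open>The first smallness condition keeps the iterates within distance 1 of the initial value,
  hence in the ball of radius \<open>R + 1\<close>; the second makes the Duhamel map contract by 1/2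
  on that ball.\<close>

lemma picard_iteration:
  assumes r: "r > 1/2" and v0: "sob_le r v0 R" and \<tau>: "0 \<le> \<tau>"
    and small1: "\<tau> * (cmod \<mu> * (bil_const r * (R + 1) * (R + 1))) \<le> 1"
    and small2: "\<tau> * lip \<mu> r (R + 1) \<le> 1/2"
  shows "\<exists>v. mild \<mu> r \<tau> v \<and> v 0 = v0 \<and> admissible r \<tau> (R + 1) v"
proof -
  define V where "V n = (duhamel \<mu> v0 ^^ n) (\<lambda>_. v0)" for n
  have V0: "V 0 = (\<lambda>_. v0)" and VS: "V (Suc n) = duhamel \<mu> v0 (V n)" for n by (simp_all add: V_def)
  have R: "R \<ge> 0" using sob_le_nonneg[OF v0] .
  let ?A = "cmod \<mu> * (bil_const r * (R + 1) * (R + 1))"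
  have L: "lip \<mu> r (R + 1) \<ge> 0" using R by (intro lip_nonneg) auto
  have adm_duhamel: "admissible r \<tau> (R + 1) (duhamel \<mu> v0 v)" if v: "admissible r \<tau> (R + 1) v" for v
    unfolding admissible_def
  proof (intro conjI allI ballI)
    fix k show "continuous_on {0..\<tau>} (\<lambda>t. duhamel \<mu> v0 v t k)" by (rule continuous_on_duhamel[OF v r])
  next
    fix t assume t: "t \<in> {0..\<tau>}"
    have "sob_le r (\<lambda>k. v0 k + (duhamel \<mu> v0 v t k - v0 k)) (R + t * ?A)"
      by (rule sob_le_add[OF v0 sob_le_duhamel_increment[OF v r t]])
    moreover have "t * ?A \<le> \<tau> * ?A"
      by (rule mult_right_mono) (use t R in auto)
    ultimately show "sob_le r (duhamel \<mu> v0 v t) (R + 1)"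
      using small1 by (auto elim!: sob_le_mono)
  qed
  have adm: "admissible r \<tau> (R + 1) (V n)" for n
    by (induction n) (auto simp: V0 VS intro!: adm_duhamel admissible_const intro: sob_le_mono[OF v0])
  have contr: "sob_le r (\<lambda>k. duhamel \<mu> v0 v t k - duhamel \<mu> v0 w t k) (d / 2)"
    if v: "admissible r \<tau> (R + 1) v" and w: "admissible r \<tau> (R + 1) w"
      and d: "\<And>s. s \<in> {0..\<tau>} \<Longrightarrow> sob_le r (\<lambda>k. v s k - w s k) d" and t: "t \<in> {0..\<tau>}" for v w d t
  proof -
    have d0: "d \<ge> 0" using sob_le_nonneg[OF d[OF t]] .
    have "sob_le r (\<lambda>k. duhamel \<mu> v0 v t k - duhamel \<mu> v0 w t k) (0 + lip \<mu> r (R + 1) * integral {0..t} (\<lambda>_. d))"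
      by (rule sob_le_duhamel_diff[OF v w r]) (use d t in \<open>auto intro: sob_le_0\<close>)
    moreover have "0 + lip \<mu> r (R + 1) * integral {0..t} (\<lambda>_. d) \<le> d / 2"
    proof -
      have "t * lip \<mu> r (R + 1) \<le> \<tau> * lip \<mu> r (R + 1)" by (rule mult_right_mono) (use t L in auto)
      also have "\<dots> \<le> 1/2" by (rule small2)
      finally have "(t * lip \<mu> r (R + 1)) * d \<le> 1/2 * d" by (rule mult_right_mono) (rule d0)
      then show ?thesis using t by (simp add: mult_ac)
    qed
    ultimately show ?thesis by (rule sob_le_mono)
  qed
  have step: "\<forall>t\<in>{0..\<tau>}. sob_le r (\<lambda>k. V (Suc n) t k - V n t k) (1 / 2 ^ n)" for n
  proof (induction n)
    case 0
    show ?case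
    proof
      fix t assume t: "t \<in> {0..\<tau>}"
      have "t * ?A \<le> \<tau> * ?A"
        by (rule mult_right_mono) (use t R in auto)
      then show "sob_le r (\<lambda>k. V (Suc 0) t k - V 0 t k) (1 / 2 ^ 0)"
        using sob_le_duhamel_increment[OF adm[of 0] r t, of \<mu> v0] small1
        by (auto simp: VS V0 elim!: sob_le_mono)
    qed
  next
    case (Suc n)
    then show ?case using contr[OF adm[of "Suc n"] adm[of n], of "1 / 2 ^ n"] by (simp add: VS mult.commute)
  qed
  have tele: "sob_le r (\<lambda>k. V (n + m) t k - V n t k) (2 / 2 ^ n)" if t: "t \<in> {0..\<tau>}" for n m t
  proof -
    have "sob_le r (\<lambda>k. V (n + m) t k - V n t k) (2 / 2 ^ n - 2 / 2 ^ (n + m))"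
    proof (induction m)
      case 0 then show ?case by (simp add: sob_le_0)
    next
      case (Suc m)
      from sob_le_add[OF Suc bspec[OF step[of "n + m"] t]]
      show ?case by (simp add: algebra_simps)
    qed
    then show ?thesis by (rule sob_le_mono) simp
  qed
  have pow: "(\<lambda>n. c / 2 ^ n) \<longlonglongrightarrow> 0" for c :: real
  proof -
    have "(\<lambda>n. c * (1 / 2) ^ n) \<longlonglongrightarrow> c * 0"
      by (intro tendsto_mult tendsto_const LIMSEQ_power_zero) auto
    then show ?thesis by (simp add: power_one_over)
  qed
  have "convergent (\<lambda>n. V n t k)" if t: "t \<in> {0..\<tau>}" for t k
  proof (rule Cauchy_convergent, rule CauchyI')
    fix e :: real assume "e > 0"
    then have "eventually (\<lambda>n. 2 / 2 ^ n < e) sequentially" using order_tendstoD(2)[OF pow] by auto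
    then obtain N where N: "\<And>n. n \<ge> N \<Longrightarrow> 2 / 2 ^ n < e" by (auto simp: eventually_sequentially)
    show "\<exists>N. \<forall>m\<ge>N. \<forall>n>m. dist (V m t k) (V n t k) < e"
    proof (intro exI allI impI)
      fix m n assume mn: "m \<ge> N" "n > m"
      have "cmod (V (m + (n - m)) t k - V m t k) \<le> 2 / 2 ^ m"
        by (rule sob_le_cmod[OF tele[OF t]]) (use r in simp)
      then show "dist (V m t k) (V n t k) < e" using mn N[OF mn(1)] by (simp add: dist_norm norm_minus_commute)
    qed
  qed
  \<comment> \<open>The limit is taken coefficient by coefficient; the geometric bound in the
    weighted norm is uniform in time and carries over by \<open>sob_le_tendsto\<close>.\<close>
  define v where "v t k = lim (\<lambda>n. V n t k)" for t k
  have lim: "(\<lambda>n. V n t k) \<longlonglongrightarrow> v t k" if t: "t \<in> {0..\<tau>}" for t k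
    using \<open>\<And>t k. t \<in> {0..\<tau>} \<Longrightarrow> convergent (\<lambda>n. V n t k)\<close>[OF t] by (simp add: v_def convergent_LIMSEQ_iff)
  have dist: "sob_le r (\<lambda>k. v t k - V n t k) (2 / 2 ^ n)" if t: "t \<in> {0..\<tau>}" for n t
  proof (rule sob_le_tendsto[where F = sequentially and a = "\<lambda>m k. V (m + n) t k - V n t k" and M = "\<lambda>_. 2 / 2 ^ n"])
    show "(\<lambda>m. V (m + n) t k - V n t k) \<longlonglongrightarrow> v t k - V n t k" for k
      by (intro tendsto_diff tendsto_const LIMSEQ_ignore_initial_segment lim t)
    show "\<forall>\<^sub>F m in sequentially. sob_le r (\<lambda>k. V (m + n) t k - V n t k) (2 / 2 ^ n)"
      unfolding add.commute[of _ n] by (intro always_eventually allI tele t)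
  qed auto
  have admv: "admissible r \<tau> (R + 1) v"
    unfolding admissible_def
  proof (intro conjI allI ballI)
    fix k
    show "continuous_on {0..\<tau>} (\<lambda>t. v t k)"
    proof (rule uniform_limit_theorem[where f = "\<lambda>n t. V n t k" and F = sequentially])
      show "\<forall>\<^sub>F n in sequentially. continuous_on {0..\<tau>} (\<lambda>t. V n t k)"
        using adm by (auto simp: admissible_def)
      show "uniform_limit {0..\<tau>} (\<lambda>n t. V n t k) (\<lambda>t. v t k) sequentially"
      proof (rule uniform_limitI)
        fix e :: real assume "e > 0"
        then have "eventually (\<lambda>n. 2 / 2 ^ n < e) sequentially" using order_tendstoD(2)[OF pow] by auto
        then show "\<forall>\<^sub>F n in sequentially. \<forall>x\<in>{0..\<tau>}. dist (V n x k) (v x k) < e"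
        proof eventually_elim
          case (elim n)
          show ?case
          proof
            fix x assume "x \<in> {0..\<tau>}"
            from sob_le_cmod[OF dist[OF this, of n], of k] r elim show "dist (V n x k) (v x k) < e"
              by (simp add: dist_norm norm_minus_commute)
          qed
        qed
      qed
    qed auto
  next
    fix t assume t: "t \<in> {0..\<tau>}"
    show "sob_le r (v t) (R + 1)"
      by (rule sob_le_tendsto[where F = sequentially, OF lim[OF t] _ _ tendsto_const])
         (use adm t in \<open>auto simp: admissible_def\<close>)
  qed
  \<comment> \<open>Both sides are compared with the same iterate \<open>V (Suc n)\<close>, from
    which each differs by at most a multiple of 2 to the power - n.\<close>
  have fp: "v t = duhamel \<mu> v0 v t" if t: "t \<in> {0..\<tau>}" for t
  proof
    fix k
    have "sob_le r (\<lambda>k. (duhamel \<mu> v0 v t k - V (Suc n) t k) - (v t k - V (Suc n) t k)) (2 / 2 ^ n / 2 + 2 / 2 ^ Suc n)" for n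
      unfolding VS by (rule sob_le_diff[OF contr[OF admv adm dist t] dist[OF t, of "Suc n", unfolded VS]])
    then have "sob_le r (\<lambda>k. duhamel \<mu> v0 v t k - v t k) (2 / 2 ^ n)" for n by simp
    then have "sob_le r (\<lambda>k. duhamel \<mu> v0 v t k - v t k) 0"
      by (intro sob_le_tendsto[where F = sequentially, OF tendsto_const _ _ pow[of 2]]) auto
    from sob_le_cmod[OF this, of k] r show "v t k = duhamel \<mu> v0 v t k" by simp
  qed
  have "v 0 = v0" using fp[of 0] \<tau> by (auto simp: duhamel_def fun_eq_iff)
  with fp admv show ?thesis unfolding mild_def by metis
qed

text \<open>The time is fixed by the radius R before the data are chosen, so a single \<tau>0 serves
  all parareal iterates.\<close>

lemma mild_local_existence:
  assumes r: "r > 1/2" and R: "R \<ge> 0"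
  shows "\<exists>\<tau>0>0. \<forall>\<tau> v0. 0 \<le> \<tau> \<longrightarrow> \<tau> \<le> \<tau>0 \<longrightarrow> sob_le r v0 R \<longrightarrow>
     (\<exists>v. mild \<mu> r \<tau> v \<and> v 0 = v0 \<and> admissible r \<tau> (R + 1) v)"
proof -
  define A where "A = cmod \<mu> * (bil_const r * (R + 1) * (R + 1)) + 2 * lip \<mu> r (R + 1) + 1"
  have L: "lip \<mu> r (R + 1) \<ge> 0" using R by (intro lip_nonneg) auto
  have B: "cmod \<mu> * (bil_const r * (R + 1) * (R + 1)) \<ge> 0" using R by simp
  have A: "A > 0" using L B by (simp add: A_def)
  show ?thesis
  proof (intro exI[of _ "1 / A"] conjI allI impI)
    fix \<tau> v0 assume \<tau>: "0 \<le> \<tau>" "\<tau> \<le> 1 / A" and v0: "sob_le r v0 R"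
    have "\<tau> * A \<le> 1" using \<tau> A by (simp add: field_simps)
    moreover have "\<tau> * (cmod \<mu> * (bil_const r * (R + 1) * (R + 1))) \<le> \<tau> * A"
      "\<tau> * (2 * lip \<mu> r (R + 1)) \<le> \<tau> * A"
      using \<tau>(1) L B by (auto simp: A_def intro!: mult_left_mono)
    ultimately show "\<exists>v. mild \<mu> r \<tau> v \<and> v 0 = v0 \<and> admissible r \<tau> (R + 1) v"
      by (intro picard_iteration[OF r v0 \<tau>(1)]) auto
  qed (use A in simp)
qed

subsection \<open>The first Picard iterate as a one-step method\<close>

text \<open>Constant paths turn the Duhamel difference bound into a one-step estimate: the integral
  of the constant \<delta> contributes \<open>lip\<close> times \<tau>.\<close>

lemma one_step_stability:
  assumes a: "sob_le r a M" and b: "sob_le r b M" and d: "sob_le r (\<lambda>k. a k - b k) \<delta>"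
    and r: "r > 1/2" and \<tau>: "\<tau> \<ge> 0"
  shows "sob_le r (\<lambda>k. duhamel \<mu> a (\<lambda>_. a) \<tau> k - duhamel \<mu> b (\<lambda>_. b) \<tau> k) ((1 + lip \<mu> r M * \<tau>) * \<delta>)"
proof -
  have "sob_le r (\<lambda>k. duhamel \<mu> a (\<lambda>_. a) \<tau> k - duhamel \<mu> b (\<lambda>_. b) \<tau> k)
     (\<delta> + lip \<mu> r M * integral {0..\<tau>} (\<lambda>_. \<delta>))"
    by (rule sob_le_duhamel_diff[where T = \<tau>, OF admissible_const[OF a] admissible_const[OF b] r _ d d])
       (use \<tau> in auto)
  then show ?thesis using \<tau> by (simp add: algebra_simps)
qed

text \<open>E is the Lipschitz constant of the exact flow over times up to 1, and A bounds the speed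
  of mild solutions in the ball. The summand with \<open>2 * M\<close> comes from the two terms of
  \<open>interaction_defect_decomp\<close> that contain a double difference, the summands
  \<open>A * E\<close> and A from the two products of a time increment and a difference of
  solutions.\<close>

definition defect_const :: "complex \<Rightarrow> real \<Rightarrow> real \<Rightarrow> real" where
  "defect_const \<mu> r M = (let E = 2 * exp (2 * lip \<mu> r M + 1); A = cmod \<mu> * (bil_const r * M * M) in
     cmod \<mu> * (bil_const r * (2 * M * (lip \<mu> r M * E) + A * E + A)))"

lemma defect_const_nonneg: "M \<ge> 0 \<Longrightarrow> defect_const \<mu> r M \<ge> 0"
  unfolding defect_const_def Let_def by (intro mult_nonneg_nonneg add_nonneg_nonneg lip_nonneg) auto

text \<open>The double difference of a quadratic expression is arranged so that each term contains
  either the double difference of the paths, or a time increment of one path together with a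
  difference of the two paths. Each term is then of order s times \<delta>.\<close>

lemma interaction_defect_decomp:
  assumes a: "sob_le r a M" and a0: "sob_le r a0 M" and b: "sob_le r b M" and b0: "sob_le r b0 M" and r: "r > 1/2"
  shows "(interaction s a a k - interaction s a0 a0 k) - (interaction s b b k - interaction s b0 b0 k)
    = interaction s (\<lambda>k. (a k - a0 k) - (b k - b0 k)) a k + interaction s (\<lambda>k. b k - b0 k) (\<lambda>k. a k - b k) k
      + (interaction s (\<lambda>k. a0 k - b0 k) (\<lambda>k. a k - a0 k) k
      + interaction s b0 (\<lambda>k. (a k - a0 k) - (b k - b0 k)) k)"
  by (simp add: interaction_diff_left[OF _ _ _ r] interaction_diff_right[OF _ _ _ r] sob_le_diff
      interaction_diff_left[OF sob_le_diff[OF a a0] sob_le_diff[OF b b0] a r]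
      interaction_diff_left[OF a a0 a r] interaction_diff_left[OF b b0 a r]
      interaction_diff_left[OF b b0 sob_le_diff[OF a b] r]
      interaction_diff_right[OF b a b r] interaction_diff_right[OF b0 a b r]
      interaction_diff_left[OF a0 b0 sob_le_diff[OF a a0] r]
      interaction_diff_right[OF a0 a a0 r] interaction_diff_right[OF b0 a a0 r]
      interaction_diff_right[OF b0 sob_le_diff[OF a a0] sob_le_diff[OF b b0] r]
      interaction_diff_right[OF b0 b b0 r])

text \<open>One power of \<tau> comes from the integration in time, the other from the integrand,
  which compares the interaction at time s with the one frozen at the initial value. The factor
  \<delta> appears because the double difference is estimated, and not the two defects
  separately.\<close>

lemma local_defect_lipschitz:
  assumes v: "admissible r \<tau> M v" and vm: "mild \<mu> r \<tau> v"
    and w: "admissible r \<tau> M w" and wm: "mild \<mu> r \<tau> w"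
    and d: "sob_le r (\<lambda>k. v 0 k - w 0 k) \<delta>" and r: "r > 1/2" and \<tau>: "0 \<le> \<tau>" "\<tau> \<le> 1"
  shows "sob_le r (\<lambda>k. (v \<tau> k - duhamel \<mu> (v 0) (\<lambda>_. v 0) \<tau> k) - (w \<tau> k - duhamel \<mu> (w 0) (\<lambda>_. w 0) \<tau> k))
     (defect_const \<mu> r M * \<tau>\<^sup>2 * \<delta>)"
proof -
  define E where "E = 2 * exp (2 * lip \<mu> r M + 1)"
  define A where "A = cmod \<mu> * (bil_const r * M * M)"
  have veq: "\<forall>t\<in>{0..\<tau>}. v t = duhamel \<mu> (v 0) v t" and weq: "\<forall>t\<in>{0..\<tau>}. w t = duhamel \<mu> (w 0) w t"
    using vm wm unfolding mild_def by blast+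
  have M: "M \<ge> 0" using admissible_nonneg[OF v \<tau>(1)] .
  have L: "lip \<mu> r M \<ge> 0" using lip_nonneg[OF M] .
  have \<delta>: "\<delta> \<ge> 0" using sob_le_nonneg[OF d] .
  have E: "E \<ge> 0" by (simp add: E_def)
  have A: "A \<ge> 0" using M by (simp add: A_def)
  have vs: "sob_le r (v s) M" and ws: "sob_le r (w s) M" if "s \<in> {0..\<tau>}" for s
    using v w that by (auto simp: admissible_def)
  note v0 = vs[of 0] and w0 = ws[of 0]
  have diff: "sob_le r (\<lambda>k. v s k - w s k) (E * \<delta>)" if s: "s \<in> {0..\<tau>}" for s
  proof -
    have "2 * \<delta> * exp ((2 * lip \<mu> r M + 1) * s) \<le> 2 * \<delta> * exp ((2 * lip \<mu> r M + 1) * 1)"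
      by (intro mult_left_mono exp_le_cancel_iff[THEN iffD2]) (use s \<tau> L \<delta> in auto)
    then have "2 * \<delta> * exp ((2 * lip \<mu> r M + 1) * s) \<le> E * \<delta>" by (simp add: E_def mult_ac)
    then show ?thesis by (rule sob_le_mono[OF mild_stability[OF v veq w weq r d s]])
  qed
  have incv: "sob_le r (\<lambda>k. v s k - v 0 k) (s * A)" and incw: "sob_le r (\<lambda>k. w s k - w 0 k) (s * A)"
    if s: "s \<in> {0..\<tau>}" for s
    using sob_le_duhamel_increment[OF v r s, of \<mu> "v 0"] sob_le_duhamel_increment[OF w r s, of \<mu> "w 0"]
    by (simp_all only: bspec[OF veq s, symmetric] bspec[OF weq s, symmetric] A_def)
  have incd: "sob_le r (\<lambda>k. (v s k - v 0 k) - (w s k - w 0 k)) (s * (lip \<mu> r M * (E * \<delta>)))"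
    if s: "s \<in> {0..\<tau>}" for s
  proof -
    \<comment> \<open>With initial value 0 the Duhamel expressions are the increments from time 0,
      so the difference bound applies with initial distance 0 and yields the factor s.\<close>
    have "sob_le r (\<lambda>k. duhamel \<mu> (\<lambda>_. 0) v s k - duhamel \<mu> (\<lambda>_. 0) w s k)
        (0 + lip \<mu> r M * integral {0..s} (\<lambda>_. E * \<delta>))"
      by (rule sob_le_duhamel_diff[OF v w r _ diff _ s]) (auto intro: sob_le_0)
    moreover have "duhamel \<mu> (\<lambda>_. 0) v s k = v s k - v 0 k" "duhamel \<mu> (\<lambda>_. 0) w s k = w s k - w 0 k" for k
      by (simp_all add: fun_cong[OF bspec[OF veq s], of k] fun_cong[OF bspec[OF weq s], of k] duhamel_def)
    ultimately show ?thesis using s by (simp add: mult_ac)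
  qed
  let ?D = "\<lambda>s k. (interaction s (v s) (v s) k - interaction s (v 0) (v 0) k) - (interaction s (w s) (w s) k - interaction s (w 0) (w 0) k)"
  define B where "B = bil_const r * (2 * M * (lip \<mu> r M * E) + A * E + A)"
  have B: "B \<ge> 0" unfolding B_def by (intro mult_nonneg_nonneg add_nonneg_nonneg) (use M L E A in auto)
  have D: "sob_le r (?D s) (\<tau> * B * \<delta>)" if s: "s \<in> {0..\<tau>}" for s
  proof -
    have 0: "0 \<in> {0..\<tau>}" using \<tau> by auto
    have "sob_le r (?D s)
      (bil_const r * (s * (lip \<mu> r M * (E * \<delta>))) * M + bil_const r * (s * A) * (E * \<delta>)
        + (bil_const r * \<delta> * (s * A) + bil_const r * M * (s * (lip \<mu> r M * (E * \<delta>)))))"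
      unfolding interaction_defect_decomp[OF vs[OF s] v0[OF 0] ws[OF s] w0[OF 0] r]
      by (intro sob_le_add sob_le_interaction incd incv incw diff d vs w0 s 0 r)
    moreover have "(bil_const r * (s * (lip \<mu> r M * (E * \<delta>))) * M + bil_const r * (s * A) * (E * \<delta>)
        + (bil_const r * \<delta> * (s * A) + bil_const r * M * (s * (lip \<mu> r M * (E * \<delta>))))) = s * (B * \<delta>)"
      by (simp add: B_def algebra_simps)
    moreover have "s * (B * \<delta>) \<le> \<tau> * (B * \<delta>)" by (rule mult_right_mono) (use s B \<delta> in auto)
    ultimately show ?thesis by (auto simp: mult_ac elim: sob_le_mono)
  qed
  note cv = continuous_on_interaction_admissible[OF v r order_refl]
  note cw = continuous_on_interaction_admissible[OF w r order_refl]
  have av0: "admissible r \<tau> M (\<lambda>_. v 0)" and aw0: "admissible r \<tau> M (\<lambda>_. w 0)"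
    using v0 w0 \<tau> by (auto intro: admissible_const)
  note cv0 = continuous_on_interaction_admissible[OF av0 r order_refl]
  note cw0 = continuous_on_interaction_admissible[OF aw0 r order_refl]
  have "sob_le r (\<lambda>k. integral {0..\<tau>} (\<lambda>s. ?D s k)) ((\<tau> - 0) * (\<tau> * B * \<delta>))"
    by (rule sob_le_integral_const[OF _ \<tau>(1) D]) (auto intro!: continuous_on_diff cv cw cv0 cw0)
  from sob_le_cmult[OF this, of "- (\<i> * \<mu>)"]
  have le: "sob_le r (\<lambda>k. - (\<i> * \<mu>) * integral {0..\<tau>} (\<lambda>s. ?D s k)) (defect_const \<mu> r M * \<tau>\<^sup>2 * \<delta>)"
    by (simp add: norm_mult defect_const_def Let_def B_def E_def A_def power2_eq_square mult_ac)
  have I: "integral {0..\<tau>} (\<lambda>s. ?D s k) =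
     (integral {0..\<tau>} (\<lambda>s. interaction s (v s) (v s) k) - integral {0..\<tau>} (\<lambda>s. interaction s (v 0) (v 0) k))
     - (integral {0..\<tau>} (\<lambda>s. interaction s (w s) (w s) k) - integral {0..\<tau>} (\<lambda>s. interaction s (w 0) (w 0) k))" for k
    by (simp add: integral_diff integrable_continuous_interval integrable_diff cv cw cv0 cw0)
  have \<tau>\<tau>: "\<tau> \<in> {0..\<tau>}" using \<tau> by simp
  have "v \<tau> = duhamel \<mu> (v 0) v \<tau>" "w \<tau> = duhamel \<mu> (w 0) w \<tau>"
    using bspec[OF veq \<tau>\<tau>] bspec[OF weq \<tau>\<tau>] by blast+
  then have F: "v \<tau> k = v 0 k - \<i> * \<mu> * integral {0..\<tau>} (\<lambda>s. interaction s (v s) (v s) k)"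
    "w \<tau> k = w 0 k - \<i> * \<mu> * integral {0..\<tau>} (\<lambda>s. interaction s (w s) (w s) k)" for k
    by (metis duhamel_def)+
  have "- (\<i> * \<mu>) * integral {0..\<tau>} (\<lambda>s. ?D s k)
      = (v \<tau> k - duhamel \<mu> (v 0) (\<lambda>_. v 0) \<tau> k) - (w \<tau> k - duhamel \<mu> (w 0) (\<lambda>_. w 0) \<tau> k)" for k
    unfolding I F duhamel_def by (simp add: algebra_simps)
  with le show ?thesis by simp
qed

section \<open>Fourier series on the torus\<close>

abbreviation "fc \<equiv> fourier_coeff"

definition fmode :: "int \<Rightarrow> real \<Rightarrow> complex" where
  "fmode k x = exp (\<i> * of_int k * of_real x)"

lemma cmod_fmode [simp]: "cmod (fmode k x) = 1"
proof -
  have "\<i> * of_int k * of_real x = \<i> * of_real (of_int k * x)" by simp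
  then show ?thesis unfolding fmode_def by (metis norm_exp_i_times)
qed

lemma fmode_0 [simp]: "fmode 0 x = 1" by (simp add: fmode_def)

lemma fmode_add: "fmode (j + k) x = fmode j x * fmode k x"
  by (simp add: fmode_def exp_add[symmetric] algebra_simps)

lemma cnj_fmode: "cnj (fmode k x) = fmode (- k) x"
  by (simp add: fmode_def exp_cnj)

lemma fmode_has_vector_derivative:
  "(fmode k has_vector_derivative (\<i> * of_int k * fmode k x)) (at x within S)"
proof -
  have "((\<lambda>z. exp (\<i> * of_int k * z)) has_field_derivative (\<i> * of_int k * exp (\<i> * of_int k * of_real x))) (at (of_real x))"
    by (auto intro!: derivative_eq_intros)
  from has_vector_derivative_real_field[OF this] show ?thesis by (simp add: fmode_def[abs_def])
qed

lemma continuous_on_fmode [continuous_intros]: "continuous_on S (fmode k)"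
  unfolding fmode_def by (intro continuous_intros)

lemma fmode_periodic: "fmode k (x + 2 * pi) = fmode k x"
proof -
  have "fmode k (x + 2 * pi) = fmode k x * exp (\<i> * of_int k * of_real (2 * pi))"
    by (simp add: fmode_def exp_add[symmetric] algebra_simps)
  also have "exp (\<i> * of_int k * of_real (2 * pi)) = 1"
    using exp_integer_2pi[of "of_int k"] by (simp add: mult_ac)
  finally show ?thesis by simp
qed

lemma fourier_coeff_fmode:
  "fc f k = (1 / (2 * pi)) * (LINT x|torus. f x * fmode (- k) x)"
  by (simp add: fourier_coeff_def fmode_def)

section \<open>Measurability, integrability and square integrability on the torus\<close>

lemma emeasure_torus: "emeasure torus {0<..<2 * pi} = ennreal (2 * pi)"
  by (subst emeasure_restrict_space) auto

lemma finite_measure_torus: "finite_measure torus"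
  by (rule finite_measureI) (simp add: emeasure_torus)

lemma measure_torus [simp]: "measure torus {0<..<2 * pi} = 2 * pi"
  by (simp add: measure_def emeasure_torus)

lemma continuous_measurable_torus:
  assumes "continuous_on {0<..<2*pi} f" shows "f \<in> borel_measurable torus"
  by (rule continuous_imp_measurable_on_sets_lebesgue[OF assms]) auto

lemma borel_measurable_fmode [measurable]: "fmode k \<in> borel_measurable torus"
  by (rule continuous_measurable_torus) (rule continuous_on_fmode)

lemma integrable_torus_bounded:
  fixes f :: "real \<Rightarrow> 'b::{banach, second_countable_topology}"
  assumes "f \<in> borel_measurable torus" "\<And>x. x \<in> {0<..<2*pi} \<Longrightarrow> norm (f x) \<le> B"
  shows "integrable torus f"
  by (rule finite_measure.integrable_const_bound[OF finite_measure_torus, where B = B])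
     (use assms in \<open>auto simp: AE_restrict_space_iff\<close>)

lemma integrable_torus_mult_bounded:
  fixes f g :: "real \<Rightarrow> complex"
  assumes "integrable torus f" "g \<in> borel_measurable torus" "\<And>x. x \<in> {0<..<2*pi} \<Longrightarrow> cmod (g x) \<le> B"
  shows "integrable torus (\<lambda>x. f x * g x)"
proof (rule Bochner_Integration.integrable_bound)
  show "integrable torus (\<lambda>x. B * cmod (f x))" using assms(1) by simp
  show "(\<lambda>x. f x * g x) \<in> borel_measurable torus" using assms(1,2) by measurable
  show "AE x in torus. norm (f x * g x) \<le> norm (B * cmod (f x))"
  proof (rule AE_I2)
    fix x assume "x \<in> space torus"
    then have b: "cmod (g x) \<le> B" using assms(3) by simp
    have "cmod (f x) * cmod (g x) \<le> cmod (f x) * B" by (rule mult_left_mono[OF b]) simp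
    moreover have "B \<ge> 0" using b norm_ge_zero order_trans by blast
    ultimately show "norm (f x * g x) \<le> norm (B * cmod (f x))" by (simp add: norm_mult mult.commute)
  qed
qed

lemma integrable_torus_mult_fmode: "integrable torus f \<Longrightarrow> integrable torus (\<lambda>x. f x * fmode k x)"
  by (rule integrable_torus_mult_bounded[where B = 1]) auto

lemma L2_measurable: "f \<in> L2 \<Longrightarrow> f \<in> borel_measurable torus" by (simp add: L2_def)

lemma L2_integrable: assumes "f \<in> L2" shows "integrable torus f"
proof (rule Bochner_Integration.integrable_bound)
  show "integrable torus (\<lambda>x. 1 + (cmod (f x))\<^sup>2)"
    using assms by (intro Bochner_Integration.integrable_add finite_measure.integrable_const finite_measure_torus) (auto simp: L2_def)
  have "y \<le> 1 + y\<^sup>2" for y :: real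
  proof -
    have "0 \<le> (y - 1/2)\<^sup>2" by simp
    then show ?thesis by (simp add: power2_eq_square algebra_simps)
  qed
  then have "cmod (f x) \<le> \<bar>1 + (cmod (f x))\<^sup>2\<bar>" for x by (smt (verit))
  then show "AE x in torus. norm (f x) \<le> norm (1 + (cmod (f x))\<^sup>2)" by simp
qed (use assms in \<open>simp add: L2_measurable\<close>)

lemma L2_bounded:
  assumes "f \<in> borel_measurable torus" "\<And>x. x \<in> {0<..<2*pi} \<Longrightarrow> cmod (f x) \<le> B" shows "f \<in> L2"
  unfolding L2_def
proof (safe)
  show "f \<in> borel_measurable torus" by fact
  show "integrable torus (\<lambda>x. (cmod (f x))\<^sup>2)"
    by (rule integrable_torus_bounded[where B = "B\<^sup>2"]) (use assms in \<open>auto intro: power_mono\<close>)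
qed

lemma L2_add:
  assumes "f \<in> L2" "g \<in> L2" shows "(\<lambda>x. f x + g x) \<in> L2"
proof -
  have [measurable]: "f \<in> borel_measurable torus" "g \<in> borel_measurable torus" using assms by (auto simp: L2_def)
  have "integrable torus (\<lambda>x. (cmod (f x + g x))\<^sup>2)"
  proof (rule Bochner_Integration.integrable_bound)
    show "integrable torus (\<lambda>x. 2 * (cmod (f x))\<^sup>2 + 2 * (cmod (g x))\<^sup>2)" using assms by (auto simp: L2_def)
    show "AE x in torus. norm ((cmod (f x + g x))\<^sup>2) \<le> norm (2 * (cmod (f x))\<^sup>2 + 2 * (cmod (g x))\<^sup>2)"
    proof (rule AE_I2)
      fix x
      have "(cmod (f x + g x))\<^sup>2 \<le> (cmod (f x) + cmod (g x))\<^sup>2" by (intro power_mono norm_triangle_ineq) auto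
      also have "\<dots> \<le> 2 * (cmod (f x))\<^sup>2 + 2 * (cmod (g x))\<^sup>2"
        using sum_squares_bound[of "cmod (f x)" "cmod (g x)"] by (simp add: power2_sum)
      finally show "norm ((cmod (f x + g x))\<^sup>2) \<le> norm (2 * (cmod (f x))\<^sup>2 + 2 * (cmod (g x))\<^sup>2)" by simp
    qed
  qed measurable
  then show ?thesis by (simp add: L2_def)
qed

lemma L2_uminus: "f \<in> L2 \<Longrightarrow> (\<lambda>x. - f x) \<in> L2"
  by (simp add: L2_def)

lemma L2_diff: "f \<in> L2 \<Longrightarrow> g \<in> L2 \<Longrightarrow> (\<lambda>x. f x - g x) \<in> L2"
  using L2_add[of f "\<lambda>x. - g x"] L2_uminus[of g] by simp

lemma measurable_cnj [measurable (raw)]: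
  "f \<in> borel_measurable M \<Longrightarrow> (\<lambda>x. cnj (f x)) \<in> borel_measurable M"
  by (rule borel_measurable_continuous_on[where f = cnj]) (auto intro: continuous_intros)

lemma L2_cnj: "f \<in> L2 \<Longrightarrow> (\<lambda>x. cnj (f x)) \<in> L2"
  unfolding L2_def by (auto intro: measurable_cnj)

section \<open>Calculus of Fourier coefficients\<close>

lemma fourier_coeff_add:
  assumes "integrable torus f" "integrable torus g"
  shows "fc (\<lambda>x. f x + g x) k = fc f k + fc g k"
  using assms by (simp add: fourier_coeff_fmode distrib_right integrable_torus_mult_fmode distrib_left add_divide_distrib)

lemma fourier_coeff_cmult: "fc (\<lambda>x. c * f x) k = c * fc f k"
  by (simp add: fourier_coeff_fmode mult.assoc)

lemma fourier_coeff_diff: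
  assumes "integrable torus f" "integrable torus g"
  shows "fc (\<lambda>x. f x - g x) k = fc f k - fc g k"
  using assms by (simp add: fourier_coeff_fmode left_diff_distrib integrable_torus_mult_fmode right_diff_distrib diff_divide_distrib)

lemma fourier_coeff_mult_fmode: "fc (\<lambda>x. f x * fmode j x) k = fc f (k - j)"
  by (simp add: fourier_coeff_fmode mult.assoc fmode_add[symmetric])

lemma fourier_coeff_sum:
  assumes "finite J" "\<And>j. j \<in> J \<Longrightarrow> integrable torus (f j)"
  shows "fc (\<lambda>x. \<Sum>j\<in>J. f j x) k = (\<Sum>j\<in>J. fc (f j) k)"
  using assms
proof (induction J rule: finite_induct)
  case empty then show ?case by (simp add: fourier_coeff_fmode)
next
  case (insert j J)
  then show ?case by (simp add: fourier_coeff_add)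
qed

lemma fourier_coeff_cong_AE:
  assumes "AE x in torus. f x = g x" "f \<in> borel_measurable torus" "g \<in> borel_measurable torus"
  shows "fc f k = fc g k"
  unfolding fourier_coeff_fmode using assms by (intro arg_cong2[where f = "(*)"] integral_cong_AE refl) (auto elim: eventually_mono)

lemma fourier_coeff_cnj: "fc (\<lambda>x. cnj (f x)) k = cnj (fc f (- k))"
proof -
  have "(LINT x|torus. cnj (f x) * fmode (- k) x) = (LINT x|torus. cnj (f x * fmode k x))"
    by (intro Bochner_Integration.integral_cong refl) (simp add: cnj_fmode)
  also have "\<dots> = cnj (LINT x|torus. f x * fmode k x)" by (rule Bochner_Integration.integral_cnj)
  finally show ?thesis by (simp add: fourier_coeff_fmode)
qed

lemma cmod_fourier_coeff_le:
  assumes "integrable torus f" 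
  shows "cmod (fc f k) \<le> (1 / (2 * pi)) * (LINT x|torus. cmod (f x))"
proof -
  have "cmod (LINT x|torus. f x * fmode (- k) x) \<le> (LINT x|torus. cmod (f x * fmode (- k) x))"
    by (rule integral_norm_bound)
  then show ?thesis unfolding fourier_coeff_fmode norm_mult by (auto simp: norm_mult norm_divide intro!: divide_right_mono)
qed

lemma lint_fmode: "(LINT x|torus. fmode k x) = (if k = 0 then 2 * pi else 0)"
proof (cases "k = 0")
  case True then show ?thesis by (simp add: scaleR_conv_of_real)
next
  case False
  have "(LINT x|torus. fmode k x) = integral {0<..<2*pi} (fmode k)"
    by (rule lebesgue_integral_eq_integral) (auto intro!: integrable_torus_bounded[where B = 1])
  also have "\<dots> = integral {0..2*pi} (fmode k)" by (simp add: integral_open_interval_real)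
  also have "\<dots> = 0"
  proof -
    have "(fmode k has_integral (inverse (\<i> * of_int k) * fmode k (2*pi) - inverse (\<i> * of_int k) * fmode k 0)) {0..2*pi}"
    proof (rule fundamental_theorem_of_calculus)
      fix x
      have "((\<lambda>x. inverse (\<i> * of_int k) * fmode k x) has_vector_derivative
          inverse (\<i> * of_int k) * (\<i> * of_int k * fmode k x)) (at x within {0..2*pi})"
        by (intro has_vector_derivative_mult_right fmode_has_vector_derivative)
      then show "((\<lambda>x. inverse (\<i> * of_int k) * fmode k x) has_vector_derivative fmode k x) (at x within {0..2*pi})"
        using False by (simp add: field_simps)
    qed simp
    moreover have "fmode k (2*pi) = fmode k 0" using fmode_periodic[of k 0] by simp
    ultimately show ?thesis by (simp add: integral_unique)
  qed
  finally show ?thesis using False by simp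
qed

lemma fourier_coeff_1: "fc (\<lambda>x. 1) k = (if k = 0 then 1 else 0)"
  by (simp add: fourier_coeff_fmode lint_fmode)

subsection \<open>Absolutely convergent series\<close>

text \<open>The inverse of taking Fourier coefficients. The free propagator and the inverse
  derivative are pointwise series of this form, so they are known through what they do to
  coefficients.\<close>

definition synth :: "(int \<Rightarrow> complex) \<Rightarrow> real \<Rightarrow> complex" where
  "synth a x = (\<Sum>\<^sub>\<infinity>k. a k * fmode k x)"

lemma summable_on_synth:
  assumes "(\<lambda>k. cmod (a k)) summable_on UNIV" shows "(\<lambda>k. a k * fmode k x) summable_on A"
proof -
  have "(\<lambda>k. cmod (a k)) summable_on A" using assms by (rule summable_on_subset_banach) auto
  note s = this
  show ?thesis by (rule abs_summable_summable) (use s in \<open>simp add: norm_mult\<close>)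
qed

text \<open>The remainder estimate of the Weierstrass M-test.\<close>

lemma infsum_tail_le:
  fixes f :: "int \<Rightarrow> complex"
  assumes B: "B summable_on UNIV" and le: "\<And>j. cmod (f j) \<le> B j" and J: "finite J"
  shows "cmod (infsum f UNIV - sum f J) \<le> infsum B UNIV - sum B J"
proof -
  have sf: "(\<lambda>j. cmod (f j)) summable_on UNIV" by (rule summable_on_comparison_test[OF B]) (use le in auto)
  have s: "f summable_on UNIV" by (rule abs_summable_summable[OF sf])
  have B': "B summable_on UNIV - J" using B by (rule summable_on_subset_banach) auto
  have "infsum f UNIV - sum f J = infsum f (UNIV - J)"
    using infsum_Diff[OF s summable_on_finite[OF J]] J by simp
  also have "cmod \<dots> \<le> infsum B (UNIV - J)"
    by (rule norm_infsum_le[OF has_sum_infsum has_sum_infsum]) 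
       (use le B' s in \<open>auto intro: summable_on_subset_banach\<close>)
  also have "\<dots> = infsum B UNIV - sum B J"
    using infsum_Diff[OF B summable_on_finite[OF J]] J by simp
  finally show ?thesis .
qed

lemma synth_tail:
  assumes "(\<lambda>k. cmod (a k)) summable_on UNIV" "finite J"
  shows "cmod (synth a x - (\<Sum>k\<in>J. a k * fmode k x)) \<le> (\<Sum>\<^sub>\<infinity>k. cmod (a k)) - (\<Sum>k\<in>J. cmod (a k))"
  unfolding synth_def by (rule infsum_tail_le[OF assms(1) _ assms(2)]) (simp add: norm_mult)

lemma tail_tendsto:
  fixes a :: "int \<Rightarrow> complex"
  assumes a: "(\<lambda>k. cmod (a k)) summable_on UNIV"
  shows "((\<lambda>J. (\<Sum>\<^sub>\<infinity>k. cmod (a k)) - (\<Sum>k\<in>J. cmod (a k))) \<longlongrightarrow> 0) (finite_subsets_at_top UNIV)"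
proof -
  have "((\<lambda>J. \<Sum>k\<in>J. cmod (a k)) \<longlongrightarrow> (\<Sum>\<^sub>\<infinity>k. cmod (a k))) (finite_subsets_at_top UNIV)"
    using has_sum_infsum[OF a] by (simp add: has_sum_def)
  from tendsto_diff[OF tendsto_const this, of "\<Sum>\<^sub>\<infinity>k. cmod (a k)"] show ?thesis by simp
qed

lemma cmod_synth_le:
  assumes "(\<lambda>k. cmod (a k)) summable_on UNIV" shows "cmod (synth a x) \<le> (\<Sum>\<^sub>\<infinity>k. cmod (a k))"
  using synth_tail[OF assms, of "{}"] by simp

lemma continuous_on_synth:
  assumes a: "(\<lambda>k. cmod (a k)) summable_on UNIV" shows "continuous_on S (synth a)"
proof (rule uniform_limit_theorem[where F = "finite_subsets_at_top UNIV" and f = "\<lambda>J x. \<Sum>k\<in>J. a k * fmode k x"])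
  show "\<forall>\<^sub>F J in finite_subsets_at_top UNIV. continuous_on S (\<lambda>x. \<Sum>k\<in>J. a k * fmode k x)"
    by (intro always_eventually allI continuous_intros)
  show "uniform_limit S (\<lambda>J x. \<Sum>k\<in>J. a k * fmode k x) (synth a) (finite_subsets_at_top UNIV)"
  proof (rule uniform_limitI)
    fix e :: real assume "e > 0"
    have fin: "\<forall>\<^sub>F J in finite_subsets_at_top (UNIV::int set). finite J"
      by (rule eventually_finite_subsets_at_top_weakI)
    show "\<forall>\<^sub>F J in finite_subsets_at_top UNIV. \<forall>x\<in>S. dist (\<Sum>k\<in>J. a k * fmode k x) (synth a x) < e"
      using order_tendstoD(2)[OF tail_tendsto[OF a] \<open>e > 0\<close>] fin
    proof eventually_elim
      case (elim J)
      then show ?case using synth_tail[OF a elim(2)] by (auto simp: dist_norm norm_minus_commute intro: le_less_trans)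
    qed
  qed
qed auto

lemma synth_measurable:
  "(\<lambda>k. cmod (a k)) summable_on UNIV \<Longrightarrow> synth a \<in> borel_measurable torus"
  by (rule continuous_measurable_torus[OF continuous_on_synth])

lemma synth_L2: "(\<lambda>k. cmod (a k)) summable_on UNIV \<Longrightarrow> synth a \<in> L2"
  by (rule L2_bounded[OF synth_measurable cmod_synth_le])

lemma integrable_mult_synth:
  "integrable torus g \<Longrightarrow> (\<lambda>k. cmod (a k)) summable_on UNIV \<Longrightarrow> integrable torus (\<lambda>x. g x * synth a x)"
  by (rule integrable_torus_mult_bounded[OF _ synth_measurable cmod_synth_le])

text \<open>The partial sums converge uniformly to the series, so after multiplication by an
  integrable g they converge in L1, where Fourier coefficients are continuous.\<close>

lemma fourier_coeff_mult_synth: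
  assumes g: "integrable torus g" and a: "(\<lambda>k. cmod (a k)) summable_on UNIV"
  shows "((\<lambda>j. a j * fc g (k - j)) has_sum fc (\<lambda>x. g x * synth a x) k) UNIV"
  unfolding has_sum_def
proof (rule Lim_transform2)
  define C where "C = (1 / (2 * pi)) * (LINT x|torus. cmod (g x))"
  let ?R = "\<lambda>J. fc (\<lambda>x. g x * synth a x) k - (\<Sum>j\<in>J. a j * fc g (k - j))"
  let ?D = "\<lambda>J x. g x * synth a x - g x * (\<Sum>j\<in>J. a j * fmode j x)"
  let ?t = "\<lambda>J. (\<Sum>\<^sub>\<infinity>k. cmod (a k)) - (\<Sum>k\<in>J. cmod (a k))"
  show "((\<lambda>_. fc (\<lambda>x. g x * synth a x) k) \<longlongrightarrow> fc (\<lambda>x. g x * synth a x) k) (finite_subsets_at_top UNIV)"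
    by (rule tendsto_const)
  show "(?R \<longlongrightarrow> 0) (finite_subsets_at_top UNIV)"
  proof (rule Lim_null_comparison)
    show "((\<lambda>J. ?t J * C) \<longlongrightarrow> 0) (finite_subsets_at_top UNIV)"
      using tendsto_mult_right[OF tail_tendsto[OF a], of C] by simp
    show "\<forall>\<^sub>F J in finite_subsets_at_top UNIV. norm (?R J) \<le> ?t J * C"
    proof (rule eventually_finite_subsets_at_top_weakI)
      fix J :: "int set" assume J: "finite J"
      have ij: "integrable torus (\<lambda>x. g x * (a j * fmode j x))" for j
        using integrable_torus_mult_fmode[OF g, of j] by (simp add: mult.left_commute)
      have "fc (\<lambda>x. g x * (\<Sum>j\<in>J. a j * fmode j x)) k = (\<Sum>j\<in>J. a j * fc g (k - j))"
        using fourier_coeff_sum[OF J, of "\<lambda>j x. g x * (a j * fmode j x)" k] ij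
        by (simp add: sum_distrib_left mult.left_commute[of "g _"] fourier_coeff_cmult fourier_coeff_mult_fmode)
      moreover have is_int: "integrable torus (\<lambda>x. g x * (\<Sum>j\<in>J. a j * fmode j x))"
        unfolding sum_distrib_left by (rule Bochner_Integration.integrable_sum) (rule ij)
      ultimately have "?R J
         = fc (?D J) k"
        using integrable_mult_synth[OF g a] by (simp add: fourier_coeff_diff)
      also have "cmod \<dots> \<le> (1 / (2 * pi)) * (LINT x|torus. cmod (?D J x))"
        by (rule cmod_fourier_coeff_le) (intro Bochner_Integration.integrable_diff is_int integrable_mult_synth g a)
      also have "\<dots> \<le> (1 / (2 * pi)) * (LINT x|torus. ?t J * cmod (g x))"
      proof (intro mult_left_mono integral_mono)
        fix x
        have "cmod (g x) * cmod (synth a x - (\<Sum>j\<in>J. a j * fmode j x)) \<le> cmod (g x) * ?t J"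
          by (rule mult_left_mono[OF synth_tail[OF a J]]) simp
        then show "cmod (?D J x) \<le> ?t J * cmod (g x)"
          by (simp add: right_diff_distrib[symmetric] norm_mult mult.commute)
      qed (use g is_int integrable_mult_synth[OF g a] in auto)
      also have "\<dots> = ?t J * C" by (simp add: C_def)
      finally show "norm (?R J) \<le> ?t J * C" .
    qed
  qed
qed

lemma integrable_torus_1: "integrable torus (\<lambda>x. 1 :: complex)"
  by (rule finite_measure.integrable_const[OF finite_measure_torus])

text \<open>The product formula with the constant function 1, whose only nonzero coefficient is at
  0.\<close>

lemma fourier_coeff_synth:
  assumes a: "(\<lambda>k. cmod (a k)) summable_on UNIV" shows "fc (synth a) k = a k"
proof -
  have "((\<lambda>j. a j * fc (\<lambda>x. 1) (k - j)) has_sum fc (\<lambda>x. 1 * synth a x) k) UNIV"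
    by (rule fourier_coeff_mult_synth[OF integrable_torus_1 a])
  moreover have "((\<lambda>j. a j * fc (\<lambda>x. 1) (k - j)) has_sum a k) UNIV"
    by (rule has_sum_finite_neutralI[where B = "{k}"]) (auto simp: fourier_coeff_1)
  ultimately show ?thesis using has_sum_unique by fastforce
qed

subsection \<open>Completeness of the Fourier modes\<close>

lemma cis_fmode: "cis x = fmode 1 x"
  by (simp add: fmode_def cis_conv_exp)

text \<open>A real-linear function of \<open>cis x\<close> is a combination of
  \<open>fmode 1\<close> and \<open>fmode (-1)\<close>, and multiplying by these only shifts
  coefficients. The quantifier over f stays inside the induction because in the product case the
  hypothesis for one factor is applied to f times the other.\<close>

lemma fourier_coeff_mult_real_polynomial:
  assumes "real_polynomial_function p"
  shows "\<forall>f. integrable torus f \<and> (\<forall>k. fc f k = 0) \<longrightarrow>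
     integrable torus (\<lambda>x. f x * of_real (p (cis x))) \<and> (\<forall>k. fc (\<lambda>x. f x * of_real (p (cis x))) k = 0)"
  using assms
proof (induction p rule: real_polynomial_function.induct)
  case (linear p)
  define c d :: complex where "c = (p 1 - \<i> * p \<i>) / 2" and "d = (p 1 + \<i> * p \<i>) / 2"
  have eq: "f * of_real (p (cis x)) = c * (f * fmode 1 x) + d * (f * fmode (-1) x)" for f x
  proof -
    have "cis x = cos x *\<^sub>R 1 + sin x *\<^sub>R \<i>" by (simp add: complex_eq_iff)
    then have "p (cis x) = cos x * p 1 + sin x * p \<i>"
      using linear by (simp add: linear_simps bounded_linear.linear linear_add linear_scale)
    moreover have e1: "fmode 1 x = cos x + \<i> * sin x" by (simp add: cis_fmode[symmetric] complex_eq_iff)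
    moreover have e2: "fmode (-1) x = cos x - \<i> * sin x"
      using cnj_fmode[of 1 x] by (simp add: cis_fmode[symmetric] complex_eq_iff)
    ultimately show ?thesis unfolding c_def d_def e1 e2 by (simp add: field_simps)
  qed
  show ?case
    unfolding eq by (auto simp: fourier_coeff_add fourier_coeff_cmult integrable_torus_mult_fmode fourier_coeff_mult_fmode)
next
  case (const c)
  show ?case using fourier_coeff_cmult[of "of_real c"] by (auto simp: mult.commute[of _ "of_real c"])
next
  case (add p q)
  then show ?case by (auto simp: distrib_left fourier_coeff_add)
next
  case (mult p q)
  show ?case
  proof (intro allI impI)
    fix f assume f: "integrable torus f \<and> (\<forall>k. fc f k = 0)"
    from mult.IH(2)[rule_format, OF mult.IH(1)[rule_format, OF f]]
    show "integrable torus (\<lambda>x. f x * of_real (p (cis x) * q (cis x)))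
      \<and> (\<forall>k. fc (\<lambda>x. f x * of_real (p (cis x) * q (cis x))) k = 0)"
      by (simp add: mult.assoc)
  qed
qed

text \<open>Stone-Weierstrass on the circle: F is uniformly close to a polynomial p, and the
  integral of f times p is a multiple of a vanishing zero coefficient.\<close>

lemma integral_mult_continuous_circle:
  fixes F :: "complex \<Rightarrow> real"
  assumes f: "integrable torus f" "\<And>k. fc f k = 0" and F: "continuous_on (sphere 0 1) F"
  shows "(LINT x|torus. f x * of_real (F (cis x))) = 0"
proof -
  have cF: "continuous_on UNIV (\<lambda>x. F (cis x))"
    by (rule continuous_on_compose2[OF F]) (auto intro!: continuous_intros)
  have bnd: "bounded (F ` sphere 0 1)" by (intro compact_imp_bounded compact_continuous_image F compact_sphere)
  then obtain B where B: "\<And>z. z \<in> sphere 0 1 \<Longrightarrow> \<bar>F z\<bar> \<le> B"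
    unfolding bounded_iff by (metis imageI real_norm_def)
  have meas: "(\<lambda>x. complex_of_real (F (cis x))) \<in> borel_measurable torus"
    by (rule continuous_measurable_torus) (intro continuous_intros continuous_on_subset[OF cF] subset_UNIV)
  have iF: "integrable torus (\<lambda>x. f x * of_real (F (cis x)))"
    by (rule integrable_torus_mult_bounded[OF f(1) meas, where B = B]) (auto intro: B)
  define N where "N = (LINT x|torus. cmod (f x))"
  have N: "N \<ge> 0" by (simp add: N_def)
  have "cmod (LINT x|torus. f x * of_real (F (cis x))) \<le> 0 + e" if e: "e > 0" for e
  proof -
    define d where "d = e / (N + 1)"
    have d: "d > 0" using e N by (simp add: d_def)
    obtain p where p: "real_polynomial_function p" "\<And>z. z \<in> sphere 0 1 \<Longrightarrow> \<bar>F z - p z\<bar> < d"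
      by (rule Stone_Weierstrass_real_polynomial_function[OF compact_sphere F d]) auto
    have pp: "integrable torus (\<lambda>x. f x * of_real (p (cis x)))" "fc (\<lambda>x. f x * of_real (p (cis x))) 0 = 0"
      using fourier_coeff_mult_real_polynomial[OF p(1)] f by blast+
    then have "(LINT x|torus. f x * of_real (p (cis x))) = 0" by (simp add: fourier_coeff_fmode)
    then have "(LINT x|torus. f x * of_real (F (cis x))) = (LINT x|torus. f x * of_real (F (cis x)) - f x * of_real (p (cis x)))"
      using iF pp(1) by simp
    also have "cmod \<dots> \<le> (LINT x|torus. cmod (f x * of_real (F (cis x)) - f x * of_real (p (cis x))))"
      by (rule integral_norm_bound)
    also have "\<dots> \<le> (LINT x|torus. d * cmod (f x))"
    proof (rule integral_mono)
      fix x
      have "cmod (f x) * \<bar>F (cis x) - p (cis x)\<bar> \<le> cmod (f x) * d"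
        using p(2)[of "cis x"] by (intro mult_left_mono) auto
      then show "cmod (f x * of_real (F (cis x)) - f x * of_real (p (cis x))) \<le> d * cmod (f x)"
        by (simp add: right_diff_distrib[symmetric] norm_mult mult.commute flip: of_real_diff)
    qed (use iF pp f in auto)
    also have "\<dots> = d * N" by (simp add: N_def)
    also have "\<dots> \<le> e" using e N by (simp add: d_def divide_simps)
    finally show ?thesis by simp
  qed
  then have "cmod (LINT x|torus. f x * of_real (F (cis x))) \<le> 0" by (rule field_le_epsilon)
  then show ?thesis by simp
qed

text \<open>The factor \<open>1 - Re z\<close> removes the discontinuity of the argument at \<open>z = 1\<close>.\<close>

lemma continuous_on_circle_cutoff:
  assumes h: "continuous_on UNIV h" and b: "\<And>x. \<bar>h x\<bar> \<le> 1"
  shows "continuous_on (sphere 0 1) (\<lambda>z. (1 - Re z) * h (Arg2pi z))"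
  unfolding continuous_on_eq_continuous_within
proof
  fix z :: complex assume z: "z \<in> sphere 0 1"
  show "continuous (at z within sphere 0 1) (\<lambda>z. (1 - Re z) * h (Arg2pi z))"
  proof (cases "z = 1")
    case True
    have "((\<lambda>z. (1 - Re z) * h (Arg2pi z)) \<longlongrightarrow> 0) (at z within sphere 0 1)"
    proof (rule Lim_null_comparison)
      have "((\<lambda>z. \<bar>1 - Re z\<bar>) \<longlongrightarrow> \<bar>1 - Re z\<bar>) (at z within sphere 0 1)" by (intro tendsto_intros)
      then show "((\<lambda>z. \<bar>1 - Re z\<bar>) \<longlongrightarrow> 0) (at z within sphere 0 1)" using True by simp
      show "\<forall>\<^sub>F x in at z within sphere 0 1. norm ((1 - Re x) * h (Arg2pi x)) \<le> \<bar>1 - Re x\<bar>"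
      proof (intro always_eventually allI)
        fix x show "norm ((1 - Re x) * h (Arg2pi x)) \<le> \<bar>1 - Re x\<bar>"
          using mult_left_mono[OF b[of "Arg2pi x"], of "\<bar>1 - Re x\<bar>"] by (simp add: abs_mult)
      qed
    qed
    then show ?thesis using True by (simp add: continuous_within)
  next
    case False
    have "\<not> (z \<in> \<real> \<and> 0 \<le> Re z)"
    proof
      assume *: "z \<in> \<real> \<and> 0 \<le> Re z"
      then have "z = of_real (Re z)" by (simp add: complex_is_Real_iff complex_eq_iff del: of_real_Re)
      moreover from this have "\<bar>Re z\<bar> = 1" using z by (metis mem_sphere_0 norm_of_real)
      then have "Re z = 1" using * by simp
      ultimately show False using False by simp
    qed
    then have "z \<notin> \<real>\<^sub>\<ge>\<^sub>0" by (auto simp: complex_nonneg_Reals_iff complex_is_Real_iff)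
    then have A: "isCont Arg2pi z" by (rule continuous_at_Arg2pi)
    have "isCont h (Arg2pi z)" using h by (simp add: continuous_on_eq_continuous_at)
    then have "isCont (\<lambda>z. h (Arg2pi z)) z" by (rule isCont_o2[OF A])
    then have "isCont (\<lambda>z. (1 - Re z) * h (Arg2pi z)) z"
      by (intro continuous_intros bounded_linear.isCont[OF bounded_linear_Re continuous_ident])
    then show ?thesis by (rule continuous_at_imp_continuous_at_within)
  qed
qed

text \<open>Indicators are almost everywhere limits of continuous functions on the line, which need
  not close up periodically. The weight 1 - cos x, which vanishes at both ends of the interval,
  makes them continuous on the circle; being nonzero inside the interval, it is divided out at the
  end.\<close>

lemma fourier_coeff_eq_0_imp_AE:
  assumes f: "integrable torus f" and f0: "\<And>k. fc f k = 0"
  shows "AE x in torus. f x = 0"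
proof -
  define g where "g x = f x * of_real (1 - cos x)" for x
  have mc: "(\<lambda>x. complex_of_real (1 - cos x)) \<in> borel_measurable torus"
    by (rule continuous_measurable_torus) (intro continuous_intros)
  have cb: "cmod (of_real (1 - cos x)) \<le> 2" for x
    using cos_ge_minus_one[of x] cos_le_one[of x] by (subst norm_of_real) auto
  have g: "integrable torus g" unfolding g_def by (rule integrable_torus_mult_bounded[OF f mc cb])
  have "AE x in torus. g x = 0"
  proof (rule sigma_finite_measure.density_zero[OF finite_measure.axioms(1)[OF finite_measure_torus] g])
    fix A assume A: "A \<in> sets torus"
    then have A': "A \<in> sets lebesgue" "A \<subseteq> {0<..<2*pi}" by (auto simp: sets_restrict_space)
    have "(indicator A :: real \<Rightarrow> real) \<in> borel_measurable (lebesgue_on UNIV)"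
      using A' by (simp add: lebesgue_on_UNIV_eq)
    then have "(indicator A :: real \<Rightarrow> real) measurable_on UNIV"
      by (subst measurable_on_iff_borel_measurable) auto
    then obtain N q where N: "negligible N" and q: "\<And>n. continuous_on UNIV (q n)"
      and lim: "\<And>x. x \<notin> N \<Longrightarrow> (\<lambda>n. q n x) \<longlonglongrightarrow> (indicator A x :: real)"
      unfolding measurable_on_def by auto
    \<comment> \<open>Clamping to [0, 1] keeps the limit, which is an indicator, and gives the
      dominating function \<open>cmod (g x)\<close>.\<close>
    define h where "h n x = max 0 (min 1 (q n x))" for n x
    have h: "continuous_on UNIV (h n)" "\<bar>h n x\<bar> \<le> 1" for n x
      unfolding h_def by (intro continuous_intros q) (auto simp: max_def min_def)
    have hlim: "(\<lambda>n. h n x) \<longlonglongrightarrow> indicator A x" if "x \<notin> N" for x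
    proof -
      have "(\<lambda>n. h n x) \<longlonglongrightarrow> max 0 (min 1 (indicator A x))"
        unfolding h_def by (intro tendsto_intros lim that)
      then show ?thesis by (auto simp: indicator_def)
    qed
    have zero: "(LINT x|torus. g x * of_real (h n x)) = 0" for n
    proof -
      have "(LINT x|torus. f x * of_real ((1 - Re (cis x)) * h n (Arg2pi (cis x)))) = 0"
        by (rule integral_mult_continuous_circle[OF f f0 continuous_on_circle_cutoff[OF h]])
      moreover have "(LINT x|torus. g x * of_real (h n x)) = (LINT x|torus. f x * of_real ((1 - Re (cis x)) * h n (Arg2pi (cis x))))"
      proof (rule Bochner_Integration.integral_cong[OF refl])
        fix x assume "x \<in> space torus"
        then have "Arg2pi (cis x) = x" by (intro Arg2pi_unique[of 1]) (auto simp: cis_conv_exp)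
        then show "g x * of_real (h n x) = f x * of_real ((1 - Re (cis x)) * h n (Arg2pi (cis x)))"
          by (simp add: g_def)
      qed
      ultimately show ?thesis by simp
    qed
    have "(\<lambda>n. LINT x|torus. g x * of_real (h n x)) \<longlonglongrightarrow> (LINT x|torus. g x * of_real (indicator A x))"
    proof (rule integral_dominated_convergence[where w = "\<lambda>x. cmod (g x)"])
      have "(\<lambda>x. complex_of_real (h n x)) \<in> borel_measurable torus" for n
        by (rule continuous_measurable_torus) (intro continuous_intros continuous_on_subset[OF h(1)] subset_UNIV)
      then show "(\<lambda>x. g x * of_real (h n x)) \<in> borel_measurable torus" for n using g by measurable
      show "(\<lambda>x. g x * of_real (indicator A x)) \<in> borel_measurable torus" using g A by measurable
      show "integrable torus (\<lambda>x. cmod (g x))" using g by simp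
      have "N \<in> null_sets lebesgue" using N by (simp add: negligible_iff_null_sets)
      then have "AE x in torus. x \<notin> N" by (auto simp: AE_restrict_space_iff dest: AE_not_in elim: eventually_mono)
      then show "AE x in torus. (\<lambda>n. g x * of_real (h n x)) \<longlonglongrightarrow> g x * of_real (indicator A x)"
        by eventually_elim (intro tendsto_intros hlim)
      show "AE x in torus. norm (g x * of_real (h n x)) \<le> cmod (g x)" for n
        using mult_left_mono[OF h(2)[of n]] by (intro AE_I2) (simp add: norm_mult)
    qed
    then have "(LINT x|torus. g x * of_real (indicator A x)) = 0" by (simp add: zero LIMSEQ_const_iff)
    then show "set_lebesgue_integral torus A g = 0"
      unfolding set_lebesgue_integral_def by (simp add: scaleR_conv_of_real mult.commute)
  qed
  moreover have "AE x in torus. x \<in> {0<..<2*pi}" by (rule AE_I2) simp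
  ultimately show ?thesis
  proof eventually_elim
    case (elim x)
    have "cos x \<noteq> 1"
    proof
      assume "cos x = 1"
      then obtain n :: int where n: "x = of_int n * (2 * pi)" by (auto simp: cos_one_2pi_int)
      then have "0 < real_of_int n" "real_of_int n < 1" using elim by (auto simp: zero_less_mult_iff)
      then have "0 < n" "n < 1" by simp_all
      then show False by simp
    qed
    then show ?case using elim(1) unfolding g_def mult_eq_0_iff of_real_eq_0_iff by simp
  qed
qed

text \<open>Both sides have the same coefficients, so their difference vanishes almost everywhere.
  This is how information on coefficients returns to functions.\<close>

lemma AE_eq_synth:
  assumes f: "integrable torus f" and s: "(\<lambda>k. cmod (fc f k)) summable_on UNIV"
  shows "AE x in torus. f x = synth (fc f) x"
proof -
  have i: "integrable torus (synth (fc f))" by (rule L2_integrable[OF synth_L2[OF s]])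
  have "AE x in torus. f x - synth (fc f) x = 0"
    by (rule fourier_coeff_eq_0_imp_AE)
       (use f i in \<open>auto simp: fourier_coeff_diff fourier_coeff_synth[OF s]\<close>)
  then show ?thesis by simp
qed

section \<open>Sobolev functions and their Fourier coefficients\<close>

lemma sobolev_L2: "f \<in> sobolev r \<Longrightarrow> f \<in> L2"
  by (simp add: sobolev_def)

lemma sobolev_integrable: "f \<in> sobolev r \<Longrightarrow> integrable torus f"
  by (rule L2_integrable[OF sobolev_L2])

lemma sobolev_imp_sob_le:
  assumes "f \<in> sobolev r"
  shows "sob_le r (fc f) (norm_sobolev r f / sqrt (2 * pi))"
  unfolding sob_le_def
proof (intro allI impI)
  fix F :: "int set" assume F: "finite F"
  let ?g = "\<lambda>k::int. (1 + (of_int k)\<^sup>2) powr r * (cmod (fc f k))\<^sup>2"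
  have s: "?g summable_on UNIV" using assms by (simp add: sobolev_def)
  have "L2_set (\<lambda>k. sob_weight r k * cmod (fc f k)) F = sqrt (sum ?g F)"
    by (simp add: L2_set_def power_mult_distrib sob_weight_square)
  also have "\<dots> \<le> sqrt (infsum ?g UNIV)"
    by (intro real_sqrt_le_mono finite_sum_le_infsum s F) auto
  also have "\<dots> = norm_sobolev r f / sqrt (2 * pi)"
    by (simp add: norm_sobolev_def real_sqrt_mult)
  finally show "L2_set (\<lambda>k. sob_weight r k * cmod (fc f k)) F \<le> norm_sobolev r f / sqrt (2 * pi)" .
qed

lemma sob_le_sum_squares:
  assumes "sob_le r a M" "finite F"
  shows "(\<Sum>k\<in>F. (1 + (of_int k)\<^sup>2) powr r * (cmod (a k))\<^sup>2) \<le> M\<^sup>2"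
proof -
  have "(\<Sum>k\<in>F. (1 + (of_int k)\<^sup>2) powr r * (cmod (a k))\<^sup>2) = (L2_set (\<lambda>k. sob_weight r k * cmod (a k)) F)\<^sup>2"
    by (simp add: L2_set_def power_mult_distrib sob_weight_square sum_nonneg)
  also have "\<dots> \<le> M\<^sup>2"
    using assms by (intro power_mono) (auto simp: sob_le_def L2_set_nonneg)
  finally show ?thesis .
qed

lemma sob_le_summable_squares:
  assumes "sob_le r a M"
  shows "(\<lambda>k::int. (1 + (of_int k)\<^sup>2) powr r * (cmod (a k))\<^sup>2) summable_on UNIV"
  by (rule nonneg_bdd_above_summable_on)
     (auto simp: bdd_above_def intro!: exI[of _ "M\<^sup>2"] sob_le_sum_squares[OF assms])

lemma sob_le_imp_sobolev:
  assumes "f \<in> L2" "sob_le r (fc f) M"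
  shows "f \<in> sobolev r" "norm_sobolev r f \<le> sqrt (2 * pi) * M"
proof -
  let ?g = "\<lambda>k::int. (1 + (of_int k)\<^sup>2) powr r * (cmod (fc f k))\<^sup>2"
  note s = sob_le_summable_squares[OF assms(2)]
  show "f \<in> sobolev r" using assms(1) s by (simp add: sobolev_def)
  have "infsum ?g UNIV \<le> M\<^sup>2"
    by (rule infsum_le_finite_sums[OF s]) (rule sob_le_sum_squares[OF assms(2)])
  then have "sqrt (2 * pi * infsum ?g UNIV) \<le> sqrt (2 * pi * M\<^sup>2)"
    by (intro real_sqrt_le_mono mult_left_mono) auto
  then show "norm_sobolev r f \<le> sqrt (2 * pi) * M"
    using sob_le_nonneg[OF assms(2)] by (simp add: norm_sobolev_def real_sqrt_mult)
qed

lemma sobolev_diff: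
  assumes "f \<in> sobolev r" "g \<in> sobolev r" shows "(\<lambda>x. f x - g x) \<in> sobolev r"
proof (rule sob_le_imp_sobolev(1))
  show "(\<lambda>x. f x - g x) \<in> L2" using assms by (intro L2_diff sobolev_L2)
  have "fc (\<lambda>x. f x - g x) = (\<lambda>k. fc f k - fc g k)"
    using assms by (intro ext fourier_coeff_diff sobolev_integrable)
  then show "sob_le r (fc (\<lambda>x. f x - g x)) (norm_sobolev r f / sqrt (2 * pi) + norm_sobolev r g / sqrt (2 * pi))"
    using sob_le_diff[OF sobolev_imp_sob_le[OF assms(1)] sobolev_imp_sob_le[OF assms(2)]] by simp
qed

lemma sobolev_abs_summable:
  "f \<in> sobolev r \<Longrightarrow> r > 1/2 \<Longrightarrow> (\<lambda>k. cmod (fc f k)) summable_on UNIV"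
  by (rule sob_le_abs_summable[OF sobolev_imp_sob_le])

lemma synth_sobolev:
  assumes "sob_le r a M" "r > 1/2" shows "synth a \<in> sobolev r" "fc (synth a) = a"
proof -
  note s = sob_le_abs_summable[OF assms]
  show eq: "fc (synth a) = a" by (rule ext) (rule fourier_coeff_synth[OF s])
  show "synth a \<in> sobolev r"
    by (rule sob_le_imp_sobolev(1)[OF synth_L2[OF s]]) (use assms eq in simp)
qed

lemma fourier_coeff_mult:
  assumes f: "integrable torus f" and g: "integrable torus g"
    and s: "(\<lambda>k. cmod (fc g k)) summable_on UNIV"
  shows "((\<lambda>j. fc g j * fc f (k - j)) has_sum fc (\<lambda>x. f x * g x) k) UNIV"
    and "integrable torus (\<lambda>x. f x * g x)"
proof -
  have [measurable]: "f \<in> borel_measurable torus" "g \<in> borel_measurable torus"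
    "synth (fc g) \<in> borel_measurable torus"
    using f g synth_measurable[OF s] by auto
  have ae: "AE x in torus. f x * g x = f x * synth (fc g) x"
    using AE_eq_synth[OF g s] by eventually_elim simp
  have "fc (\<lambda>x. f x * g x) k = fc (\<lambda>x. f x * synth (fc g) x) k"
    by (rule fourier_coeff_cong_AE[OF ae]) measurable
  then show "((\<lambda>j. fc g j * fc f (k - j)) has_sum fc (\<lambda>x. f x * g x) k) UNIV"
    using fourier_coeff_mult_synth[OF f s, of k] by simp
  have "integrable torus (\<lambda>x. f x * g x) \<longleftrightarrow> integrable torus (\<lambda>x. f x * synth (fc g) x)"
    by (rule integrable_cong_AE[OF _ _ ae]) measurable
  then show "integrable torus (\<lambda>x. f x * g x)" using integrable_mult_synth[OF f s] by simp
qed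

lemma abs_summable_uminus:
  fixes a :: "int \<Rightarrow> complex"
  assumes "(\<lambda>k. cmod (a k)) summable_on UNIV" shows "(\<lambda>k. cmod (a (- k))) summable_on UNIV"
  using assms summable_on_reindex_bij_betw[OF bij_uminus[where 'a = int], of "\<lambda>k. cmod (a k)"] by simp

text \<open>Conjugation reflects the index, so the convolution becomes a correlation, which is the
  interaction at time 0, where all phases are 1.\<close>

lemma fourier_coeff_mult_cnj:
  assumes f: "integrable torus f" and g: "integrable torus g"
    and s: "(\<lambda>k. cmod (fc g k)) summable_on UNIV"
  shows "fc (\<lambda>x. f x * cnj (g x)) k = interaction 0 (fc f) (fc g) k"
    and "integrable torus (\<lambda>x. f x * cnj (g x))"
proof -
  have s': "(\<lambda>k. cmod (fc (\<lambda>x. cnj (g x)) k)) summable_on UNIV"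
    using abs_summable_uminus[OF s] by (simp add: fourier_coeff_cnj)
  have g': "integrable torus (\<lambda>x. cnj (g x))" using g by simp
  have "((\<lambda>j. cnj (fc g (- j)) * fc f (k - j)) has_sum fc (\<lambda>x. f x * cnj (g x)) k) UNIV"
    using fourier_coeff_mult(1)[OF f g' s', of k] by (simp add: fourier_coeff_cnj)
  then have "((\<lambda>j. cnj (fc g j) * fc f (k + j)) has_sum fc (\<lambda>x. f x * cnj (g x)) k) UNIV"
    by (subst has_sum_reindex_bij_betw[OF bij_uminus, symmetric]) simp
  then show "fc (\<lambda>x. f x * cnj (g x)) k = interaction 0 (fc f) (fc g) k"
    by (simp add: interaction_def infsumI mult.commute)
  show "integrable torus (\<lambda>x. f x * cnj (g x))" by (rule fourier_coeff_mult(2)[OF f g' s'])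
qed

text \<open>Parseval's identity, read off from the zero coefficient of f times its
  conjugate.\<close>

lemma norm_L2_square:
  assumes f: "f \<in> L2" and s: "(\<lambda>k. cmod (fc f k)) summable_on UNIV"
  shows "of_real ((norm_L2 f)\<^sup>2) = 2 * pi * interaction 0 (fc f) (fc f) 0"
proof -
  have "(norm_L2 f)\<^sup>2 = (LINT x|torus. (cmod (f x))\<^sup>2)" by (simp add: norm_L2_def)
  then have "complex_of_real ((norm_L2 f)\<^sup>2) = (LINT x|torus. complex_of_real ((cmod (f x))\<^sup>2))"
    by (simp only: integral_complex_of_real)
  also have "\<dots> = (LINT x|torus. f x * cnj (f x))" by (simp only: complex_norm_square)
  also have "\<dots> = 2 * pi * fc (\<lambda>x. f x * cnj (f x)) 0" by (simp add: fourier_coeff_fmode)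
  finally show ?thesis by (simp only: fourier_coeff_mult_cnj(1)[OF L2_integrable[OF f] L2_integrable[OF f] s])
qed

subsection \<open>The free propagator\<close>

definition free_phase :: "real \<Rightarrow> int \<Rightarrow> complex" where
  "free_phase t k = exp (- (\<i> * of_real t * (of_int k)\<^sup>2))"

lemma cmod_free_phase [simp]: "cmod (free_phase t k) = 1"
proof -
  have "- (\<i> * of_real t * (of_int k)\<^sup>2) = \<i> * complex_of_real (- (t * (of_int k)\<^sup>2))" by simp
  then show ?thesis unfolding free_phase_def by (metis norm_exp_i_times)
qed

lemma free_phase_0 [simp]: "free_phase 0 k = 1" "free_phase t 0 = 1" by (simp_all add: free_phase_def)

lemma free_phase_uminus: "free_phase (- t) k = cnj (free_phase t k)"
  by (simp add: free_phase_def exp_cnj)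

lemma free_phase_add: "free_phase (s + t) k = free_phase s k * free_phase t k"
  by (simp add: free_phase_def exp_add[symmetric] algebra_simps)

lemma free_phase_inverse: "free_phase (- t) k * free_phase t k = 1"
  using free_phase_add[of "- t" t k] by simp

lemma free_phase_k_uminus: "free_phase t (- k) = free_phase t k" by (simp add: free_phase_def)

lemma sob_le_free_phase: "sob_le r (\<lambda>k. free_phase t k * a k) M \<longleftrightarrow> sob_le r a M"
  by (auto elim!: sob_le_dominated simp: norm_mult)

lemma schroedinger_group_eq_synth: "schroedinger_group t f = synth (\<lambda>k. free_phase t k * fc f k)"
  by (simp add: schroedinger_group_def synth_def free_phase_def fmode_def fun_eq_iff)

definition inv_deriv :: "(int \<Rightarrow> complex) \<Rightarrow> int \<Rightarrow> complex" where
  "inv_deriv a k = (if k = 0 then 0 else inverse (\<i> * of_int k) * a k)"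

lemma inv_dx_eq_synth: "inv_dx f = synth (inv_deriv (fc f))"
  unfolding inv_dx_def synth_def fmode_def fun_eq_iff inv_deriv_def
  by (intro allI infsum_cong_neutral) auto

lemma cmod_inv_deriv_le: "cmod (inv_deriv a k) \<le> cmod (a k)"
proof (cases "k = 0")
  case False
  then have "\<bar>real_of_int k\<bar> \<ge> 1" by linarith
  then have "inverse \<bar>real_of_int k\<bar> * cmod (a k) \<le> 1 * cmod (a k)"
    by (intro mult_right_mono) (auto simp: inverse_le_1_iff)
  then show ?thesis using False by (simp add: inv_deriv_def norm_mult norm_inverse)
qed (simp add: inv_deriv_def)

lemma sob_le_inv_deriv: "sob_le r a M \<Longrightarrow> sob_le r (inv_deriv a) M"
  by (erule sob_le_dominated) (rule cmod_inv_deriv_le)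

text \<open>Since (k + j)^2 - j^2 = k^2 + 2 k j, the phase of the output factors out and
  \<open>osc\<close> remains. The identity serves twice: for the equation itself, and for the
  product of propagated functions in the coarse propagator.\<close>

lemma interaction_gauge:
  "interaction 0 (\<lambda>k. free_phase t k * a k) (\<lambda>k. free_phase t k * b k) k = free_phase t k * interaction t a b k"
proof -
  have *: "free_phase t (k + j) * cnj (free_phase t j) = free_phase t k * osc t k j" for j
    by (simp add: free_phase_def exp_cnj exp_add[symmetric] power2_eq_square algebra_simps)
  have "osc 0 k j * (free_phase t (k + j) * a (k + j) * cnj (free_phase t j * b j))
     = free_phase t k * (osc t k j * (a (k + j) * cnj (b j)))" for j
  proof -
    have "osc 0 k j * (free_phase t (k + j) * a (k + j) * cnj (free_phase t j * b j))
       = (free_phase t (k + j) * cnj (free_phase t j)) * (a (k + j) * cnj (b j))" by simp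
    then show ?thesis by (simp only: * mult.assoc)
  qed
  then show ?thesis unfolding interaction_def by (simp only: infsum_cmult_right')
qed

section \<open>The coarse propagator in Fourier space\<close>

text \<open>Sum and integral may be exchanged because the tail bound of the interaction is uniform
  in time.\<close>

lemma has_sum_integral_interaction:
  assumes a: "sob_le r a M" and b: "sob_le r b N" and r: "r > 1/2" and \<tau>: "\<tau> \<ge> 0"
  shows "((\<lambda>j. integral {0..\<tau>} (\<lambda>s. osc s k j * (a (k + j) * cnj (b j))))
     has_sum integral {0..\<tau>} (\<lambda>s. interaction s a b k)) UNIV"
proof -
  let ?f = "\<lambda>j s. osc s k j * (a (k + j) * cnj (b j))"
  have M: "M \<ge> 0" and N: "N \<ge> 0" using a b sob_le_nonneg by auto
  have cI: "continuous_on {0..\<tau>} (\<lambda>s. interaction s a b k)"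
    by (rule continuous_on_interaction[OF r, where M = M and N = N]) (use a b in auto)
  have cf: "continuous_on {0..\<tau>} (?f j)" for j by (intro continuous_intros)
  show ?thesis
    unfolding has_sum_def tendsto_iff eventually_finite_subsets_at_top
  proof (intro allI impI)
    fix e :: real assume e: "e > 0"
    define d where "d = e / (\<tau> * M * N + 1)"
    have X: "\<tau> * M * N + 1 > 0" using \<tau> M N by (simp add: add_nonneg_pos)
    have d: "d > 0" using e X by (simp add: d_def)
    obtain J where J: "finite J"
      and tail: "\<And>F. finite F \<Longrightarrow> F \<inter> J = {} \<Longrightarrow> L2_set (\<lambda>k. inverse (sob_weight r k)) F \<le> d"
      using sob_emb_tail[OF r d] by blast
    show "\<exists>J. finite J \<and> J \<subseteq> UNIV \<and> (\<forall>Y. finite Y \<and> J \<subseteq> Y \<and> Y \<subseteq> UNIV \<longrightarrow>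
        dist (\<Sum>j\<in>Y. integral {0..\<tau>} (?f j)) (integral {0..\<tau>} (\<lambda>s. interaction s a b k)) < e)"
    proof (intro exI[of _ J] conjI allI impI J)
      fix Y assume Y: "finite Y \<and> J \<subseteq> Y \<and> Y \<subseteq> UNIV"
      have "integral {0..\<tau>} (\<lambda>s. interaction s a b k) - (\<Sum>j\<in>Y. integral {0..\<tau>} (?f j))
        = integral {0..\<tau>} (\<lambda>s. interaction s a b k - (\<Sum>j\<in>Y. ?f j s))"
        using Y by (simp add: integral_sum integral_diff integrable_continuous_interval cI cf continuous_on_sum)
      also have "cmod \<dots> \<le> (M * (N * d)) * (\<tau> - 0)"
      proof (rule integral_bound[OF \<tau>])
        show "continuous_on {0..\<tau>} (\<lambda>s. interaction s a b k - (\<Sum>j\<in>Y. ?f j s))"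
          by (intro continuous_on_diff continuous_on_sum cI cf)
        show "cmod (interaction s a b k - (\<Sum>j\<in>Y. ?f j s)) \<le> M * (N * d)" for s
          by (intro interaction_tail[OF a b r] tail) (use Y in auto)
      qed
      also have "\<dots> = (\<tau> * M * N) * d" by simp
      also have "\<dots> < (\<tau> * M * N + 1) * d" using d by simp
      also have "\<dots> = e" using X by (simp add: d_def)
      finally show "dist (\<Sum>j\<in>Y. integral {0..\<tau>} (?f j)) (integral {0..\<tau>} (\<lambda>s. interaction s a b k)) < e"
        by (simp add: dist_norm norm_minus_commute)
    qed auto
  qed
qed

lemma has_sum_diff_complex:
  fixes f g :: "'i \<Rightarrow> complex"
  assumes "(f has_sum x) A" "(g has_sum y) A" shows "((\<lambda>i. f i - g i) has_sum (x - y)) A"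
  using has_sum_add[OF assms(1) has_sum_cmult_right[OF assms(2), of "-1"]] by simp

lemma integral_exp_linear:
  assumes "c \<noteq> 0" "\<tau> \<ge> 0"
  shows "integral {0..\<tau>} (\<lambda>s. exp (- (c * complex_of_real s)) * z) = (1 - exp (- (c * of_real \<tau>))) / c * z"
proof -
  have "((\<lambda>s. exp (- (c * complex_of_real s)) * z) has_integral
     (- exp (- (c * of_real \<tau>)) / c * z - - exp (- (c * of_real 0)) / c * z)) {0..\<tau>}"
  proof (rule fundamental_theorem_of_calculus[OF assms(2)])
    fix s
    have "((\<lambda>w. - exp (- (c * w)) / c * z) has_field_derivative exp (- (c * of_real s)) * z) (at (of_real s))"
      using assms(1) by (auto intro!: derivative_eq_intros)
    from has_vector_derivative_real_field[OF this]
    show "((\<lambda>s. - exp (- (c * complex_of_real s)) / c * z) has_vector_derivative exp (- (c * of_real s)) * z) (at s within {0..\<tau>})" .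
  qed
  then show ?thesis by (subst integral_unique) (auto simp: left_diff_distrib diff_divide_distrib)
qed

text \<open>The time integral of the phase \<open>exp (- 2 i s k j)\<close> produces the factor \<open>1 / (k j)\<close>,
  that is, the two inverse derivatives of the coarse propagator.\<close>

lemma integral_interaction:
  assumes a: "sob_le r a M" and b: "sob_le r b N" and r: "r > 1/2" and \<tau>: "\<tau> \<ge> 0" and k: "k \<noteq> 0"
  shows "integral {0..\<tau>} (\<lambda>s. interaction s a b k) = of_real \<tau> * (a k * cnj (b 0))
    + inverse (2 * of_int k) * (interaction \<tau> a (inv_deriv b) k - interaction 0 a (inv_deriv b) k)"
proof -
  let ?d = "inv_deriv b"
  have d: "sob_le r ?d N" by (rule sob_le_inv_deriv[OF b])
  let ?g = "\<lambda>j. (if j = 0 then of_real \<tau> * (a k * cnj (b 0)) else 0)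
    + inverse (2 * of_int k) * (osc \<tau> k j * (a (k + j) * cnj (?d j))
      - osc 0 k j * (a (k + j) * cnj (?d j)))"
  have 1: "(?g has_sum (of_real \<tau> * (a k * cnj (b 0))
    + inverse (2 * of_int k) * (interaction \<tau> a ?d k - interaction 0 a ?d k))) UNIV"
    by (intro has_sum_add has_sum_cmult_right has_sum_diff_complex has_sum_interaction[OF a d r]
        has_sum_finite_neutralI[where B = "{0}"]) auto
  \<comment> \<open>For j = 0 the phase is constant in time, which gives the term with the factor
    \<tau>; there \<open>inv_deriv\<close> is 0, so the other part of \<open>?g\<close> vanishes.
    For all other j the exponential is integrated.\<close>
  have "integral {0..\<tau>} (\<lambda>s. osc s k j * (a (k + j) * cnj (b j))) = ?g j" for j
  proof (cases "j = 0")
    case True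
    then show ?thesis using \<tau> by (simp add: inv_deriv_def scaleR_conv_of_real)
  next
    case False
    define c where "c = 2 * \<i> * of_int k * (of_int j :: complex)"
    have c: "c \<noteq> 0" using k False by (simp add: c_def)
    have cs: "2 * \<i> * of_real s * of_int k * of_int j = c * of_real s" for s by (simp add: c_def)
    have "integral {0..\<tau>} (\<lambda>s. osc s k j * (a (k + j) * cnj (b j)))
       = (1 - exp (- (c * of_real \<tau>))) / c * (a (k + j) * cnj (b j))"
      unfolding cs by (rule integral_exp_linear[OF c \<tau>])
    also have "\<dots> = ?g j"
      unfolding cs using False k by (simp add: inv_deriv_def c_def field_simps)
    finally show ?thesis .
  qed
  then have "(?g has_sum integral {0..\<tau>} (\<lambda>s. interaction s a b k)) UNIV"
    using has_sum_integral_interaction[OF a b r \<tau>, of k] by simp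
  then show ?thesis using 1 has_sum_unique by blast
qed

lemma inv_deriv_cnj: "inv_deriv (\<lambda>k. cnj (a (- k))) k = cnj (inv_deriv a (- k))"
  by (simp add: inv_deriv_def)

text \<open>Each term of \<open>Phi_c1\<close> has its place in the time integral. For k = 0 no
  phase oscillates, and the integral is \<tau> times the mean of |v|^2, which the L2 norm supplies.
  For k nonzero the resonant index j = 0 gives the term with the conjugate mean, and the other j
  give the inverse derivatives, where - i / (2 k) = 1 / (2 i k) explains the prefactor \<mu> / 2.
  The summand with the squared modulus of the mean cancels what the conjugate mean term contributes
  to the mode k = 0.\<close>

lemma coarse_propagator_coeff:
  assumes v: "v \<in> sobolev r" and r: "r > 1/2" and \<tau>: "\<tau> \<ge> 0"
  shows "coarse_propagator \<mu> \<tau> v \<in> L2"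
    and "fc (coarse_propagator \<mu> \<tau> v) k
      = free_phase \<tau> k * duhamel \<mu> (fc v) (\<lambda>_. fc v) \<tau> k"
proof -
  define a where "a = fc v"
  define d where "d = inv_deriv a"
  define W where "W = inv_dx (\<lambda>z. cnj (v z))"
  obtain M where a: "sob_le r a M" using sobolev_imp_sob_le[OF v] by (auto simp: a_def)
  have d: "sob_le r d M" unfolding d_def by (rule sob_le_inv_deriv[OF a])
  note sum = sob_le_abs_summable[OF _ r]
  have vi: "integrable torus v" by (rule sobolev_integrable[OF v])
  \<comment> \<open>The inverse derivative commutes with conjugation, so W has the coefficients of
    the conjugate of the inverse derivative of v.\<close>
  have W: "W = synth (\<lambda>k. cnj (d (- k)))"
    unfolding W_def inv_dx_eq_synth fourier_coeff_cnj inv_deriv_cnj d_def a_def ..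
  have dsum: "(\<lambda>k. cmod (cnj (d (- k)))) summable_on UNIV" using abs_summable_uminus[OF sum[OF d]] by simp
  have Wc: "fc W k = cnj (d (- k))" for k unfolding W by (rule fourier_coeff_synth[OF dsum])
  have Wi: "integrable torus W" unfolding W by (rule L2_integrable[OF synth_L2[OF dsum]])
  define V where "V = schroedinger_group \<tau> v"
  have pa: "sob_le r (\<lambda>k. free_phase \<tau> k * a k) M" using a by (simp add: sob_le_free_phase)
  have V: "V = synth (\<lambda>k. free_phase \<tau> k * a k)" by (simp add: V_def schroedinger_group_eq_synth a_def)
  have VL2: "V \<in> L2" unfolding V by (rule synth_L2[OF sum[OF pa]])
  have Vc: "fc V = (\<lambda>k. free_phase \<tau> k * a k)" unfolding V by (rule synth_sobolev(2)[OF pa r])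
  define X where "X = schroedinger_group (- \<tau>) W"
  have pd: "sob_le r (\<lambda>k. free_phase \<tau> k * d k) M" using d by (simp add: sob_le_free_phase)
  have Xeq: "X = synth (\<lambda>k. free_phase (- \<tau>) k * cnj (d (- k)))"
    by (simp add: X_def schroedinger_group_eq_synth Wc)
  have Xsum: "(\<lambda>k. cmod (free_phase (- \<tau>) k * cnj (d (- k)))) summable_on UNIV"
    using dsum by (simp add: norm_mult)
  have XL2: "X \<in> L2" unfolding Xeq by (rule synth_L2[OF Xsum])
  have cXc: "fc (\<lambda>y. cnj (X y)) = (\<lambda>k. free_phase \<tau> k * d k)"
    unfolding fourier_coeff_cnj Xeq fourier_coeff_synth[OF Xsum]
    by (simp add: free_phase_uminus free_phase_k_uminus)
  \<comment> \<open>Read as V times the conjugate of \<open>cnj (X y)\<close>, the product has two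
    factors that carry the same free phase, so the gauge identity applies.\<close>
  have VXc: "fc (\<lambda>y. V y * X y) k = free_phase \<tau> k * interaction \<tau> a d k"
    and VXi: "integrable torus (\<lambda>y. V y * X y)" for k
    using fourier_coeff_mult_cnj(1)[OF L2_integrable[OF VL2] L2_integrable[OF L2_cnj[OF XL2]], of k]
      fourier_coeff_mult_cnj(2)[OF L2_integrable[OF VL2] L2_integrable[OF L2_cnj[OF XL2]]] sum[OF pd]
    by (simp_all add: cXc Vc interaction_gauge)
  define Q where "Q = (\<lambda>z. v z * W z)"
  have cWc: "fc (\<lambda>y. cnj (W y)) = d"
    unfolding fourier_coeff_cnj Wc by simp
  have Qc: "fc Q k = interaction 0 a d k" and Qi: "integrable torus Q" for k
    using fourier_coeff_mult_cnj(1)[OF vi, of "\<lambda>y. cnj (W y)" k]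
      fourier_coeff_mult_cnj(2)[OF vi, of "\<lambda>y. cnj (W y)"] Wi sum[OF d]
    by (simp_all add: cWc Q_def a_def)
  have Id: "sob_le r (interaction s a d) (bil_const r * M * M)" for s
    by (rule sob_le_interaction[OF a d r])
  have pI: "sob_le r (\<lambda>k. free_phase \<tau> k * interaction 0 a d k) (bil_const r * M * M)"
    using Id by (simp add: sob_le_free_phase)
  have S: "schroedinger_group \<tau> Q = synth (\<lambda>k. free_phase \<tau> k * interaction 0 a d k)"
    by (simp add: schroedinger_group_eq_synth Qc)
  define Y where "Y = (\<lambda>y. V y * X y - schroedinger_group \<tau> Q y)"
  have Yc: "fc Y k = free_phase \<tau> k * (interaction \<tau> a d k - interaction 0 a d k)" for k
    unfolding Y_def S
    by (subst fourier_coeff_diff[OF VXi L2_integrable[OF synth_L2[OF sum[OF pI]]]])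
       (simp add: VXc fourier_coeff_synth[OF sum[OF pI]] right_diff_distrib)
  define e where "e = inv_deriv (\<lambda>k. free_phase \<tau> k * (interaction \<tau> a d k - interaction 0 a d k))"
  have "sob_le r (\<lambda>k. free_phase \<tau> k * (interaction \<tau> a d k - interaction 0 a d k)) (bil_const r * M * M + bil_const r * M * M)"
    unfolding sob_le_free_phase by (rule sob_le_diff[OF Id Id])
  then have e: "sob_le r e (bil_const r * M * M + bil_const r * M * M)"
    unfolding e_def by (rule sob_le_inv_deriv)
  have Z: "inv_dx Y = synth e" unfolding inv_dx_eq_synth e_def ext[of "fc Y", OF Yc] ..
  have ZL2: "synth e \<in> L2" by (rule synth_L2[OF sum[OF e]])
  define c1 where "c1 = 1 - \<i> * \<mu> * of_real \<tau> * cnj (a 0)"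
  define c2 where "c2 = - \<i> * \<mu> * of_real \<tau> / (2 * of_real pi) * of_real ((norm_L2 v)\<^sup>2) + \<i> * \<mu> * of_real \<tau> * of_real ((cmod (a 0))\<^sup>2)"
  have G: "coarse_propagator \<mu> \<tau> v = (\<lambda>x. c1 * V x + (c2 * 1 + \<mu> / 2 * synth e x))"
    unfolding coarse_propagator_def Phi_c1_def Z[symmetric] Y_def Q_def X_def V_def W_def c1_def c2_def a_def
    by (simp add: algebra_simps)
  have cL2: "(\<lambda>x. c * f x) \<in> L2" if "f \<in> L2" for c f
    using that by (auto simp: L2_def norm_mult power_mult_distrib)
  have 1: "(\<lambda>x. 1) \<in> L2" by (rule L2_bounded[where B = 1]) auto
  show "coarse_propagator \<mu> \<tau> v \<in> L2"
    unfolding G by (intro L2_add cL2 VL2 ZL2 1)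
  have nL: "of_real ((norm_L2 v)\<^sup>2) = 2 * pi * interaction 0 a a 0"
    unfolding a_def by (rule norm_L2_square[OF sobolev_L2[OF v]]) (use sum[OF a] in \<open>simp add: a_def\<close>)
  have c2: "c2 = - \<i> * \<mu> * of_real \<tau> * interaction 0 a a 0 + \<i> * \<mu> * of_real \<tau> * (a 0 * cnj (a 0))"
    unfolding c2_def nL complex_norm_square by simp
  have "fc (coarse_propagator \<mu> \<tau> v) k = c1 * (free_phase \<tau> k * a k) + (c2 * (if k = 0 then 1 else 0) + \<mu> / 2 * e k)"
    unfolding G
    by (subst fourier_coeff_add, (intro L2_integrable cL2 L2_add VL2 ZL2 1)+,
        subst fourier_coeff_add, (intro L2_integrable cL2 L2_add VL2 ZL2 1)+)
       (simp only: fourier_coeff_cmult Vc fourier_coeff_1 fourier_coeff_synth[OF sum[OF e]])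
  also have "\<dots> = free_phase \<tau> k * duhamel \<mu> a (\<lambda>_. a) \<tau> k"
  proof (cases "k = 0")
    case True
    have "interaction s a a 0 = interaction 0 a a 0" for s by (simp add: interaction_def)
    then have "integral {0..\<tau>} (\<lambda>s. interaction s a a 0) = integral {0..\<tau>} (\<lambda>s. interaction 0 a a 0)"
      by (intro Henstock_Kurzweil_Integration.integral_cong)
    also have "\<dots> = of_real \<tau> * interaction 0 a a 0"
      using \<tau> by (simp add: scaleR_conv_of_real)
    finally have "integral {0..\<tau>} (\<lambda>s. interaction s a a 0) = of_real \<tau> * interaction 0 a a 0" .
    then show ?thesis
      unfolding True duhamel_def c1_def c2 e_def by (simp add: inv_deriv_def algebra_simps)
  next
    case False
    have I: "integral {0..\<tau>} (\<lambda>s. interaction s a a k) = of_real \<tau> * (a k * cnj (a 0))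
      + inverse (2 * of_int k) * (interaction \<tau> a d k - interaction 0 a d k)"
      unfolding d_def by (rule integral_interaction[OF a a r \<tau> False])
    show ?thesis
      using False unfolding duhamel_def I c1_def e_def inv_deriv_def by (simp add: field_simps)
  qed
  finally show "fc (coarse_propagator \<mu> \<tau> v) k
      = free_phase \<tau> k * duhamel \<mu> (fc v) (\<lambda>_. fc v) \<tau> k"
    by (simp add: a_def)
qed

section \<open>Exact solutions are mild\<close>

text \<open>Completeness of Lebesgue measure. It is called for because u0 is only known to agree
  almost everywhere with a Sobolev function.\<close>

lemma borel_measurable_torus_AE:
  fixes f g :: "real \<Rightarrow> complex"
  assumes f: "f \<in> borel_measurable torus" and ae: "AE x in torus. f x = g x"
  shows "g \<in> borel_measurable torus"
proof -
  let ?S = "{0<..<2*pi}"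
  have "(\<lambda>x. if x \<in> ?S then f x else 0) \<in> borel_measurable lebesgue"
    using f by (subst borel_measurable_if) auto
  moreover have "AE x in lebesgue. (if x \<in> ?S then f x else 0) = (if x \<in> ?S then g x else 0)"
    using ae by (auto simp: AE_restrict_space_iff elim: eventually_mono)
  ultimately have "(\<lambda>x. if x \<in> ?S then g x else 0) \<in> borel_measurable lebesgue"
    by (rule borel_measurable_AE)
  then show ?thesis by (subst (asm) borel_measurable_if) auto
qed

lemma sobolev_cong_AE:
  assumes f: "f \<in> sobolev r" and ae: "AE x in torus. f x = g x"
  shows "g \<in> sobolev r" "fc g = fc f"
proof -
  have mf: "f \<in> borel_measurable torus" by (rule L2_measurable[OF sobolev_L2[OF f]])
  have mg: "g \<in> borel_measurable torus" by (rule borel_measurable_torus_AE[OF mf ae])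
  show eq: "fc g = fc f"
    by (rule ext, rule fourier_coeff_cong_AE[OF _ mg mf]) (use ae in \<open>auto elim: eventually_mono\<close>)
  have "integrable torus (\<lambda>x. (cmod (f x))\<^sup>2)" using sobolev_L2[OF f] by (simp add: L2_def)
  then have "integrable torus (\<lambda>x. (cmod (g x))\<^sup>2)"
    by (rule integrable_cong_AE_imp) (use mg ae in \<open>auto elim: eventually_mono\<close>)
  then show "g \<in> sobolev r" using f mg eq by (simp add: sobolev_def L2_def)
qed

section \<open>The Sobolev norm in terms of coefficient bounds\<close>

lemma norm_sobolev_le_iff:
  assumes "f \<in> sobolev r"
  shows "norm_sobolev r f \<le> sqrt (2 * pi) * M \<longleftrightarrow> sob_le r (fc f) M"
proof
  assume "norm_sobolev r f \<le> sqrt (2 * pi) * M"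
  then have "norm_sobolev r f / sqrt (2 * pi) \<le> M" by (simp add: divide_le_eq mult.commute)
  then show "sob_le r (fc f) M" by (rule sob_le_mono[OF sobolev_imp_sob_le[OF assms]])
qed (rule sob_le_imp_sobolev(2)[OF sobolev_L2[OF assms]])

lemma fourier_coeff_sobolev_diff:
  "f \<in> sobolev r \<Longrightarrow> g \<in> sobolev r \<Longrightarrow> fc (\<lambda>x. f x - g x) = (\<lambda>k. fc f k - fc g k)"
  by (intro ext fourier_coeff_diff sobolev_integrable)

lemma norm_sobolev_le_add_diff:
  assumes f: "f \<in> sobolev r" and g: "g \<in> sobolev r"
  shows "norm_sobolev r f \<le> norm_sobolev r g + norm_sobolev r (\<lambda>x. f x - g x)"
proof -
  have "sob_le r (\<lambda>k. fc g k + fc (\<lambda>x. f x - g x) k)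
      (norm_sobolev r g / sqrt (2 * pi) + norm_sobolev r (\<lambda>x. f x - g x) / sqrt (2 * pi))"
    by (intro sob_le_add sobolev_imp_sob_le sobolev_diff f g)
  then have "sob_le r (fc f) (norm_sobolev r g / sqrt (2 * pi) + norm_sobolev r (\<lambda>x. f x - g x) / sqrt (2 * pi))"
    by (simp add: fourier_coeff_sobolev_diff[OF f g])
  then have "norm_sobolev r f \<le> sqrt (2 * pi) * (norm_sobolev r g / sqrt (2 * pi) + norm_sobolev r (\<lambda>x. f x - g x) / sqrt (2 * pi))"
    by (simp only: norm_sobolev_le_iff[OF f])
  then show ?thesis by (simp add: distrib_left)
qed

lemma norm_sobolev_diff_commute:
  assumes "f \<in> sobolev r" "g \<in> sobolev r"
  shows "norm_sobolev r (\<lambda>x. f x - g x) = norm_sobolev r (\<lambda>x. g x - f x)"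
  by (simp add: norm_sobolev_def fourier_coeff_sobolev_diff[OF assms] fourier_coeff_sobolev_diff[OF assms(2,1)]
      norm_minus_commute[of "fc f _"])

text \<open>The triangle inequality in both directions makes the norm continuous in time, hence
  bounded on the compact interval.\<close>

lemma continuous_into_sobolev_bounded:
  assumes u: "continuous_into_sobolev r T u"
  shows "\<exists>M. \<forall>t\<in>{0..T}. sob_le r (fc (u t)) M"
proof -
  have us: "u t \<in> sobolev r" if "t \<in> {0..T}" for t using u that by (simp add: continuous_into_sobolev_def)
  have "continuous_on {0..T} (\<lambda>t. norm_sobolev r (u t))"
    unfolding continuous_on_def
  proof
    fix t assume t: "t \<in> {0..T}"
    show "((\<lambda>s. norm_sobolev r (u s)) \<longlongrightarrow> norm_sobolev r (u t)) (at t within {0..T})"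
    proof (rule Lim_transform2[OF tendsto_const], rule Lim_null_comparison)
      show "((\<lambda>s. norm_sobolev r (\<lambda>x. u s x - u t x)) \<longlongrightarrow> 0) (at t within {0..T})"
        using u t by (simp add: continuous_into_sobolev_def)
      have "eventually (\<lambda>s. s \<in> {0..T}) (at t within {0..T})" by (simp add: eventually_at_filter)
      then show "\<forall>\<^sub>F s in at t within {0..T}. norm (norm_sobolev r (u t) - norm_sobolev r (u s)) \<le> norm_sobolev r (\<lambda>x. u s x - u t x)"
      proof eventually_elim
        case (elim s)
        show ?case
          using norm_sobolev_le_add_diff[OF us[OF elim] us[OF t]] norm_sobolev_le_add_diff[OF us[OF t] us[OF elim]]
            norm_sobolev_diff_commute[OF us[OF elim] us[OF t]] by (simp add: abs_le_iff)
      qed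
    qed
  qed
  then have "bounded ((\<lambda>t. norm_sobolev r (u t)) ` {0..T})"
    by (intro compact_imp_bounded compact_continuous_image) auto
  then obtain B where "\<And>t. t \<in> {0..T} \<Longrightarrow> norm_sobolev r (u t) \<le> B"
    unfolding bounded_iff by (metis abs_le_iff image_eqI real_norm_def)
  then have "\<forall>t\<in>{0..T}. sob_le r (fc (u t)) (B / sqrt (2 * pi))"
    by (auto intro!: sob_le_mono[OF sobolev_imp_sob_le[OF us]] divide_right_mono)
  then show ?thesis by blast
qed

lemma continuous_on_fourier_coeff:
  assumes u: "continuous_into_sobolev r T u" and r: "r \<ge> 0"
  shows "continuous_on {0..T} (\<lambda>t. fc (u t) k)"
  unfolding continuous_on_def
proof
  fix t assume t: "t \<in> {0..T}"
  have us: "u t \<in> sobolev r" if "t \<in> {0..T}" for t using u that by (simp add: continuous_into_sobolev_def)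
  show "((\<lambda>s. fc (u s) k) \<longlongrightarrow> fc (u t) k) (at t within {0..T})"
  proof (rule Lim_transform2[OF tendsto_const], rule Lim_null_comparison)
    have "((\<lambda>s. norm_sobolev r (\<lambda>x. u s x - u t x)) \<longlongrightarrow> 0) (at t within {0..T})"
      using u t by (simp add: continuous_into_sobolev_def)
    from tendsto_divide[OF this tendsto_const, of "sqrt (2 * pi)"]
    show "((\<lambda>s. norm_sobolev r (\<lambda>x. u s x - u t x) / sqrt (2 * pi)) \<longlongrightarrow> 0) (at t within {0..T})" by simp
    have "eventually (\<lambda>s. s \<in> {0..T}) (at t within {0..T})" by (simp add: eventually_at_filter)
    then show "\<forall>\<^sub>F s in at t within {0..T}. norm (fc (u t) k - fc (u s) k) \<le> norm_sobolev r (\<lambda>x. u s x - u t x) / sqrt (2 * pi)"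
    proof eventually_elim
      case (elim s)
      show ?case
        using sob_le_cmod[OF sobolev_imp_sob_le[OF sobolev_diff[OF us[OF elim] us[OF t]]] r, of k]
        by (simp add: fourier_coeff_sobolev_diff[OF us[OF elim] us[OF t]] norm_minus_commute)
    qed
  qed
qed

section \<open>Fourier modes as test functions\<close>

lemma dx_fmode: "dx (\<lambda>x. c * fmode k x) = (\<lambda>x. (\<i> * of_int k * c) * fmode k x)"
proof
  fix x
  have "((\<lambda>x. c * fmode k x) has_vector_derivative c * (\<i> * of_int k * fmode k x)) (at x)"
    by (intro has_vector_derivative_mult_right fmode_has_vector_derivative)
  then show "dx (\<lambda>x. c * fmode k x) x = (\<i> * of_int k * c) * fmode k x"
    unfolding dx_def by (simp add: vector_derivative_at mult_ac)
qed

lemma periodic_test_function_fmode: "periodic_test_function (fmode k)"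
proof -
  have eq: "(dx ^^ n) (fmode k) = (\<lambda>x. (\<i> * of_int k) ^ n * fmode k x)" for n
  proof (induction n)
    case (Suc n)
    then show ?case by (simp add: dx_fmode)
  qed simp
  have "(\<lambda>x. c * fmode k x) differentiable (at x)" for c x
    using has_vector_derivative_mult_right[OF fmode_has_vector_derivative[of k x UNIV], of c]
    unfolding has_vector_derivative_def differentiable_def by auto
  then have "(dx ^^ n) (fmode k) differentiable (at x)" for n x unfolding eq .
  then show ?thesis by (simp add: periodic_test_function_def fmode_periodic)
qed

lemma fourier_coeff_cmod_square:
  assumes "f \<in> sobolev r" "r > 1/2"
  shows "fc (\<lambda>x. of_real ((cmod (f x))\<^sup>2)) k = interaction 0 (fc f) (fc f) k"
    and "integrable torus (\<lambda>x. complex_of_real ((cmod (f x))\<^sup>2))"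
  unfolding complex_norm_square
  by (rule fourier_coeff_mult_cnj(1) fourier_coeff_mult_cnj(2);
      use assms in \<open>auto intro: sobolev_integrable sobolev_abs_summable\<close>)+

text \<open>Testing with \<open>fmode (- k)\<close> isolates the k-th coefficient: two derivatives
  of the mode give the factor - k^2, and the k-th coefficient of |u|^2 is the interaction at time
  0.\<close>

lemma exact_solution_coeff_derivative:
  assumes u: "exact_solution \<mu> r T u0 u" and r: "r > 1/2" and t: "t \<in> {0<..<T}"
  shows "((\<lambda>s. fc (u s) k) has_vector_derivative
     - \<i> * (of_int k)\<^sup>2 * fc (u t) k - \<i> * \<mu> * interaction 0 (fc (u t)) (fc (u t)) k) (at t)"
proof -
  have ut: "u t \<in> sobolev r" using u t by (simp add: exact_solution_def continuous_into_sobolev_def)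
  obtain D where D: "((\<lambda>s. LINT x|torus. u s x * fmode (- k) x) has_vector_derivative D) (at t)"
    and iD: "\<i> * D = - (LINT x|torus. u t x * dx (dx (fmode (- k))) x)
       + \<mu> * (LINT x|torus. of_real ((cmod (u t x))\<^sup>2) * fmode (- k) x)"
    using u t periodic_test_function_fmode[of "- k"] unfolding exact_solution_def by blast
  have I: "(LINT x|torus. f x * fmode (- k) x) = 2 * pi * fc f k" for f
    by (simp add: fourier_coeff_fmode)
  have d1: "dx (fmode (- k)) = (\<lambda>x. (\<i> * of_int (- k) * 1) * fmode (- k) x)"
    using dx_fmode[of 1 "- k"] unfolding mult_1_left .
  have "dx (dx (fmode (- k))) = (\<lambda>x. - ((of_int k)\<^sup>2) * fmode (- k) x)"
  proof -
    have "\<i> * of_int (- k) * (\<i> * of_int (- k) * 1) = - ((of_int k)\<^sup>2 :: complex)"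
      by (simp add: power2_eq_square algebra_simps)
    then show ?thesis unfolding d1 dx_fmode by (simp only:)
  qed
  then have "(LINT x|torus. u t x * dx (dx (fmode (- k))) x) = - ((of_int k)\<^sup>2) * (LINT x|torus. u t x * fmode (- k) x)"
    by (simp add: mult.left_commute[of "u t _"])
  then have iD': "\<i> * D = (of_int k)\<^sup>2 * (2 * pi * fc (u t) k)
     + \<mu> * (2 * pi * interaction 0 (fc (u t)) (fc (u t)) k)"
    unfolding iD I fourier_coeff_cmod_square(1)[OF ut r] by simp
  have "D = - \<i> * (\<i> * D)" by simp
  also have "\<dots> = 2 * pi * (- \<i> * (of_int k)\<^sup>2 * fc (u t) k - \<i> * \<mu> * interaction 0 (fc (u t)) (fc (u t)) k)"
    unfolding iD' by (simp add: algebra_simps)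
  finally have D': "D = 2 * pi * (- \<i> * (of_int k)\<^sup>2 * fc (u t) k - \<i> * \<mu> * interaction 0 (fc (u t)) (fc (u t)) k)" .
  have "((\<lambda>s. (1 / (2 * pi)) * (LINT x|torus. u s x * fmode (- k) x)) has_vector_derivative of_real (1 / (2 * pi)) * D) (at t)"
    using has_vector_derivative_mult_right[OF D, of "1 / (2 * pi)"] by simp
  then show ?thesis unfolding fourier_coeff_fmode[symmetric] D' by simp
qed

lemma free_phase_has_vector_derivative:
  "((\<lambda>t. free_phase (c * t) k) has_vector_derivative (- \<i> * of_real c * (of_int k)\<^sup>2 * free_phase (c * t) k)) (at t within S)"
proof -
  have "((\<lambda>z. exp (- (\<i> * (of_real c * z) * (of_int k)\<^sup>2))) has_field_derivative
     (- \<i> * of_real c * (of_int k)\<^sup>2 * exp (- (\<i> * (of_real c * of_real t) * (of_int k)\<^sup>2)))) (at (of_real t))"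
    by (auto intro!: derivative_eq_intros)
  from has_vector_derivative_real_field[OF this] show ?thesis by (simp add: free_phase_def)
qed

lemma continuous_on_free_phase: "continuous_on S (\<lambda>t. free_phase (c * t) k)"
  unfolding free_phase_def by (intro continuous_intros)

text \<open>The conjugate free phase cancels the linear term and leaves, for each coefficient, an
  ordinary differential equation that is integrated in time.\<close>

lemma exact_solution_imp_mild:
  assumes u: "exact_solution \<mu> r T u0 u" and r: "r > 1/2"
  shows "mild \<mu> r T (\<lambda>t k. free_phase (- t) k * fc (u t) k)"
proof -
  define v where "v t k = free_phase (- t) k * fc (u t) k" for t k
  have cu: "continuous_into_sobolev r T u" using u by (simp add: exact_solution_def)
  obtain M where M: "\<And>t. t \<in> {0..T} \<Longrightarrow> sob_le r (fc (u t)) M"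
    using continuous_into_sobolev_bounded[OF cu] by blast
  have cv: "continuous_on {0..T} (\<lambda>t. v t k)" for k
    unfolding v_def using continuous_on_free_phase[of "{0..T}" "-1" k] continuous_on_fourier_coeff[OF cu, of k] r
    by (auto intro!: continuous_on_mult)
  have adm: "admissible r T M v"
    unfolding admissible_def
  proof (intro conjI allI ballI cv)
    fix t assume "t \<in> {0..T}"
    then show "sob_le r (v t) M" unfolding v_def[abs_def] sob_le_free_phase by (rule M)
  qed
  have fc: "fc (u t) = (\<lambda>k. free_phase t k * v t k)" for t
    by (simp add: v_def fun_eq_iff mult.assoc[symmetric] mult.commute[of "free_phase t _"] free_phase_inverse)
  have der: "((\<lambda>t. v t k) has_vector_derivative - \<i> * \<mu> * interaction t (v t) (v t) k) (at t)"
    if t: "t \<in> {0<..<T}" for t k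
  proof -
    have "((\<lambda>t. v t k) has_vector_derivative
      free_phase (- t) k * (- \<i> * (of_int k)\<^sup>2 * fc (u t) k - \<i> * \<mu> * interaction 0 (fc (u t)) (fc (u t)) k)
       + (\<i> * (of_int k)\<^sup>2 * free_phase (- t) k) * fc (u t) k) (at t)"
      unfolding v_def
      using has_vector_derivative_mult[OF free_phase_has_vector_derivative[of "-1" k t UNIV]
          exact_solution_coeff_derivative[OF u r t, of k]] by simp
    moreover have "interaction 0 (fc (u t)) (fc (u t)) k = free_phase t k * interaction t (v t) (v t) k"
      unfolding fc by (rule interaction_gauge)
    moreover have "free_phase t k * (free_phase (- t) k * z) = z" for z
      by (simp add: mult.assoc[symmetric] mult.commute[of "free_phase t k"] free_phase_inverse)
    note inv = this
    ultimately show ?thesis by (simp add: algebra_simps inv)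
  qed
  have eq: "v t k = duhamel \<mu> (v 0) v t k" if t: "t \<in> {0..T}" for t k
  proof -
    \<comment> \<open>The equation is available at interior times only; continuity of the
      coefficients on the closed interval covers the endpoints.\<close>
    have "((\<lambda>s. - \<i> * \<mu> * interaction s (v s) (v s) k) has_integral (v t k - v 0 k)) {0..t}"
      by (rule fundamental_theorem_of_calculus_interior)
         (use t der in \<open>auto intro: continuous_on_subset[OF cv]\<close>)
    then have "v t k - v 0 k = integral {0..t} (\<lambda>s. - \<i> * \<mu> * interaction s (v s) (v s) k)"
      by (simp only: integral_unique)
    also have "\<dots> = - \<i> * \<mu> * integral {0..t} (\<lambda>s. interaction s (v s) (v s) k)"
      by (rule integral_mult_right)
    finally show ?thesis by (simp add: duhamel_def algebra_simps)
  qed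
  have "mild \<mu> r T v" unfolding mild_def using adm eq by (auto intro!: ext)
  then show ?thesis by (simp add: v_def[abs_def])
qed

section \<open>Mild solutions are exact\<close>

lemma mild_increment:
  assumes v: "admissible r T M v" "\<forall>t\<in>{0..T}. v t = duhamel \<mu> (v 0) v t" and r: "r > 1/2"
    and t: "0 \<le> t" "t \<le> s" "s \<le> T"
  shows "sob_le r (\<lambda>k. v s k - v t k) ((s - t) * (cmod \<mu> * (bil_const r * M * M)))"
proof -
  let ?I = "\<lambda>k x. interaction x (v x) (v x) k"
  have c: "continuous_on {0..s} (?I k)" for k by (rule continuous_on_interaction_admissible[OF v(1) r t(3)])
  have "sob_le r (\<lambda>k. integral {t..s} (?I k)) ((s - t) * (bil_const r * M * M))"
    by (rule sob_le_integral_const)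
       (use t v(1) r in \<open>auto intro!: continuous_on_subset[OF c] sob_le_interaction simp: admissible_def\<close>)
  from sob_le_cmult[OF this, of "- (\<i> * \<mu>)"]
  have "sob_le r (\<lambda>k. - (\<i> * \<mu>) * integral {t..s} (?I k)) ((s - t) * (cmod \<mu> * (bil_const r * M * M)))"
    by (simp add: norm_mult mult_ac)
  moreover have "v s k - v t k = - (\<i> * \<mu>) * integral {t..s} (?I k)" for k
  proof -
    have st: "s \<in> {0..T}" "t \<in> {0..T}" using t by auto
    have V: "v s k = v 0 k - \<i> * \<mu> * integral {0..s} (?I k)" "v t k = v 0 k - \<i> * \<mu> * integral {0..t} (?I k)"
      using fun_cong[OF bspec[OF v(2) st(1)], of k] fun_cong[OF bspec[OF v(2) st(2)], of k]
      unfolding duhamel_def .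
    have "integral {0..t} (?I k) + integral {t..s} (?I k) = integral {0..s} (?I k)"
      by (rule Henstock_Kurzweil_Integration.integral_combine[OF t(1,2) integrable_continuous_interval[OF c]])
    then have I: "integral {t..s} (?I k) = integral {0..s} (?I k) - integral {0..t} (?I k)" by (simp add: algebra_simps)
    show ?thesis unfolding V I by (simp add: algebra_simps)
  qed
  ultimately show ?thesis by simp
qed

text \<open>The free flow is strongly but not uniformly continuous on H^r, so the family a is fixed:
  on a finite J the phases converge, and off J the weighted norm of a is at most e / 4, doubled by
  the triangle inequality.\<close>

lemma free_phase_strongly_continuous:
  assumes a: "sob_le r a M" and e: "e > 0"
  shows "\<forall>\<^sub>F s in at t within S. sob_le r (\<lambda>k. free_phase s k * a k - free_phase t k * a k) e"
proof -
  let ?g = "\<lambda>k. (sob_weight r k * cmod (a k))\<^sup>2"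
  have sg: "?g summable_on UNIV"
    using sob_le_summable_squares[OF a] by (simp add: power_mult_distrib sob_weight_square)
  obtain J where J: "finite J" and tail: "\<And>F. finite F \<Longrightarrow> F \<inter> J = {} \<Longrightarrow> L2_set (\<lambda>k. sob_weight r k * cmod (a k)) F \<le> e / 4"
    using small_tail[OF sg, of "e / 4"] e by auto
  let ?D = "\<lambda>s k. free_phase s k * a k - free_phase t k * a k"
  have cp: "((\<lambda>s. free_phase s k) \<longlongrightarrow> free_phase t k) (at t within S)" for k
    using continuous_on_free_phase[of UNIV 1 k]
    by (auto simp: continuous_on_def intro: tendsto_within_subset)
  have "((\<lambda>s. L2_set (\<lambda>k. sob_weight r k * cmod (?D s k)) J) \<longlongrightarrow> L2_set (\<lambda>k. sob_weight r k * cmod (?D t k)) J) (at t within S)"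
    unfolding L2_set_def by (intro tendsto_intros cp)
  then have "((\<lambda>s. L2_set (\<lambda>k. sob_weight r k * cmod (?D s k)) J) \<longlongrightarrow> 0) (at t within S)"
    by (simp add: L2_set_def)
  then have "\<forall>\<^sub>F s in at t within S. L2_set (\<lambda>k. sob_weight r k * cmod (?D s k)) J < e / 2"
    by (rule order_tendstoD) (use e in simp)
  then show ?thesis
  proof eventually_elim
    case (elim s)
    show ?case
      unfolding sob_le_def
    proof (intro allI impI)
      fix F :: "int set" assume F: "finite F"
      let ?h = "\<lambda>k. sob_weight r k * cmod (?D s k)"
      have "L2_set ?h F = sqrt ((\<Sum>k\<in>F \<inter> J. (?h k)\<^sup>2) + (\<Sum>k\<in>F - J. (?h k)\<^sup>2))"
        unfolding L2_set_def using sum.Int_Diff[OF F, of "\<lambda>k. (?h k)\<^sup>2" J] by simp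
      also have "\<dots> \<le> L2_set ?h (F \<inter> J) + L2_set ?h (F - J)"
        unfolding L2_set_def by (rule sqrt_add_le_add_sqrt) (auto intro: sum_nonneg)
      also have "L2_set ?h (F \<inter> J) \<le> L2_set ?h J"
        unfolding L2_set_def by (intro real_sqrt_le_mono sum_mono2 J) auto
      also have "L2_set ?h (F - J) \<le> L2_set (\<lambda>k. 2 * (sob_weight r k * cmod (a k))) (F - J)"
      proof (rule L2_set_mono)
        fix k
        have "cmod (?D s k) \<le> cmod (free_phase s k * a k) + cmod (free_phase t k * a k)" by (rule norm_triangle_ineq4)
        also have "\<dots> = 2 * cmod (a k)" by (simp add: norm_mult)
        finally show "?h k \<le> 2 * (sob_weight r k * cmod (a k))"
          using mult_left_mono[OF _ sob_weight_nonneg, of _ _ r k] by (metis mult.left_commute)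
      qed auto
      also have "\<dots> = 2 * L2_set (\<lambda>k. sob_weight r k * cmod (a k)) (F - J)" by (simp add: L2_set_right_distrib)
      also have "\<dots> \<le> 2 * (e / 4)" by (intro mult_left_mono tail) (use F in auto)
      finally show "L2_set ?h F \<le> e" using elim by simp
    qed
  qed
qed

text \<open>The increment of u splits into the free flow applied to the increment of v, which is
  Lipschitz in time, and the increment of the free flow applied to the fixed family
  \<open>v t\<close>, for which strong continuity suffices.\<close>

lemma mild_continuous_into_sobolev:
  assumes v: "admissible r T M v" "\<forall>t\<in>{0..T}. v t = duhamel \<mu> (v 0) v t" and r: "r > 1/2"
  shows "continuous_into_sobolev r T (\<lambda>t. synth (\<lambda>k. free_phase t k * v t k))"
  unfolding continuous_into_sobolev_def
proof (intro conjI ballI)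
  define u where "u t = synth (\<lambda>k. free_phase t k * v t k)" for t
  have c: "sob_le r (\<lambda>k. free_phase t k * v t k) M" if "t \<in> {0..T}" for t
    using v(1) that by (simp add: admissible_def sob_le_free_phase)
  have us: "u t \<in> sobolev r" and fc: "fc (u t) = (\<lambda>k. free_phase t k * v t k)" if "t \<in> {0..T}" for t
    unfolding u_def using synth_sobolev[OF c[OF that] r] by auto
  fix t assume t: "t \<in> {0..T}"
  show "synth (\<lambda>k. free_phase t k * v t k) \<in> sobolev r" using us[OF t] by (simp add: u_def)
  define A where "A = cmod \<mu> * (bil_const r * M * M)"
  have A: "A \<ge> 0" using admissible_nonneg[OF v(1)] t by (auto simp: A_def)
  have inc: "sob_le r (\<lambda>k. v s k - v t k) (\<bar>s - t\<bar> * A)" if s: "s \<in> {0..T}" for s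
  proof (cases "t \<le> s")
    case True then show ?thesis using mild_increment[OF v r, of t s] s t by (simp add: A_def)
  next
    case False then show ?thesis
      using mild_increment[OF v r, of s t] s t by (simp add: A_def sob_le_diff_commute[of r "v s"])
  qed
  have vt: "sob_le r (v t) M" using v(1) t by (simp add: admissible_def)
  show "((\<lambda>s. norm_sobolev r (\<lambda>x. synth (\<lambda>k. free_phase s k * v s k) x - synth (\<lambda>k. free_phase t k * v t k) x)) \<longlongrightarrow> 0) (at t within {0..T})"
    unfolding tendsto_iff u_def[symmetric]
  proof (intro allI impI)
    fix e :: real assume e: "e > 0"
    define d where "d = e / (3 * sqrt (2 * pi))"
    have d: "d > 0" using e by (simp add: d_def)
    have "((\<lambda>s. \<bar>s - t\<bar> * A) \<longlongrightarrow> \<bar>t - t\<bar> * A) (at t within {0..T})" by (intro tendsto_intros)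
    then have "\<forall>\<^sub>F s in at t within {0..T}. \<bar>s - t\<bar> * A < d" by (rule order_tendstoD) (use d in simp)
    moreover have "\<forall>\<^sub>F s in at t within {0..T}. s \<in> {0..T}" by (simp add: eventually_at_filter)
    ultimately show "\<forall>\<^sub>F s in at t within {0..T}. dist (norm_sobolev r (\<lambda>x. u s x - u t x)) 0 < e"
      using free_phase_strongly_continuous[OF vt d, of t "{0..T}"]
    proof eventually_elim
      case (elim s)
      have "sob_le r (\<lambda>k. free_phase s k * (v s k - v t k) + (free_phase s k * v t k - free_phase t k * v t k)) (\<bar>s - t\<bar> * A + d)"
        by (rule sob_le_add[OF _ elim(3)]) (simp add: sob_le_free_phase inc[OF elim(2)])
      then have "sob_le r (fc (\<lambda>x. u s x - u t x)) (\<bar>s - t\<bar> * A + d)"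
        by (simp add: fourier_coeff_sobolev_diff[OF us[OF elim(2)] us[OF t]] fc[OF elim(2)] fc[OF t] algebra_simps)
      then have "norm_sobolev r (\<lambda>x. u s x - u t x) \<le> sqrt (2 * pi) * (\<bar>s - t\<bar> * A + d)"
        by (simp only: norm_sobolev_le_iff[OF sobolev_diff[OF us[OF elim(2)] us[OF t]]])
      also have "\<dots> \<le> sqrt (2 * pi) * (2 * d)" using elim(1) by (intro mult_left_mono) auto
      also have "\<dots> < e" using e by (simp add: d_def)
      finally have "norm_sobolev r (\<lambda>x. u s x - u t x) < e" .
      moreover have "norm_sobolev r (\<lambda>x. u s x - u t x) \<ge> 0" by (simp add: norm_sobolev_def infsum_nonneg)
      ultimately show ?case by simp
    qed
  qed
qed

subsection \<open>Test functions\<close>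

lemma lint_torus_continuous:
  fixes h :: "real \<Rightarrow> complex"
  assumes "continuous_on UNIV h" shows "integrable torus h" "(LINT x|torus. h x) = integral {0..2*pi} h"
proof -
  have "bounded (h ` {0..2*pi})"
    by (intro compact_imp_bounded compact_continuous_image continuous_on_subset[OF assms]) auto
  then obtain B where "\<And>x. x \<in> {0..2*pi} \<Longrightarrow> cmod (h x) \<le> B"
    unfolding bounded_iff by (metis imageI)
  then show i: "integrable torus h"
    by (intro integrable_torus_bounded[where B = B] continuous_measurable_torus continuous_on_subset[OF assms]) auto
  show "(LINT x|torus. h x) = integral {0..2*pi} h"
    using lebesgue_integral_eq_integral[OF i] by (simp add: integral_open_interval_real)
qed

lemma test_function_derivative:
  assumes "periodic_test_function \<phi>" shows "(\<phi> has_vector_derivative dx \<phi> x) (at x)"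
proof -
  have "((dx ^^ 0) \<phi>) differentiable (at x)" using assms unfolding periodic_test_function_def by blast
  then show ?thesis unfolding dx_def by (simp add: vector_derivative_works[symmetric])
qed

lemma test_function_dx:
  assumes "periodic_test_function \<phi>" shows "periodic_test_function (dx \<phi>)"
proof -
  have "dx \<phi> (x + 2 * pi) = dx \<phi> x" for x
  proof -
    have "((\<lambda>y. \<phi> (y + 2 * pi)) has_vector_derivative (1 *\<^sub>R dx \<phi> (x + 2 * pi))) (at x)"
      by (rule vector_diff_chain_at[of "\<lambda>y. y + 2 * pi" 1 x \<phi>, unfolded o_def])
         (auto intro!: derivative_eq_intros test_function_derivative[OF assms])
    moreover have "(\<lambda>y. \<phi> (y + 2 * pi)) = \<phi>" using assms by (auto simp: periodic_test_function_def)
    ultimately show ?thesis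
      using test_function_derivative[OF assms, of x] vector_derivative_at by (metis scaleR_one)
  qed
  moreover have "((dx ^^ n) (dx \<phi>)) differentiable (at x)" for n x
    using assms unfolding periodic_test_function_def by (metis funpow_swap1 funpow.simps(2) o_apply)
  ultimately show ?thesis by (simp add: periodic_test_function_def)
qed

lemma test_function_continuous:
  assumes "periodic_test_function \<phi>" shows "continuous_on UNIV \<phi>"
  using test_function_derivative[OF assms]
  by (meson continuous_at_imp_continuous_on has_vector_derivative_continuous)

lemma fourier_coeff_dx:
  assumes "periodic_test_function \<phi>"
  shows "fc (dx \<phi>) k = \<i> * of_int k * fc \<phi> k"
proof -
  note c = test_function_continuous[OF assms] and c' = test_function_continuous[OF test_function_dx[OF assms]]
  have i1: "continuous_on UNIV (\<lambda>x. dx \<phi> x * fmode (- k) x)" by (intro continuous_intros c')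
  have i2: "continuous_on UNIV (\<lambda>x. \<phi> x * fmode (- k) x)" by (intro continuous_intros c)
  have "((\<lambda>x. \<phi> x * (\<i> * of_int (- k) * fmode (- k) x) + dx \<phi> x * fmode (- k) x) has_integral
     (\<phi> (2 * pi) * fmode (- k) (2 * pi) - \<phi> 0 * fmode (- k) 0)) {0..2*pi}"
  proof (rule fundamental_theorem_of_calculus)
    show "((\<lambda>x. \<phi> x * fmode (- k) x) has_vector_derivative
        (\<phi> x * (\<i> * of_int (- k) * fmode (- k) x) + dx \<phi> x * fmode (- k) x)) (at x within {0..2*pi})" for x
      by (intro has_vector_derivative_mult fmode_has_vector_derivative
          has_vector_derivative_at_within[OF test_function_derivative[OF assms]])
  qed simp
  moreover have "\<phi> (2 * pi) * fmode (- k) (2 * pi) - \<phi> 0 * fmode (- k) 0 = 0"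
    using fmode_periodic[of "- k" 0] assms unfolding periodic_test_function_def
    by (metis add_0 diff_self)
  ultimately have "integral {0..2*pi} (\<lambda>x. \<phi> x * (\<i> * of_int (- k) * fmode (- k) x) + dx \<phi> x * fmode (- k) x) = 0"
    by (simp only: integral_unique)
  then have "(LINT x|torus. \<phi> x * (\<i> * of_int (- k) * fmode (- k) x) + dx \<phi> x * fmode (- k) x) = 0"
    by (subst lint_torus_continuous(2)) (auto intro!: continuous_intros c c')
  then have "(LINT x|torus. dx \<phi> x * fmode (- k) x) - \<i> * of_int k * (LINT x|torus. \<phi> x * fmode (- k) x) = 0"
    using lint_torus_continuous(1)[OF i1] lint_torus_continuous(1)[OF i2]
    by (simp add: mult.left_commute[of "\<phi> _"] mult.assoc)
  then show ?thesis by (simp add: fourier_coeff_fmode mult_ac)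
qed

text \<open>Two integrations by parts give decay like 1 / (1 + k^2), which is the squared inverse
  weight for r = 1.\<close>

lemma test_function_abs_summable:
  assumes \<phi>: "periodic_test_function \<phi>"
  shows "(\<lambda>k. cmod (fc \<phi> k)) summable_on UNIV"
proof -
  have bdd: "\<exists>B. \<forall>k. cmod (fc \<psi> k) \<le> B" if "periodic_test_function \<psi>" for \<psi>
    using cmod_fourier_coeff_le[OF lint_torus_continuous(1)[OF test_function_continuous[OF that]]] by blast
  note \<phi>' = test_function_dx[OF \<phi>]
  note \<phi>'' = test_function_dx[OF \<phi>']
  obtain B where B: "\<And>k. cmod (fc \<phi> k) \<le> B" using bdd[OF \<phi>] by blast
  obtain C where C: "\<And>k. cmod (fc (dx (dx \<phi>)) k) \<le> C" using bdd[OF \<phi>''] by blast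
  have le: "cmod (fc \<phi> k) \<le> (B + C) * (inverse (sob_weight 1 k))\<^sup>2" for k
  proof -
    have "(of_int k)\<^sup>2 * cmod (fc \<phi> k) \<le> C"
      using C[of k] unfolding fourier_coeff_dx[OF \<phi>'] fourier_coeff_dx[OF \<phi>]
      by (simp add: norm_mult power2_eq_square mult.assoc)
    then have le: "(1 + (of_int k)\<^sup>2) * cmod (fc \<phi> k) \<le> B + C" using B[of k] by (simp add: distrib_right)
    have pos: "1 + (real_of_int k)\<^sup>2 > 0" by (simp add: add_pos_nonneg)
    then have "(inverse (sob_weight 1 k))\<^sup>2 = inverse (1 + (of_int k)\<^sup>2)"
      by (simp add: power_inverse sob_weight_square)
    then show ?thesis using le pos by (simp add: field_simps)
  qed
  show ?thesis
    by (rule summable_on_comparison_test[OF summable_on_cmult_right[OF summable_on_inverse_sob_weight[of 1]]])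
       (use le in auto)
qed

subsection \<open>Termwise differentiation\<close>

text \<open>Limits over finite sets of indices become limits of a sequence, to which the theorem on
  differentiating sequences of functions applies.\<close>

lemma filterlim_symmetric_intervals:
  "filterlim (\<lambda>n. {- int n..int n}) (finite_subsets_at_top UNIV) sequentially"
  unfolding filterlim_finite_subsets_at_top
proof (intro allI impI)
  fix X :: "int set" assume X: "finite X \<and> X \<subseteq> UNIV"
  have "\<forall>\<^sub>F n in sequentially. \<forall>x\<in>X. x \<in> {- int n..int n}"
  proof (rule eventually_ball_finite)
    show "\<forall>x\<in>X. \<forall>\<^sub>F n in sequentially. x \<in> {- int n..int n}"
    proof
      fix x
      show "\<forall>\<^sub>F n in sequentially. x \<in> {- int n..int n}"
        using eventually_ge_at_top[of "nat \<bar>x\<bar>"] by eventually_elim auto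
    qed
  qed (use X in auto)
  then show "\<forall>\<^sub>F n in sequentially. finite {- int n..int n} \<and> X \<subseteq> {- int n..int n} \<and> {- int n..int n} \<subseteq> UNIV"
    by eventually_elim auto
qed

text \<open>The summable majorant B makes the derivatives of the symmetric partial sums converge
  uniformly on the interval, which permits differentiation of the limit.\<close>

lemma has_vector_derivative_infsum:
  fixes f f' :: "int \<Rightarrow> real \<Rightarrow> complex"
  assumes der: "\<And>j x. x \<in> {a<..<b} \<Longrightarrow> (f j has_vector_derivative f' j x) (at x)"
    and B: "B summable_on UNIV" and le: "\<And>j x. x \<in> {a<..<b} \<Longrightarrow> cmod (f' j x) \<le> B j"
    and sum: "\<And>x. x \<in> {a<..<b} \<Longrightarrow> (\<lambda>j. f j x) summable_on UNIV"
    and t: "t \<in> {a<..<b}"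
  shows "((\<lambda>x. \<Sum>\<^sub>\<infinity>j. f j x) has_vector_derivative (\<Sum>\<^sub>\<infinity>j. f' j t)) (at t)"
proof -
  let ?J = "\<lambda>n. {- int n..int n}"
  have lim: "(\<lambda>n. \<Sum>j\<in>?J n. f j x) \<longlonglongrightarrow> (\<Sum>\<^sub>\<infinity>j. f j x)" if "x \<in> {a<..<b}" for x
    using filterlim_compose[OF _ filterlim_symmetric_intervals, of "\<lambda>J. \<Sum>j\<in>J. f j x"] has_sum_infsum[OF sum[OF that]]
    by (simp add: has_sum_def)
  have "((\<lambda>J. infsum B UNIV - sum B J) \<longlongrightarrow> infsum B UNIV - infsum B UNIV) (finite_subsets_at_top UNIV)"
    using has_sum_infsum[OF B] by (intro tendsto_diff tendsto_const) (simp add: has_sum_def)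
  then have tail: "(\<lambda>n. infsum B UNIV - sum B (?J n)) \<longlonglongrightarrow> 0"
    using filterlim_compose[OF _ filterlim_symmetric_intervals] by simp
  have "\<exists>g. \<forall>x\<in>{a<..<b}. (\<lambda>n. \<Sum>j\<in>?J n. f j x) \<longlonglongrightarrow> g x \<and>
      (g has_derivative (\<lambda>h. h *\<^sub>R (\<Sum>\<^sub>\<infinity>j. f' j x))) (at x within {a<..<b})"
  proof (rule has_derivative_sequence[where f' = "\<lambda>n x h. h *\<^sub>R (\<Sum>j\<in>?J n. f' j x)"
        and f = "\<lambda>n x. \<Sum>j\<in>?J n. f j x" and l = "\<Sum>\<^sub>\<infinity>j. f j t"])
    show "t \<in> {a<..<b}" "(\<lambda>n. \<Sum>j\<in>?J n. f j t) \<longlonglongrightarrow> (\<Sum>\<^sub>\<infinity>j. f j t)" by (fact t, rule lim[OF t])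
    fix n x assume x: "x \<in> {a<..<b}"
    have "((\<lambda>x. \<Sum>j\<in>?J n. f j x) has_vector_derivative (\<Sum>j\<in>?J n. f' j x)) (at x within {a<..<b})"
      by (intro has_vector_derivative_sum has_vector_derivative_at_within[OF der] x)
    then show "((\<lambda>x. \<Sum>j\<in>?J n. f j x) has_derivative (\<lambda>h. h *\<^sub>R (\<Sum>j\<in>?J n. f' j x))) (at x within {a<..<b})"
      by (simp add: has_vector_derivative_def)
  next
    fix e :: real assume "e > 0"
    from order_tendstoD(2)[OF tail this]
    show "\<forall>\<^sub>F n in sequentially. \<forall>x\<in>{a<..<b}. \<forall>h. norm (h *\<^sub>R (\<Sum>j\<in>?J n. f' j x) - h *\<^sub>R (\<Sum>\<^sub>\<infinity>j. f' j x)) \<le> e * norm h"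
    proof eventually_elim
      case (elim n)
      show ?case
      proof (intro ballI allI)
        fix x h assume x: "x \<in> {a<..<b}"
        have "cmod ((\<Sum>j\<in>?J n. f' j x) - (\<Sum>\<^sub>\<infinity>j. f' j x)) \<le> e"
          using infsum_tail_le[of B "\<lambda>j. f' j x" "?J n", OF B le[OF x]] elim by (simp add: norm_minus_commute)
        then have "cmod ((\<Sum>j\<in>?J n. f' j x) - (\<Sum>\<^sub>\<infinity>j. f' j x)) * \<bar>h\<bar> \<le> e * \<bar>h\<bar>" by (rule mult_right_mono) simp
        then show "norm (h *\<^sub>R (\<Sum>j\<in>?J n. f' j x) - h *\<^sub>R (\<Sum>\<^sub>\<infinity>j. f' j x)) \<le> e * norm h"
          by (simp only: scaleR_diff_right[symmetric] norm_scaleR real_norm_def mult.commute)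
      qed
    qed
  qed auto
  then obtain g where g: "\<And>x. x \<in> {a<..<b} \<Longrightarrow> (\<lambda>n. \<Sum>j\<in>?J n. f j x) \<longlonglongrightarrow> g x"
    and dg: "\<And>x. x \<in> {a<..<b} \<Longrightarrow> (g has_derivative (\<lambda>h. h *\<^sub>R (\<Sum>\<^sub>\<infinity>j. f' j x))) (at x within {a<..<b})"
    by blast
  have "(g has_vector_derivative (\<Sum>\<^sub>\<infinity>j. f' j t)) (at t)"
    using dg[OF t] t by (simp add: has_vector_derivative_def at_within_open[of t "{a<..<b}"])
  then show ?thesis
    by (rule has_vector_derivative_transform_within_open[where S = "{a<..<b}"])
       (use t LIMSEQ_unique[OF g lim] in auto)
qed

text \<open>The pairing is, up to 2 pi, the zero coefficient of the product, hence a convolution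
  evaluated at 0.\<close>

lemma lint_mult_test_function:
  fixes g \<phi> :: "real \<Rightarrow> complex"
  assumes g: "integrable torus g" and \<phi>: "periodic_test_function \<phi>"
  shows "((\<lambda>j. fc \<phi> j * fc g (- j)) has_sum (1 / (2 * pi)) * (LINT x|torus. g x * \<phi> x)) UNIV"
  using fourier_coeff_mult(1)[OF g lint_torus_continuous(1)[OF test_function_continuous[OF \<phi>]] test_function_abs_summable[OF \<phi>], of 0]
  by (simp add: fourier_coeff_fmode)

lemma mild_coeff_derivative:
  assumes v: "admissible r T M v" "\<forall>t\<in>{0..T}. v t = duhamel \<mu> (v 0) v t" and r: "r > 1/2" and t: "t \<in> {0<..<T}"
  shows "((\<lambda>t. free_phase t k * v t k) has_vector_derivative
     - \<i> * (of_int k)\<^sup>2 * (free_phase t k * v t k)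
     - \<i> * \<mu> * interaction 0 (\<lambda>k. free_phase t k * v t k) (\<lambda>k. free_phase t k * v t k) k) (at t)"
proof -
  have "((\<lambda>u. integral {0..u} (\<lambda>s. interaction s (v s) (v s) k)) has_vector_derivative interaction t (v t) (v t) k) (at t within {0..T})"
    by (rule integral_has_vector_derivative[OF continuous_on_interaction_admissible[OF v(1) r order_refl]]) (use t in auto)
  then have "((\<lambda>u. integral {0..u} (\<lambda>s. interaction s (v s) (v s) k)) has_vector_derivative interaction t (v t) (v t) k) (at t)"
    using t by (simp add: at_within_Icc_at)
  then have "((\<lambda>u. v 0 k - \<i> * \<mu> * integral {0..u} (\<lambda>s. interaction s (v s) (v s) k)) has_vector_derivative (0 - \<i> * \<mu> * interaction t (v t) (v t) k)) (at t)"
    by (intro has_vector_derivative_diff has_vector_derivative_const has_vector_derivative_mult_right)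
  then have dv: "((\<lambda>u. v u k) has_vector_derivative (0 - \<i> * \<mu> * interaction t (v t) (v t) k)) (at t)"
  proof (rule has_vector_derivative_transform_within_open[where S = "{0<..<T}"])
    fix u assume "u \<in> {0<..<T}"
    then have "u \<in> {0..T}" by auto
    from fun_cong[OF bspec[OF v(2) this], of k]
    show "v 0 k - \<i> * \<mu> * integral {0..u} (\<lambda>s. interaction s (v s) (v s) k) = v u k"
      unfolding duhamel_def by (rule sym)
  qed (use t in auto)
  show ?thesis
    unfolding interaction_gauge
    using has_vector_derivative_mult[OF free_phase_has_vector_derivative[of 1 k t UNIV] dv, unfolded mult_1_left]
    by (rule has_vector_derivative_eq_rhs) (simp add: algebra_simps)
qed

text \<open>The products of k^2 with the coefficients of u need not be summable. In the pairing with
  a test function the factor k^2 is moved to the coefficients of the test function, where it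
  produces those of its second derivative; their absolute summability dominates the differentiated
  series.\<close>

lemma mild_imp_exact_solution:
  assumes v: "mild \<mu> r T v" and r: "r > 1/2" and T: "T > 0"
    and u0: "AE x in torus. synth (v 0) x = u0 x"
  shows "exact_solution \<mu> r T u0 (\<lambda>t. synth (\<lambda>k. free_phase t k * v t k))"
proof -
  obtain M where adm: "admissible r T M v" using v by (auto simp: mild_def)
  have eq: "\<forall>t\<in>{0..T}. v t = duhamel \<mu> (v 0) v t" using v unfolding mild_def by blast
  define c where "c t = (\<lambda>k. free_phase t k * v t k)" for t
  define u where "u t = synth (c t)" for t
  have cM: "sob_le r (c t) M" if "t \<in> {0..T}" for t
    using adm that by (simp add: admissible_def sob_le_free_phase c_def)
  have us: "u t \<in> sobolev r" and fc: "fc (u t) = c t" if "t \<in> {0..T}" for t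
    unfolding u_def using synth_sobolev[OF cM[OF that] r] by auto
  have IM: "sob_le r (interaction 0 (c t) (c t)) (bil_const r * M * M)" if "t \<in> {0..T}" for t
    by (rule sob_le_interaction[OF cM[OF that] cM[OF that] r])
  have weak: "\<exists>D. ((\<lambda>s. LINT x|torus. u s x * \<phi> x) has_vector_derivative D) (at t) \<and>
      \<i> * D = - (LINT x|torus. u t x * dx (dx \<phi>) x) + \<mu> * (LINT x|torus. of_real ((cmod (u t x))\<^sup>2) * \<phi> x)"
    if \<phi>: "periodic_test_function \<phi>" and t: "t \<in> {0<..<T}" for \<phi> t
  proof -
    let ?P = "LINT x|torus. u t x * dx (dx \<phi>) x" and ?Q = "LINT x|torus. of_real ((cmod (u t x))\<^sup>2) * \<phi> x"
    define b where "b = fc \<phi>"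
    note \<phi>' = test_function_dx[OF \<phi>]
    note \<phi>'' = test_function_dx[OF \<phi>']
    define b2 where "b2 = fc (dx (dx \<phi>))"
    have b2: "b2 k = - ((of_int k)\<^sup>2) * b k" for k
      by (simp add: b2_def b_def fourier_coeff_dx[OF \<phi>'] fourier_coeff_dx[OF \<phi>] power2_eq_square algebra_simps)
    have bs: "(\<lambda>k. cmod (b k)) summable_on UNIV" unfolding b_def by (rule test_function_abs_summable[OF \<phi>])
    have b2s: "(\<lambda>k. cmod (b2 k)) summable_on UNIV" unfolding b2_def by (rule test_function_abs_summable[OF \<phi>''])
    define f where "f j s = b j * c s (- j)" for j s
    define f' where "f' j s = \<i> * (b2 j * c s (- j)) - \<i> * \<mu> * (b j * interaction 0 (c s) (c s) (- j))" for j s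
    have t': "t \<in> {0..T}" using t by auto
    have hs: "((\<lambda>j. f j s) has_sum (1 / (2 * pi)) * (LINT x|torus. u s x * \<phi> x)) UNIV" if "s \<in> {0..T}" for s
      using lint_mult_test_function[OF sobolev_integrable[OF us[OF that]] \<phi>] by (simp add: fc[OF that] f_def b_def)
    have "((\<lambda>s. \<Sum>\<^sub>\<infinity>j. f j s) has_vector_derivative (\<Sum>\<^sub>\<infinity>j. f' j t)) (at t)"
    proof (rule has_vector_derivative_infsum[OF _ _ _ _ t])
      fix j s assume s: "s \<in> {0<..<T}"
      then have s': "s \<in> {0..T}" by auto
      have "(f j has_vector_derivative b j * (- \<i> * (of_int (- j))\<^sup>2 * c s (- j) - \<i> * \<mu> * interaction 0 (c s) (c s) (- j))) (at s)"
        unfolding f_def[abs_def] c_def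
        by (intro has_vector_derivative_mult_right mild_coeff_derivative[OF adm eq r s])
      moreover have "b j * (- \<i> * (of_int (- j))\<^sup>2 * c s (- j) - \<i> * \<mu> * interaction 0 (c s) (c s) (- j)) = f' j s"
        unfolding f'_def b2 by (simp add: algebra_simps)
      ultimately show "(f j has_vector_derivative f' j s) (at s)" by simp
      have "cmod (f' j s) \<le> cmod (\<i> * (b2 j * c s (- j))) + cmod (\<i> * \<mu> * (b j * interaction 0 (c s) (c s) (- j)))"
        unfolding f'_def by (rule norm_triangle_ineq4)
      also have "\<dots> \<le> cmod (b2 j) * M + cmod \<mu> * (cmod (b j) * (bil_const r * M * M))"
        using sob_le_cmod[OF cM[OF s'], of "- j"] sob_le_cmod[OF IM[OF s'], of "- j"] r
        by (auto simp: norm_mult mult.assoc intro!: add_mono mult_left_mono)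
      finally show "cmod (f' j s) \<le> cmod (b2 j) * M + cmod \<mu> * (cmod (b j) * (bil_const r * M * M))" .
    next
      show "(\<lambda>j. cmod (b2 j) * M + cmod \<mu> * (cmod (b j) * (bil_const r * M * M))) summable_on UNIV"
        by (intro summable_on_add summable_on_cmult_right summable_on_cmult_left bs b2s)
      show "(\<lambda>j. f j s) summable_on UNIV" if "s \<in> {0<..<T}" for s
        using hs[of s] that by (auto intro: has_sum_imp_summable)
    qed
    from has_vector_derivative_mult_right[OF this, of "2 * of_real pi"]
    have "((\<lambda>s. LINT x|torus. u s x * \<phi> x) has_vector_derivative (2 * of_real pi * (\<Sum>\<^sub>\<infinity>j. f' j t))) (at t)"
      by (rule has_vector_derivative_transform_within_open[where S = "{0<..<T}"])
         (use t infsumI[OF hs] in auto)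
    moreover have "((\<lambda>j. f' j t) has_sum (\<i> * ((1 / (2 * pi)) * ?P)
        - \<i> * \<mu> * ((1 / (2 * pi)) * ?Q))) UNIV"
      unfolding f'_def
    proof (intro has_sum_diff_complex has_sum_cmult_right)
      show "((\<lambda>j. b2 j * c t (- j)) has_sum (1 / (2 * pi)) * ?P) UNIV"
        using lint_mult_test_function[OF sobolev_integrable[OF us[OF t']] \<phi>''] by (simp add: fc[OF t'] b2_def)
      show "((\<lambda>j. b j * interaction 0 (c t) (c t) (- j)) has_sum (1 / (2 * pi)) * ?Q) UNIV"
        using lint_mult_test_function[OF fourier_coeff_cmod_square(2)[OF us[OF t'] r] \<phi>]
        by (simp only: fourier_coeff_cmod_square(1)[OF us[OF t'] r] fc[OF t'] b_def)
    qed
    then have "(\<Sum>\<^sub>\<infinity>j. f' j t) = \<i> * ((1 / (2 * pi)) * ?P)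
        - \<i> * \<mu> * ((1 / (2 * pi)) * ?Q)"
      by (rule infsumI)
    then have "\<i> * (2 * of_real pi * (\<Sum>\<^sub>\<infinity>j. f' j t)) = - ?P + \<mu> * ?Q"
      by (simp only:) (simp add: field_simps)
    ultimately show ?thesis by blast
  qed
  have "continuous_into_sobolev r T u"
    using mild_continuous_into_sobolev[OF adm eq r] by (simp add: u_def[abs_def] c_def)
  moreover have "AE x in torus. u 0 x = u0 x" using u0 by (simp add: u_def c_def)
  ultimately have "exact_solution \<mu> r T u0 u" unfolding exact_solution_def using weak by blast
  then show ?thesis by (simp add: u_def[abs_def] c_def)
qed

text \<open>The mild solution w yields an exact one, so the choice does select an exact solution.
  That solution is mild in turn, and uniqueness of mild solutions identifies its coefficients with
  those of w. The function itself is fixed only up to null sets, which is why coefficients are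
  compared.\<close>

lemma fine_propagator_coeff:
  assumes f: "f \<in> sobolev r" and r: "r > 1/2" and \<tau>: "\<tau> > 0"
    and w: "mild \<mu> r \<tau> w" "w 0 = fc f"
  shows "fine_propagator \<mu> r \<tau> f \<in> sobolev r"
    and "fc (fine_propagator \<mu> r \<tau> f) = (\<lambda>k. free_phase \<tau> k * w \<tau> k)"
proof -
  have "AE x in torus. synth (w 0) x = f x"
    using AE_eq_synth[OF sobolev_integrable[OF f] sobolev_abs_summable[OF f r]] unfolding w(2)
    by eventually_elim simp
  then have ex: "exact_solution \<mu> r \<tau> f (\<lambda>t. synth (\<lambda>k. free_phase t k * w t k))"
    by (rule mild_imp_exact_solution[OF w(1) r \<tau>])
  define u where "u = (SOME u. exact_solution \<mu> r \<tau> f u)"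
  have u: "exact_solution \<mu> r \<tau> f u" unfolding u_def by (rule someI[of "exact_solution \<mu> r \<tau> f", OF ex])
  have us: "u t \<in> sobolev r" if "t \<in> {0..\<tau>}" for t
    using u that by (simp add: exact_solution_def continuous_into_sobolev_def)
  have F: "fine_propagator \<mu> r \<tau> f = u \<tau>" by (simp add: fine_propagator_def u_def)
  show "fine_propagator \<mu> r \<tau> f \<in> sobolev r" unfolding F by (rule us) (use \<tau> in auto)
  let ?v = "\<lambda>t k. free_phase (- t) k * fc (u t) k"
  have m: "mild \<mu> r \<tau> ?v" by (rule exact_solution_imp_mild[OF u r])
  have "AE x in torus. f x = u 0 x" using u unfolding exact_solution_def by (auto elim: eventually_mono)
  then have "fc (u 0) = fc f" by (rule sobolev_cong_AE(2)[OF f])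
  then have "?v 0 = w 0" using w(2) by simp
  then have "?v \<tau> = w \<tau>" by (rule mild_unique[OF m w(1) _ r]) (use \<tau> in auto)
  then have "w \<tau> k = free_phase (- \<tau>) k * fc (u \<tau>) k" for k by (simp add: fun_eq_iff)
  then show "fc (fine_propagator \<mu> r \<tau> f) = (\<lambda>k. free_phase \<tau> k * w \<tau> k)"
    unfolding F by (simp add: fun_eq_iff mult.assoc[symmetric] mult.commute[of "free_phase \<tau> _"] free_phase_inverse)
qed

section \<open>The parareal iteration\<close>

lemma sobolev_add:
  assumes "f \<in> sobolev r" "g \<in> sobolev r" shows "(\<lambda>x. f x + g x) \<in> sobolev r"
proof (rule sob_le_imp_sobolev(1))
  show "(\<lambda>x. f x + g x) \<in> L2" using assms by (intro L2_add sobolev_L2)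
  have "fc (\<lambda>x. f x + g x) = (\<lambda>k. fc f k + fc g k)"
    using assms by (intro ext fourier_coeff_add sobolev_integrable)
  then show "sob_le r (fc (\<lambda>x. f x + g x)) (norm_sobolev r f / sqrt (2 * pi) + norm_sobolev r g / sqrt (2 * pi))"
    using sob_le_add[OF sobolev_imp_sob_le[OF assms(1)] sobolev_imp_sob_le[OF assms(2)]] by simp
qed

lemma coarse_propagator_sobolev:
  assumes f: "f \<in> sobolev r" and r: "r > 1/2" and \<tau>: "\<tau> \<ge> 0"
  shows "coarse_propagator \<mu> \<tau> f \<in> sobolev r"
proof -
  obtain M where a: "sob_le r (fc f) M" using sobolev_imp_sob_le[OF f] by blast
  have "sob_le r (\<lambda>k. fc f k + (duhamel \<mu> (fc f) (\<lambda>_. fc f) \<tau> k - fc f k))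
      (M + \<tau> * (cmod \<mu> * (bil_const r * M * M)))"
    by (rule sob_le_add[OF a sob_le_duhamel_increment[OF admissible_const[OF a] r, of \<tau> \<tau>]]) (use \<tau> in auto)
  then have "sob_le r (fc (coarse_propagator \<mu> \<tau> f)) (M + \<tau> * (cmod \<mu> * (bil_const r * M * M)))"
    unfolding ext[of "fc (coarse_propagator \<mu> \<tau> f)", OF coarse_propagator_coeff(2)[OF f r \<tau>]] sob_le_free_phase
    by simp
  then show ?thesis by (rule sob_le_imp_sobolev(1)[OF coarse_propagator_coeff(1)[OF f r \<tau>]])
qed

text \<open>The free phase is common to both terms and has modulus 1, so the one-step estimate
  carries over.\<close>

lemma coarse_propagator_lipschitz:
  assumes f: "f \<in> sobolev r" and g: "g \<in> sobolev r" and r: "r > 1/2" and \<tau>: "\<tau> \<ge> 0"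
    and "sob_le r (fc f) M" "sob_le r (fc g) M"
    and "sob_le r (\<lambda>k. fc f k - fc g k) \<delta>"
  shows "sob_le r (\<lambda>k. fc (coarse_propagator \<mu> \<tau> f) k - fc (coarse_propagator \<mu> \<tau> g) k)
    ((1 + lip \<mu> r M * \<tau>) * \<delta>)"
  unfolding coarse_propagator_coeff(2)[OF f r \<tau>] coarse_propagator_coeff(2)[OF g r \<tau>]
    right_diff_distrib[symmetric] sob_le_free_phase
  by (intro one_step_stability assms)

lemma propagator_defect_lipschitz:
  assumes f: "f \<in> sobolev r" and g: "g \<in> sobolev r" and r: "r > 1/2" and \<tau>: "0 < \<tau>" "\<tau> \<le> 1"
    and v: "mild \<mu> r \<tau> v" "v 0 = fc f" "admissible r \<tau> M v"
    and w: "mild \<mu> r \<tau> w" "w 0 = fc g" "admissible r \<tau> M w"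
    and d: "sob_le r (\<lambda>k. fc f k - fc g k) \<delta>"
  shows "sob_le r (\<lambda>k. (fc (fine_propagator \<mu> r \<tau> f) k - fc (coarse_propagator \<mu> \<tau> f) k)
      - (fc (fine_propagator \<mu> r \<tau> g) k - fc (coarse_propagator \<mu> \<tau> g) k))
    (defect_const \<mu> r M * \<tau>\<^sup>2 * \<delta>)"
proof -
  have \<tau>': "\<tau> \<ge> 0" using \<tau> by simp
  show ?thesis
    unfolding coarse_propagator_coeff(2)[OF f r \<tau>'] coarse_propagator_coeff(2)[OF g r \<tau>']
      fine_propagator_coeff(2)[OF f r \<tau>(1) v(1,2)] fine_propagator_coeff(2)[OF g r \<tau>(1) w(1,2)]
      right_diff_distrib[symmetric] sob_le_free_phase
    using local_defect_lipschitz[OF v(3,1) w(3,1) _ r \<tau>' \<tau>(2), of \<delta>] d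
    by (simp add: v(2) w(2))
qed

text \<open>The Lipschitz estimate is used against the zero solution, whose defect vanishes; the
  size of the data takes the place of the distance.\<close>

lemma propagator_defect:
  assumes f: "f \<in> sobolev r" and r: "r > 1/2" and \<tau>: "0 < \<tau>" "\<tau> \<le> 1"
    and v: "mild \<mu> r \<tau> v" "v 0 = fc f" "admissible r \<tau> M v"
    and d: "sob_le r (fc f) \<delta>"
  shows "sob_le r (\<lambda>k. fc (fine_propagator \<mu> r \<tau> f) k - fc (coarse_propagator \<mu> \<tau> f) k)
    (defect_const \<mu> r M * \<tau>\<^sup>2 * \<delta>)"
proof -
  have \<tau>': "\<tau> \<ge> 0" using \<tau> by simp
  have M: "M \<ge> 0" using admissible_nonneg[OF v(3) \<tau>'] .
  have 0: "admissible r \<tau> M (\<lambda>_ _. 0)" by (rule admissible_const[OF sob_le_0[OF M]])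
  have "duhamel \<mu> (\<lambda>_. 0) (\<lambda>_ _. 0) \<tau> k = 0" for k by (simp add: duhamel_def interaction_def)
  then show ?thesis
    unfolding coarse_propagator_coeff(2)[OF f r \<tau>'] fine_propagator_coeff(2)[OF f r \<tau>(1) v(1,2)]
      right_diff_distrib[symmetric] sob_le_free_phase
    using local_defect_lipschitz[OF v(3,1) 0 mild_0 _ r \<tau>' \<tau>(2), of \<delta>] d
    by (simp add: v(2))
qed

section \<open>The exact solution as an orbit of the fine propagator\<close>

lemma exact_solution_shift:
  assumes u: "exact_solution \<mu> r T u0 u" and a: "0 \<le> a" "a + \<tau> \<le> T"
  shows "exact_solution \<mu> r \<tau> (u a) (\<lambda>t. u (a + t))"
  unfolding exact_solution_def continuous_into_sobolev_def
proof (intro conjI ballI allI impI)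
  fix t assume t: "t \<in> {0..\<tau>}"
  then have at: "a + t \<in> {0..T}" using a by auto
  show "u (a + t) \<in> sobolev r" using u at by (simp add: exact_solution_def continuous_into_sobolev_def)
  have l: "((\<lambda>s. norm_sobolev r (\<lambda>x. u s x - u (a + t) x)) \<longlongrightarrow> 0) (at (a + t) within {0..T})"
    using u at by (simp add: exact_solution_def continuous_into_sobolev_def)
  have "filterlim (\<lambda>s. a + s) (at (a + t) within {0..T}) (at t within {0..\<tau>})"
    unfolding filterlim_at
  proof (intro conjI)
    show "((\<lambda>s. a + s) \<longlongrightarrow> a + t) (at t within {0..\<tau>})" by (intro tendsto_intros)
    show "\<forall>\<^sub>F s in at t within {0..\<tau>}. a + s \<in> {0..T} \<and> a + s \<noteq> a + t"
      using a by (auto simp: eventually_at_filter)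
  qed
  from filterlim_compose[OF l this]
  show "((\<lambda>s. norm_sobolev r (\<lambda>x. u (a + s) x - u (a + t) x)) \<longlongrightarrow> 0) (at t within {0..\<tau>})" .
next
  show "AE x in torus. u (a + 0) x = u a x" by simp
next
  fix \<phi> t assume \<phi>: "periodic_test_function \<phi>" and t: "t \<in> {0<..<\<tau>}"
  then have "a + t \<in> {0<..<T}" using a by auto
  then obtain D where D: "((\<lambda>s. LINT x|torus. u s x * \<phi> x) has_vector_derivative D) (at (a + t))"
    and iD: "\<i> * D = - (LINT x|torus. u (a + t) x * dx (dx \<phi>) x)
                 + \<mu> * (LINT x|torus. of_real ((cmod (u (a + t) x))\<^sup>2) * \<phi> x)"
    using u \<phi> unfolding exact_solution_def by blast
  have "((\<lambda>s. LINT x|torus. u (a + s) x * \<phi> x) has_vector_derivative (1 *\<^sub>R D)) (at t)"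
    by (rule vector_diff_chain_at[of "\<lambda>s. a + s" 1 t, unfolded o_def])
       (auto intro!: derivative_eq_intros D)
  then show "\<exists>D. ((\<lambda>s. LINT x|torus. u (a + s) x * \<phi> x) has_vector_derivative D) (at t) \<and>
        \<i> * D = - (LINT x|torus. u (a + t) x * dx (dx \<phi>) x)
                 + \<mu> * (LINT x|torus. of_real ((cmod (u (a + t) x))\<^sup>2) * \<phi> x)"
    using iD by auto
qed

lemma fine_propagator_exact_solution:
  assumes u: "exact_solution \<mu> r T u0 u" and r: "r > 1/2" and a: "0 \<le> a" "a + \<tau> \<le> T" and \<tau>: "\<tau> > 0"
  shows "fc (fine_propagator \<mu> r \<tau> (u a)) = fc (u (a + \<tau>))"
proof -
  have ua: "u a \<in> sobolev r" using u a \<tau> by (simp add: exact_solution_def continuous_into_sobolev_def)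
  have "fc (fine_propagator \<mu> r \<tau> (u a)) = (\<lambda>k. free_phase \<tau> k * (free_phase (- \<tau>) k * fc (u (a + \<tau>)) k))"
    by (rule fine_propagator_coeff(2)[OF ua r \<tau> exact_solution_imp_mild[OF exact_solution_shift[OF u a] r]]) simp
  then show ?thesis
    by (simp add: fun_eq_iff mult.assoc[symmetric] mult.commute[of "free_phase \<tau> _"] free_phase_inverse)
qed

text \<open>In the application L and D become \<open>L * \<tau>\<close> and
  \<open>D * \<tau>\<^sup>2\<close>. The bound is coarser than the geometric sum that solves the
  recursion with start 0, but it contains no division by L, so L = 0 is no exception.\<close>

lemma gronwall_step:
  fixes L B D :: real
  assumes "L \<ge> 0" "D \<ge> 0" "B \<ge> 0"
  shows "(1 + L) * (real n * (1 + L) ^ n * (D * B)) + D * B \<le> real (Suc n) * (1 + L) ^ Suc n * (D * B)"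
proof -
  have "1 * (D * B) \<le> (1 + L) ^ Suc n * (D * B)"
    by (rule mult_right_mono) (use assms in \<open>auto intro: one_le_power simp del: power_Suc\<close>)
  then show ?thesis by (simp add: algebra_simps)
qed

text \<open>One of the two factors \<tau> is spent on the number of steps, since n \<tau> \<le> T,
  and the growth factor is at most exp (L T). The other \<tau> remains as the gain per
  iteration.\<close>

lemma gronwall_bound:
  fixes L D T \<tau> :: real
  assumes "L \<ge> 0" "D \<ge> 0" "\<tau> > 0" "real n * \<tau> \<le> T"
  shows "real n * (1 + L * \<tau>) ^ n * (D * \<tau>\<^sup>2) \<le> (T * exp (L * T) * D) * \<tau>"
proof -
  have T: "T \<ge> 0" using assms(3,4) by (meson less_imp_le mult_nonneg_nonneg of_nat_0_le_iff order_trans)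
  have "(1 + L * \<tau>) ^ n \<le> exp (L * \<tau>) ^ n" by (rule power_mono) (use assms exp_ge_add_one_self in auto)
  also have "\<dots> = exp (L * (real n * \<tau>))" by (simp add: exp_of_nat_mult[symmetric] mult_ac)
  also have "\<dots> \<le> exp (L * T)" using assms by (auto intro: mult_left_mono)
  finally have "(real n * \<tau>) * (1 + L * \<tau>) ^ n \<le> T * exp (L * T)"
    using assms T by (intro mult_mono) auto
  then have "((real n * \<tau>) * (1 + L * \<tau>) ^ n) * (D * \<tau>) \<le> (T * exp (L * T)) * (D * \<tau>)"
    by (rule mult_right_mono) (use assms in auto)
  then show ?thesis by (simp add: power2_eq_square mult_ac)
qed

text \<open>All k follow one scheme if M is viewed as the error before the coarse run: for k = 0 the
  defect of the exact solution is at most \<open>D * \<tau>\<^sup>2 * M\<close>, just what a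
  previous iterate with error M would contribute. Hence the exponent \<open>Suc k\<close>. The
  estimates live on the ball of radius \<open>M + 1\<close>, with mild solutions bounded by
  \<open>M + 2\<close>, and the two smallness conditions keep the iterates in that ball.\<close>

lemma parareal_error:
  assumes u: "exact_solution \<mu> r T u0 u" and r: "r > 1/2" and \<tau>: "0 < \<tau>" "\<tau> \<le> 1"
    and M: "\<And>t. t \<in> {0..T} \<Longrightarrow> sob_le r (fc (u t)) M"
    and ex: "\<And>v0. sob_le r v0 (M + 1) \<Longrightarrow> \<exists>v. mild \<mu> r \<tau> v \<and> v 0 = v0 \<and> admissible r \<tau> (M + 2) v"
    and S: "S = T * exp (lip \<mu> r (M + 2) * T) * defect_const \<mu> r (M + 2)"
    and small: "M * (S * \<tau>) \<le> 1" "S * \<tau> \<le> 1"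
    and N: "real N * \<tau> \<le> T" and n: "n \<le> N"
  shows "parareal (fine_propagator \<mu> r \<tau>) (coarse_propagator \<mu> \<tau>) u0 n k \<in> sobolev r \<and>
    sob_le r (\<lambda>j. fc (parareal (fine_propagator \<mu> r \<tau>) (coarse_propagator \<mu> \<tau>) u0 n k) j
      - fc (u (real n * \<tau>)) j) (M * (S * \<tau>) ^ Suc k)"
  using n
proof (induction k arbitrary: n)
  define F where "F = fine_propagator \<mu> r \<tau>"
  define G where "G = coarse_propagator \<mu> \<tau>"
  define U where "U = parareal F G u0"
  define L where "L = lip \<mu> r (M + 2)"
  define D where "D = defect_const \<mu> r (M + 2)"
  have T0: "T \<ge> 0" using N \<tau> by (meson order_trans mult_nonneg_nonneg of_nat_0_le_iff less_imp_le)
  have M0: "M \<ge> 0" using sob_le_nonneg[OF M[of 0]] T0 by simp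
  have L0: "L \<ge> 0" using M0 by (auto simp: L_def intro!: lip_nonneg)
  have D0: "D \<ge> 0" using M0 by (auto simp: D_def intro!: defect_const_nonneg)
  have S0: "S \<ge> 0" unfolding S using T0 M0 by (intro mult_nonneg_nonneg defect_const_nonneg) auto
  have tn: "real n * \<tau> \<in> {0..T}" if "n \<le> N" for n
    using that \<tau> order_trans[OF mult_right_mono[of "real n" "real N" \<tau>] N] by auto
  have us: "u t \<in> sobolev r" if "t \<in> {0..T}" for t
    using u that by (simp add: exact_solution_def continuous_into_sobolev_def)
  have Fu: "fc (F (u (real n * \<tau>))) = fc (u (real (Suc n) * \<tau>))" if "Suc n \<le> N" for n
    using fine_propagator_exact_solution[OF u r _ _ \<tau>(1), of "real n * \<tau>"] tn[OF that] \<tau>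
    by (simp add: F_def algebra_simps)
  have Fs: "F f \<in> sobolev r" if "f \<in> sobolev r" "sob_le r (fc f) (M + 1)" for f
    using ex[OF that(2)] fine_propagator_coeff(1)[OF that(1) r \<tau>(1)] unfolding F_def by blast
  have Gs: "G f \<in> sobolev r" if "f \<in> sobolev r" for f
    unfolding G_def by (rule coarse_propagator_sobolev[OF that r]) (use \<tau> in simp)
  have G_lip: "sob_le r (\<lambda>j. fc (G f) j - fc (G g) j) ((1 + L * \<tau>) * \<delta>)"
    if "f \<in> sobolev r" "sob_le r (fc f) (M + 1)" "g \<in> sobolev r" "sob_le r (fc g) (M + 1)"
      "sob_le r (\<lambda>j. fc f j - fc g j) \<delta>" for f g \<delta>
    unfolding G_def L_def
    by (rule coarse_propagator_lipschitz) (use that r \<tau> in \<open>auto elim: sob_le_mono\<close>)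
  have defect_lip: "sob_le r (\<lambda>j. (fc (F f) j - fc (G f) j) - (fc (F g) j - fc (G g) j)) (D * \<tau>\<^sup>2 * \<delta>)"
    if "f \<in> sobolev r" "sob_le r (fc f) (M + 1)" "g \<in> sobolev r" "sob_le r (fc g) (M + 1)"
      "sob_le r (\<lambda>j. fc f j - fc g j) \<delta>" for f g \<delta>
  proof -
    note fg = that
    obtain v where v: "mild \<mu> r \<tau> v" "v 0 = fc f" "admissible r \<tau> (M + 2) v" using ex[OF fg(2)] by blast
    obtain w where w: "mild \<mu> r \<tau> w" "w 0 = fc g" "admissible r \<tau> (M + 2) w" using ex[OF fg(4)] by blast
    show ?thesis unfolding F_def G_def D_def by (rule propagator_defect_lipschitz[OF fg(1,3) r \<tau> v w fg(5)])
  qed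
  have defect: "sob_le r (\<lambda>j. fc (F f) j - fc (G f) j) (D * \<tau>\<^sup>2 * M)"
    if "f \<in> sobolev r" "sob_le r (fc f) M" for f
  proof -
    have "sob_le r (fc f) (M + 1)" by (rule sob_le_mono[OF that(2)]) simp
    then obtain v where v: "mild \<mu> r \<tau> v" "v 0 = fc f" "admissible r \<tau> (M + 2) v" using ex by blast
    show ?thesis unfolding F_def G_def D_def by (rule propagator_defect[OF that(1) r \<tau> v that(2)])
  qed
  let ?e = "\<lambda>n k j. fc (U n k) j - fc (u (real n * \<tau>)) j"
  \<comment> \<open>By the parareal recursion this is, for positive k, the difference between the
    defects of the previous iterate and of the exact solution; for k = 0 it is minus the defect of
    the exact solution.\<close>
  let ?X = "\<lambda>n k j. fc (U (Suc n) k) j - fc (G (U n k)) j - (fc (F (u (real n * \<tau>))) j - fc (G (u (real n * \<tau>))) j)"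
  have U0: "U 0 k \<in> sobolev r \<and> sob_le r (?e 0 k) 0" for k
  proof -
    have "u 0 \<in> sobolev r" "AE x in torus. u 0 x = u0 x" using us[of 0] T0 u by (auto simp: exact_solution_def)
    from sobolev_cong_AE[OF this] show ?thesis by (simp add: U_def sob_le_0)
  qed
  have ball: "sob_le r (fc (U n k)) (M + 1)"
    if "n \<le> N" "sob_le r (?e n k) e" "e \<le> 1" for n k e
    using sob_le_add[OF M[OF tn[OF that(1)]] that(2)] that(3) by (auto elim: sob_le_mono)
  have small_pow: "M * (S * \<tau>) ^ Suc k \<le> 1" for k
  proof -
    have "(S * \<tau>) ^ k \<le> 1" using small S0 \<tau> by (intro power_le_one) auto
    then have "(M * (S * \<tau>)) * (S * \<tau>) ^ k \<le> 1 * 1" using small S0 \<tau> M0 by (intro mult_mono) auto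
    then show ?thesis by (simp add: mult_ac)
  qed
  text \<open>The Gronwall argument in \<open>n\<close>, for the recursion \<open>E (n + 1) \<le> (1 + L \<tau>) E n + D \<tau>\<^sup>2 B\<close>.\<close>
  have gronwall: "U n k \<in> sobolev r \<and> sob_le r (?e n k) (M * (S * \<tau>) ^ Suc k)"
    if nN: "n \<le> N"
      and step: "\<And>n. Suc n \<le> N \<Longrightarrow> U n k \<in> sobolev r \<Longrightarrow>
          U (Suc n) k \<in> sobolev r \<and>
          sob_le r (?X n k) (D * \<tau>\<^sup>2 * (M * (S * \<tau>) ^ k))"
    for n k
  proof -
    define B where "B = M * (S * \<tau>) ^ k"
    have B0: "B \<ge> 0" using M0 S0 \<tau> by (simp add: B_def)
    have bnd: "real n * (1 + L * \<tau>) ^ n * (D * \<tau>\<^sup>2 * B) \<le> M * (S * \<tau>) ^ Suc k" if "n \<le> N" for n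
    proof -
      have "real n * \<tau> \<le> T" using tn[OF that] by simp
      from mult_right_mono[OF gronwall_bound[OF L0 D0 \<tau>(1) this] B0]
      show ?thesis by (simp add: B_def S L_def D_def mult_ac)
    qed
    have "U n k \<in> sobolev r \<and> sob_le r (?e n k) (real n * (1 + L * \<tau>) ^ n * (D * \<tau>\<^sup>2 * B))"
      using nN
    proof (induction n)
      case 0 then show ?case using U0 by simp
    next
      case (Suc n)
      then have Un: "U n k \<in> sobolev r" and en: "sob_le r (?e n k) (real n * (1 + L * \<tau>) ^ n * (D * \<tau>\<^sup>2 * B))"
        and nN: "n \<le> N" by auto
      \<comment> \<open>The error bound already known at step n places the iterate in the ball
        before the Lipschitz estimate is applied to it.\<close>
      have Unb: "sob_le r (fc (U n k)) (M + 1)"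
        by (rule ball[OF nN en]) (use bnd[OF nN] small_pow[of k] in linarith)
      have unb: "sob_le r (fc (u (real n * \<tau>))) (M + 1)" using M[OF tn[OF nN]] by (rule sob_le_mono) simp
      have st: "U (Suc n) k \<in> sobolev r"
        "sob_le r (?X n k) (D * \<tau>\<^sup>2 * B)"
        using step[OF Suc.prems Un] by (auto simp: B_def)
      have eq: "?e (Suc n) k = (\<lambda>j. (fc (G (U n k)) j - fc (G (u (real n * \<tau>))) j)
         + (fc (U (Suc n) k) j - fc (G (U n k)) j
            - (fc (F (u (real n * \<tau>))) j - fc (G (u (real n * \<tau>))) j)))"
        unfolding Fu[OF Suc.prems] by (simp add: fun_eq_iff)
      have le: "sob_le r (?e (Suc n) k) ((1 + L * \<tau>) * (real n * (1 + L * \<tau>) ^ n * (D * \<tau>\<^sup>2 * B)) + D * \<tau>\<^sup>2 * B)"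
        unfolding eq by (rule sob_le_add[OF G_lip[OF Un Unb us[OF tn[OF nN]] unb en] st(2)])
      have "(1 + L * \<tau>) * (real n * (1 + L * \<tau>) ^ n * (D * \<tau>\<^sup>2 * B)) + D * \<tau>\<^sup>2 * B
         \<le> real (Suc n) * (1 + L * \<tau>) ^ Suc n * (D * \<tau>\<^sup>2 * B)"
        by (rule gronwall_step) (use L0 D0 B0 \<tau> in auto)
      then show ?case using st(1) sob_le_mono[OF le] by blast
    qed
    then show ?thesis using sob_le_mono bnd[OF nN] by blast
  qed
  {
    case 0
    show ?case
      unfolding F_def[symmetric] G_def[symmetric] U_def[symmetric]
    proof (rule gronwall[OF 0])
      fix n assume n: "Suc n \<le> N" "U n 0 \<in> sobolev r"
      have "U (Suc n) 0 = G (U n 0)" by (simp add: U_def)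
      moreover have "sob_le r (\<lambda>j. - (fc (F (u (real n * \<tau>))) j - fc (G (u (real n * \<tau>))) j)) (D * \<tau>\<^sup>2 * M)"
        by (intro sob_le_uminus defect us M tn) (use n in auto)
      ultimately show "U (Suc n) 0 \<in> sobolev r \<and>
          sob_le r (?X n 0) (D * \<tau>\<^sup>2 * (M * (S * \<tau>) ^ 0))"
        using Gs[OF n(2)] by simp
    qed
  next
    case (Suc k)
    have IH: "U n k \<in> sobolev r" "sob_le r (?e n k) (M * (S * \<tau>) ^ Suc k)" if "n \<le> N" for n
      using Suc.IH[OF that] by (auto simp: F_def G_def U_def)
    show ?case
      unfolding F_def[symmetric] G_def[symmetric] U_def[symmetric]
    proof (rule gronwall[OF Suc.prems])
      fix n assume n: "Suc n \<le> N" "U n (Suc k) \<in> sobolev r"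
      then have nN: "n \<le> N" by simp
      \<comment> \<open>The previous iterate lies in the ball, so the fine propagator acts on data
        for which a mild solution exists over a full coarse step.\<close>
      note b = ball[OF nN IH(2)[OF nN] small_pow]
      have unb: "sob_le r (fc (u (real n * \<tau>))) (M + 1)" using M[OF tn[OF nN]] by (rule sob_le_mono) simp
      note FU = Fs[OF IH(1)[OF nN] b] and GU = Gs[OF IH(1)[OF nN]]
      have U: "U (Suc n) (Suc k) = (\<lambda>x. G (U n (Suc k)) x + (F (U n k) x - G (U n k) x))" by (simp add: U_def)
      have s: "U (Suc n) (Suc k) \<in> sobolev r"
        unfolding U by (intro sobolev_add sobolev_diff Gs n FU GU)
      have "fc (U (Suc n) (Suc k)) j = fc (G (U n (Suc k))) j + (fc (F (U n k)) j - fc (G (U n k)) j)" for j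
        unfolding U using sobolev_integrable[OF Gs[OF n(2)]] sobolev_integrable[OF FU] sobolev_integrable[OF GU]
        by (simp add: fourier_coeff_add fourier_coeff_diff)
      moreover have "sob_le r (\<lambda>j. (fc (F (U n k)) j - fc (G (U n k)) j)
          - (fc (F (u (real n * \<tau>))) j - fc (G (u (real n * \<tau>))) j)) (D * \<tau>\<^sup>2 * (M * (S * \<tau>) ^ Suc k))"
        by (rule defect_lip[OF IH(1)[OF nN] b us[OF tn[OF nN]] unb IH(2)[OF nN]])
      ultimately show "U (Suc n) (Suc k) \<in> sobolev r \<and>
          sob_le r (?X n (Suc k)) (D * \<tau>\<^sup>2 * (M * (S * \<tau>) ^ Suc k))"
        using s by simp
    qed
  }
qed

theorem corollary4p1:
  fixes \<mu> :: complex and r T :: real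
    and u0 :: "real \<Rightarrow> complex" and u :: "real \<Rightarrow> real \<Rightarrow> complex"
  assumes "r > 1 / 2" and "T > 0"
    and "exact_solution \<mu> r T u0 u"
  shows "\<exists>\<tau>0 > 0. \<exists>C1 > 0. \<exists>C2 > 0.
    \<forall>\<tau> N k. 0 < \<tau> \<and> \<tau> \<le> \<tau>0 \<and> T / \<tau> = real N \<longrightarrow>
      (let U = parareal (fine_propagator \<mu> r \<tau>) (coarse_propagator \<mu> \<tau>) u0 in
        (\<forall>n\<in>{1..N}. U n k \<in> sobolev r) \<and>
        (MAX n\<in>{1..N}. norm_sobolev r (\<lambda>x. U n k x - u (real n * \<tau>) x)) \<le> C1 * (C2 * \<tau>) ^ k)"
proof -
  note r = assms(1) and T = assms(2) and u = assms(3)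
  have cu: "continuous_into_sobolev r T u" using u by (simp add: exact_solution_def)
  obtain M where M: "\<And>t. t \<in> {0..T} \<Longrightarrow> sob_le r (fc (u t)) M"
    using continuous_into_sobolev_bounded[OF cu] by blast
  have M0: "M \<ge> 0" using sob_le_nonneg[OF M[of 0]] T by simp
  obtain \<tau>1 where \<tau>1: "\<tau>1 > 0" and ex: "\<And>\<tau> v0. 0 \<le> \<tau> \<Longrightarrow> \<tau> \<le> \<tau>1 \<Longrightarrow> sob_le r v0 (M + 1) \<Longrightarrow>
     \<exists>v. mild \<mu> r \<tau> v \<and> v 0 = v0 \<and> admissible r \<tau> (M + 1 + 1) v"
    using mild_local_existence[OF r, of "M + 1" \<mu>] M0 by auto
  define S where "S = T * exp (lip \<mu> r (M + 2) * T) * defect_const \<mu> r (M + 2)"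
  have S0: "S \<ge> 0" unfolding S_def using T M0 by (intro mult_nonneg_nonneg defect_const_nonneg) auto
  \<comment> \<open>The three constraints are local existence over one coarse step, the condition
    \<tau> \<le> 1 of the defect estimate, and the smallness of both S \<tau> and M S
    \<tau>.\<close>
  define \<tau>0 where "\<tau>0 = min (min \<tau>1 1) (1 / ((M + 1) * (S + 1)))"
  have \<tau>0: "\<tau>0 > 0" using \<tau>1 M0 S0 by (simp add: \<tau>0_def)
  \<comment> \<open>The factor sqrt (2 pi) converts coefficient bounds into the Sobolev norm; M and
    S are increased by 1 to make both constants positive.\<close>
  have C1: "sqrt (2 * pi) * (M + 1) > 0" and C2: "S + 1 > 0" using M0 S0 by auto
  show ?thesis
  proof (rule exI[of _ \<tau>0], rule conjI[OF \<tau>0], rule exI[of _ "sqrt (2 * pi) * (M + 1)"], rule conjI[OF C1],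
      rule exI[of _ "S + 1"], rule conjI[OF C2], intro allI impI)
    fix \<tau> N k assume "0 < \<tau> \<and> \<tau> \<le> \<tau>0 \<and> T / \<tau> = real N"
    then have \<tau>: "0 < \<tau>" "\<tau> \<le> \<tau>0" and N: "real N * \<tau> = T" by (auto simp: field_simps)
    have \<tau>': "\<tau> \<le> 1" "\<tau> \<le> \<tau>1" "\<tau> \<le> 1 / ((M + 1) * (S + 1))" using \<tau> by (auto simp: \<tau>0_def)
    \<comment> \<open>The maximum is then over a nonempty set.\<close>
    have "N \<noteq> 0" using N T by (cases "N = 0") simp_all
    have "(M + 1) * (S + 1) > 0" using M0 S0 by simp
    then have "((M + 1) * (S + 1)) * \<tau> \<le> 1" using \<tau>'(3) by (simp only: pos_le_divide_eq mult.commute)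
    moreover have "M * (S * \<tau>) \<le> ((M + 1) * (S + 1)) * \<tau>" "S * \<tau> \<le> ((M + 1) * (S + 1)) * \<tau>"
      using M0 S0 \<tau> by (auto simp: algebra_simps)
    ultimately have small: "M * (S * \<tau>) \<le> 1" "S * \<tau> \<le> 1" by linarith+
    define U where "U = parareal (fine_propagator \<mu> r \<tau>) (coarse_propagator \<mu> \<tau>) u0"
    have err: "U n k \<in> sobolev r" "sob_le r (\<lambda>j. fc (U n k) j - fc (u (real n * \<tau>)) j) (M * (S * \<tau>) ^ Suc k)"
      if "n \<le> N" for n
    proof -
      have two: "M + 1 + 1 = M + 2" by simp
      have "real N * \<tau> \<le> T" using N by simp
      from parareal_error[OF u r \<tau>(1) \<tau>'(1) M ex[OF less_imp_le[OF \<tau>(1)] \<tau>'(2), unfolded two] S_def small this that, of k]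
      show "U n k \<in> sobolev r" "sob_le r (\<lambda>j. fc (U n k) j - fc (u (real n * \<tau>)) j) (M * (S * \<tau>) ^ Suc k)"
        unfolding U_def by blast+
    qed
    have norm: "norm_sobolev r (\<lambda>x. U n k x - u (real n * \<tau>) x) \<le> sqrt (2 * pi) * (M + 1) * ((S + 1) * \<tau>) ^ k"
      if n: "n \<le> N" for n
    proof -
      have "real n * \<tau> \<le> T" using n \<tau> N mult_right_mono[of "real n" "real N" \<tau>] by simp
      then have us: "u (real n * \<tau>) \<in> sobolev r" using cu \<tau> by (simp add: continuous_into_sobolev_def)
      have "norm_sobolev r (\<lambda>x. U n k x - u (real n * \<tau>) x) \<le> sqrt (2 * pi) * (M * (S * \<tau>) ^ Suc k)"
        unfolding norm_sobolev_le_iff[OF sobolev_diff[OF err(1)[OF n] us]] fourier_coeff_sobolev_diff[OF err(1)[OF n] us]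
        by (rule err(2)[OF n])
      \<comment> \<open>The error has order k + 1 in \<tau>; its additional factor S \<tau> is
        bounded by 1, as the claim asks for order k.\<close>
      also have "\<dots> \<le> sqrt (2 * pi) * ((M + 1) * ((S + 1) * \<tau>) ^ k)"
      proof (intro mult_left_mono mult_mono)
        have "(S * \<tau>) * (S * \<tau>) ^ k \<le> 1 * ((S + 1) * \<tau>) ^ k"
          by (intro mult_mono power_mono small mult_right_mono) (use S0 \<tau> in auto)
        then show "(S * \<tau>) ^ Suc k \<le> ((S + 1) * \<tau>) ^ k" by simp
      qed (use M0 S0 \<tau> in auto)
      finally show ?thesis by (simp add: mult.assoc)
    qed
    show "let U = parareal (fine_propagator \<mu> r \<tau>) (coarse_propagator \<mu> \<tau>) u0 in
        (\<forall>n\<in>{1..N}. U n k \<in> sobolev r) \<and>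
        (MAX n\<in>{1..N}. norm_sobolev r (\<lambda>x. U n k x - u (real n * \<tau>) x)) \<le> sqrt (2 * pi) * (M + 1) * ((S + 1) * \<tau>) ^ k"
      unfolding Let_def U_def[symmetric]
    proof (intro conjI ballI)
      fix n assume "n \<in> {1..N}"
      then show "U n k \<in> sobolev r" by (intro err(1)) simp
    next
      show "(MAX n\<in>{1..N}. norm_sobolev r (\<lambda>x. U n k x - u (real n * \<tau>) x)) \<le> sqrt (2 * pi) * (M + 1) * ((S + 1) * \<tau>) ^ k"
        by (rule Max.boundedI) (use \<open>N \<noteq> 0\<close> norm in auto)
    qed
  qed
qed

end
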